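(* Let $\underline Q$ be a skewed-gentle polarized quiver and $F:\underline{\widehat Q}\to\underline Q$ the canonical morphism starting in the associated gentle polarized quiver $\underline{\widehat Q}$. Then $\mathbf x\in \mathrm{St}(\underline{\widehat Q})\cup \mathrm{pBa}(\underline{\widehat Q})$ is admissible if and only if $\mathbf x=A(\mathbf w)^{\pm 1}$ for some $\mathbf w\in \mathrm{St}(\underline Q)\cup \mathrm{pBa}'(\underline Q)$. In particular, all the words $A(\mathbf w)$ with $\mathbf w\in \mathrm{St}(\underline Q)\cup \mathrm{pBa}'(\underline Q)$ are admissible strings or bands, and $\overline{A(\mathbf w)}=\mathbf w$.
   Context: **Polarized quivers.** A skewed-gentle polarized quiver $\underline Q$ consists of finite sets $Q_0$ (vertices) and $Q_1=Q_1^{sp}\sqcup Q_1^{ord}$ (special and ordinary arrows) and injective maps $\underline s=(s,s_1),\ \underline t=(t,t_1):Q_1\to Q_0\times\{-1,1\}$, such that every special arrow is a loop $\varepsilon$ with $s_1(\varepsilon)=t_1(\varepsilon)=-1$, and such that there are only finitely many admissible paths, i.e. sequences of arrows $\alpha_1\cdots\alpha_l$ with $\underline s(\alpha_k)=-\underline t(\alpha_{k+1})$, where $-(i,\rho):=(i,-\rho)$. At each vertex $i$ there is at most one special loop, denoted $\varepsilon_i$; $Q_0^{sp}$ is the set of vertices with a special loop. $\underline Q$ is gentle if $Q_1^{sp}=\emptyset$. **Letters.** The letters of $\underline Q$ are: ordinary (direct) letters $\alpha$ and inverse letters $\alpha^{-1}$ for $\alpha\in Q_1^{ord}$, with $\underline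 s(\alpha^{-1})=\underline t(\alpha)$, $\underline t(\alpha^{-1})=\underline s(\alpha)$; a special letter $\varepsilon_i^*$ for each $i\in Q_0^{sp}$, with $\underline s(\varepsilon_i^* )=\underline t(\varepsilon_i^* )=(i,-1)$ and $(\varepsilon_i^* )^{-1}=\varepsilon_i^*$; and for each $(i,\rho)\in Q_0\times\{-1,1\}$ not of the form $(i,-1)$ with $i\in Q_0^{sp}$, a trivial letter $\mathbf 1_{i,\rho}$ with $\underline t=(i,\rho)$, $\underline s=*$, and its inverse $\mathbf 1_{i,\rho}^{-1}$ with $\underline s=(i,\rho)$, $\underline t=*$. Two distinct letters are comparable iff they have the same $\underline t\in Q_0\times\{-1,1\}$, and then $\alpha<\mathbf 1_{i,\rho}<\beta^{-1}$ (for $\alpha,\beta\in Q_1^{ord}$ with $\underline t(\alpha)=(i,\rho)=\underline s(\beta)$). **Words.** A word is a sequence of letters $w_0w_1\cdots w_n$ with $\underline s(w_k)=-\underline t(w_{k+1})\in Q_0\times\{-1,1\}$; $\mathbf w_{[k]}:=w_0\cdots w_k$, $\mathbf w^{[k]}:=w_k\cdots w_n$, $\mathbf w^{-1}:=w_n^{-1}\cdots w_0^{-1}$. Words are compared lexicographically: $\mathbf v<\mathbf w$ iff $\mathbf v=\mathbf u v\cdots$, $\mathbf w=\mathbf u w\cdots$ with letters $v<w$. A string is a word whose first letter is an inverse trivial letter and whose last letter is a trivial letter; $\mathrm{St}(\underline Q)$ is the set of strings. A string is symmetric if $\mathbf w=\mathbf w^{-1}$; then $\mathbf w=\mathbf v\varepsilon^*\mathbf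 v^{-1}$. A band is a (nonempty) word $\mathbf w$ such that $\mathbf w\mathbf w$ is a word; it is primitive if it is not a proper power; a rotation of $\mathbf w$ is $\mathbf w^{[k+1]}\mathbf w_{[k]}$. A primitive band is symmetric if its inverse is one of its rotations; equivalently some rotation is of the form $\varepsilon_a^*\mathbf v\varepsilon_b^*\mathbf v^{-1}$ (standard form). $\mathrm{pBa}(\underline Q)$ is the set of primitive bands, and $\mathrm{pBa}'(\underline Q)\subset\mathrm{pBa}(\underline Q)$ consists of all asymmetric primitive bands and of the symmetric primitive bands in standard form. **Associated gentle quiver.** $\underline{\widehat Q}$ has the same vertices, arrows and maps $\underline s,\underline t$ as $\underline Q$, but all arrows are declared ordinary. Hence for each $i\in Q_0^{sp}$ there are the letters $\varepsilon_i,\varepsilon_i^{-1}$ and the punctured letters $\mathbf 1_{i,-1}^{\pm1}$, with $\varepsilon_i\prec\mathbf 1_{i,-1}\prec\varepsilon_i^{-1}$; the order on letters and words of $\underline{\widehat Q}$ is denoted $\prec$. $F$ maps words of $\underline{\widehat Q}$ to words of $\underline Q$ letterwise, sending $\varepsilon_i^{\pm1},\mathbf 1_{i,-1}^{\pm1}$ ($i\in Q_0^{sp}$) to $\varepsilon_i^*$ and fixing all other letters. A string $x_0\cdots x_l$ of $\underline{\widehat Q}$ has type $(a,b)\in\{u,p\}^2$, with $a=p$ iff $x_0$ is punctured and $b=p$ iff $x_l$ is punctured. **Completion.** For $\mathbf x=x_0\cdots x_l$ a string of $\underline{\widehat Q}$: $\overline{\mathbf x}:=F(\mathbf x)$ for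 type $(u,u)$; $F(\mathbf x)F(x_{l-1}^{-1}\cdots x_0^{-1})$ for type $(u,p)$; $F(x_l^{-1}\cdots x_1^{-1})F(\mathbf x)$ for type $(p,u)$; $F(\mathbf x)F(x_{l-1}^{-1}\cdots x_1^{-1})$ for type $(p,p)$. For a band $\mathbf x$, $\overline{\mathbf x}:=F(\mathbf x)$. **Admissible.** A string $\mathbf x=x_0\cdots x_n$ of $\underline{\widehat Q}$ is admissible if (i) for every $k\in\{1,\dots,n-1\}$ with $F(x_k)$ special, $\mathbf x_{[k-1]}^{-1}\neq\mathbf x^{[k+1]}$, and $x_k$ is direct iff $\mathbf x_{[k-1]}^{-1}\succ\mathbf x^{[k+1]}$; (ii) if $\mathbf x$ is of type $(p,p)$, then $\overline{\mathbf x}$ is a primitive band. A band $\mathbf x=x_0\cdots x_n$ of $\underline{\widehat Q}$ is admissible if (i) for every $k\in\{0,\dots,n\}$ with $F(x_k)$ special, $(\mathbf x^{[k+1]}\mathbf x_{[k-1]})^{-1}\neq\mathbf x^{[k+1]}\mathbf x_{[k-1]}$, and $x_k$ is direct iff $(\mathbf x^{[k+1]}\mathbf x_{[k-1]})^{-1}\succ\mathbf x^{[k+1]}\mathbf x_{[k-1]}$; (ii) $F(\mathbf x)$ is a primitive asymmetric band of $\underline Q$. **The words $A(\mathbf w)$.** For $\mathbf w=w_0\cdots w_n$ an asymmetric string, $A(\mathbf w)=a_0\cdots a_n$ with $a_i=w_i$ if $w_i$ is not special; if $w_i=\varepsilon^*$, then $a_i=\varepsilon$ if $\mathbf w_{[i-1]}^{-1}>\mathbf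 w^{[i+1]}$ and $a_i=\varepsilon^{-1}$ if $\mathbf w_{[i-1]}^{-1}<\mathbf w^{[i+1]}$. For a symmetric string $\mathbf w=v_0\cdots v_{m-1}\varepsilon_b^*v_{m-1}^{-1}\cdots v_0^{-1}$, $A(\mathbf w)=a_0\cdots a_{m-1}\mathbf 1_{b,-1}$ with the $a_i$ given by the same rule applied to $\mathbf w$. For an asymmetric primitive band $\mathbf w=w_0\cdots w_n$, $A(\mathbf w)=a_0\cdots a_n$ with $a_i=w_i$ if $w_i$ is not special; if $w_i=\varepsilon^*$, then $a_i=\varepsilon$ if $(\mathbf w^{[i+1]}\mathbf w_{[i-1]})^{-1}>\mathbf w^{[i+1]}\mathbf w_{[i-1]}$ and $a_i=\varepsilon^{-1}$ if $(\mathbf w^{[i+1]}\mathbf w_{[i-1]})^{-1}<\mathbf w^{[i+1]}\mathbf w_{[i-1]}$. For a symmetric band in standard form $\mathbf w=\varepsilon_a^*v_1\cdots v_{n-1}\varepsilon_b^*v_{n-1}^{-1}\cdots v_1^{-1}$, $A(\mathbf w)=\mathbf 1_{a,-1}^{-1}a_1\cdots a_{n-1}\mathbf 1_{b,-1}$ with the $a_i$ given by the band rule applied to $\mathbf w$. *)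

theory Defs
  imports Main
begin

section \<open>Skewed-gentle polarized quivers\<close>

record ('v, 'a) polarized_quiver =
  verts :: "'v set"
  special :: "'a set"
  ordinary :: "'a set"
  src :: "'a \<Rightarrow> 'v \<times> int"
  tgt :: "'a \<Rightarrow> 'v \<times> int"

definition arrows :: "('v, 'a) polarized_quiver \<Rightarrow> 'a set" where
  "arrows Q = special Q \<union> ordinary Q"

definition neg :: "'v \<times> int \<Rightarrow> 'v \<times> int" where
  "neg p = (fst p, - snd p)"

definition admissible_path :: "('v, 'a) polarized_quiver \<Rightarrow> 'a list \<Rightarrow> bool" where
  "admissible_path Q p \<longleftrightarrow>
     p \<noteq> [] \<and> set p \<subseteq> arrows Q \<and> successively (\<lambda>a b. src Q a = neg (tgt Q b)) p"

definition skewed_gentle :: "('v, 'a) polarized_quiver \<Rightarrow> bool" where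
  "skewed_gentle Q \<longleftrightarrow>
     finite (verts Q) \<and> finite (special Q) \<and> finite (ordinary Q) \<and>
     special Q \<inter> ordinary Q = {} \<and>
     src Q ` arrows Q \<subseteq> verts Q \<times> {-1, 1} \<and> inj_on (src Q) (arrows Q) \<and>
     tgt Q ` arrows Q \<subseteq> verts Q \<times> {-1, 1} \<and> inj_on (tgt Q) (arrows Q) \<and>
     (\<forall>e\<in>special Q. fst (src Q e) = fst (tgt Q e) \<and> snd (src Q e) = -1 \<and> snd (tgt Q e) = -1) \<and>
     finite {p. admissible_path Q p}"

definition special_verts :: "('v, 'a) polarized_quiver \<Rightarrow> 'v set" where
  "special_verts Q = (\<lambda>e. fst (src Q e)) ` special Q"

text \<open>Unique for a special vertex, since \<^const>\<open>src\<close> is injective on arrows.\<close>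

definition special_loop :: "('v, 'a) polarized_quiver \<Rightarrow> 'v \<Rightarrow> 'a" where
  "special_loop Q i = (THE e. e \<in> special Q \<and> fst (src Q e) = i)"


section \<open>Letters and words\<close>

datatype ('v, 'a) letter =
    Dir 'a
  | Inv 'a
  | Star (star_vertex: 'v)
  | Triv 'v int
  | TrivInv 'v int

type_synonym ('v, 'a) word = "('v, 'a) letter list"

definition letters :: "('v, 'a) polarized_quiver \<Rightarrow> ('v, 'a) letter set" where
  "letters Q =
     Dir ` ordinary Q \<union> Inv ` ordinary Q \<union> Star ` special_verts Q \<union>
     {Triv i r | i r. i \<in> verts Q \<and> r \<in> {-1, 1} \<and> \<not> (i \<in> special_verts Q \<and> r = -1)} \<union>
     {TrivInv i r | i r. i \<in> verts Q \<and> r \<in> {-1, 1} \<and> \<not> (i \<in> special_verts Q \<and> r = -1)}"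

text \<open>The value \<^const>\<open>None\<close> stands for the symbol \<open>*\<close> of the trivial letters.\<close>

fun lsrc :: "('v, 'a) polarized_quiver \<Rightarrow> ('v, 'a) letter \<Rightarrow> ('v \<times> int) option" where
  "lsrc Q (Dir a) = Some (src Q a)"
| "lsrc Q (Inv a) = Some (tgt Q a)"
| "lsrc Q (Star i) = Some (i, -1)"
| "lsrc Q (Triv i r) = None"
| "lsrc Q (TrivInv i r) = Some (i, r)"

fun ltgt :: "('v, 'a) polarized_quiver \<Rightarrow> ('v, 'a) letter \<Rightarrow> ('v \<times> int) option" where
  "ltgt Q (Dir a) = Some (tgt Q a)"
| "ltgt Q (Inv a) = Some (src Q a)"
| "ltgt Q (Star i) = Some (i, -1)"
| "ltgt Q (Triv i r) = Some (i, r)"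
| "ltgt Q (TrivInv i r) = None"

fun linv :: "('v, 'a) letter \<Rightarrow> ('v, 'a) letter" where
  "linv (Dir a) = Inv a"
| "linv (Inv a) = Dir a"
| "linv (Star i) = Star i"
| "linv (Triv i r) = TrivInv i r"
| "linv (TrivInv i r) = Triv i r"

definition is_direct :: "('v, 'a) letter \<Rightarrow> bool" where
  "is_direct x \<longleftrightarrow> (\<exists>a. x = Dir a)"

definition is_special :: "('v, 'a) letter \<Rightarrow> bool" where
  "is_special x \<longleftrightarrow> (\<exists>i. x = Star i)"

definition letter_less ::
  "('v, 'a) polarized_quiver \<Rightarrow> ('v, 'a) letter \<Rightarrow> ('v, 'a) letter \<Rightarrow> bool" where
  "letter_less Q x y \<longleftrightarrow>
     x \<in> letters Q \<and> y \<in> letters Q \<and> ltgt Q x = ltgt Q y \<and> ltgt Q x \<noteq> None \<and>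
     ((\<exists>a i r. x = Dir a \<and> y = Triv i r) \<or>
      (\<exists>i r b. x = Triv i r \<and> y = Inv b) \<or>
      (\<exists>a b. x = Dir a \<and> y = Inv b))"

definition word_less ::
  "('v, 'a) polarized_quiver \<Rightarrow> ('v, 'a) word \<Rightarrow> ('v, 'a) word \<Rightarrow> bool" where
  "word_less Q v w \<longleftrightarrow>
     (\<exists>u x y v' w'. v = u @ x # v' \<and> w = u @ y # w' \<and> letter_less Q x y)"

definition winv :: "('v, 'a) word \<Rightarrow> ('v, 'a) word" where
  "winv w = rev (map linv w)"

definition is_word :: "('v, 'a) polarized_quiver \<Rightarrow> ('v, 'a) word \<Rightarrow> bool" where
  "is_word Q w \<longleftrightarrow>
     set w \<subseteq> letters Q \<and>
     successively (\<lambda>x y. \<exists>p. lsrc Q x = Some p \<and> ltgt Q y = Some (neg p)) w"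

definition strings :: "('v, 'a) polarized_quiver \<Rightarrow> ('v, 'a) word set" where
  "strings Q =
     {w. is_word Q w \<and> w \<noteq> [] \<and> (\<exists>i r. hd w = TrivInv i r) \<and> (\<exists>i r. last w = Triv i r)}"

definition bands :: "('v, 'a) polarized_quiver \<Rightarrow> ('v, 'a) word set" where
  "bands Q = {w. w \<noteq> [] \<and> is_word Q w \<and> is_word Q (w @ w)}"

definition pbands :: "('v, 'a) polarized_quiver \<Rightarrow> ('v, 'a) word set" where
  "pbands Q = {w \<in> bands Q. \<not> (\<exists>u n. 2 \<le> n \<and> w = concat (replicate n u))}"

definition symmetric_string :: "('v, 'a) word \<Rightarrow> bool" where
  "symmetric_string w \<longleftrightarrow> w = winv w"

definition symmetric_band :: "('v, 'a) word \<Rightarrow> bool" where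
  "symmetric_band w \<longleftrightarrow> (\<exists>k. winv w = rotate k w)"

definition standard_form :: "('v, 'a) word \<Rightarrow> bool" where
  "standard_form w \<longleftrightarrow> (\<exists>a b v. w = Star a # v @ Star b # winv v)"

definition pbands' :: "('v, 'a) polarized_quiver \<Rightarrow> ('v, 'a) word set" where
  "pbands' Q = {w \<in> pbands Q. \<not> symmetric_band w} \<union>
               {w \<in> pbands Q. symmetric_band w \<and> standard_form w}"


section \<open>The associated gentle quiver, completion and admissibility\<close>

definition hat :: "('v, 'a) polarized_quiver \<Rightarrow> ('v, 'a) polarized_quiver" where
  "hat Q = Q\<lparr>special := {}, ordinary := arrows Q\<rparr>"

fun F_letter :: "('v, 'a) polarized_quiver \<Rightarrow> ('v, 'a) letter \<Rightarrow> ('v, 'a) letter" where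
  "F_letter Q (Dir a) = (if a \<in> special Q then Star (fst (src Q a)) else Dir a)"
| "F_letter Q (Inv a) = (if a \<in> special Q then Star (fst (src Q a)) else Inv a)"
| "F_letter Q (Star i) = Star i"
| "F_letter Q (Triv i r) = (if i \<in> special_verts Q \<and> r = -1 then Star i else Triv i r)"
| "F_letter Q (TrivInv i r) = (if i \<in> special_verts Q \<and> r = -1 then Star i else TrivInv i r)"

definition F_word :: "('v, 'a) polarized_quiver \<Rightarrow> ('v, 'a) word \<Rightarrow> ('v, 'a) word" where
  "F_word Q w = map (F_letter Q) w"

definition punctured :: "('v, 'a) polarized_quiver \<Rightarrow> ('v, 'a) letter \<Rightarrow> bool" where
  "punctured Q x \<longleftrightarrow> (\<exists>i\<in>special_verts Q. x = Triv i (-1) \<or> x = TrivInv i (-1))"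

definition completion_string ::
  "('v, 'a) polarized_quiver \<Rightarrow> ('v, 'a) word \<Rightarrow> ('v, 'a) word" where
  "completion_string Q x =
     (case (punctured Q (hd x), punctured Q (last x)) of
        (False, False) \<Rightarrow> F_word Q x
      | (False, True) \<Rightarrow> F_word Q x @ F_word Q (winv (butlast x))
      | (True, False) \<Rightarrow> F_word Q (winv (tl x)) @ F_word Q x
      | (True, True) \<Rightarrow> F_word Q x @ F_word Q (winv (butlast (tl x))))"

text \<open>No word is both a string and a band, so that the case distinctions in
  \<open>completion\<close>, \<open>admissible\<close> and \<open>A_word\<close> below are unambiguous.\<close>

definition completion ::
  "('v, 'a) polarized_quiver \<Rightarrow> ('v, 'a) word \<Rightarrow> ('v, 'a) word" where
  "completion Q x = (if x \<in> strings (hat Q) then completion_string Q x else F_word Q x)"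

definition admissible_string :: "('v, 'a) polarized_quiver \<Rightarrow> ('v, 'a) word \<Rightarrow> bool" where
  "admissible_string Q x \<longleftrightarrow>
     x \<in> strings (hat Q) \<and>
     (\<forall>k\<in>{0<..<length x - 1}. is_special (F_letter Q (x ! k)) \<longrightarrow>
        winv (take k x) \<noteq> drop (Suc k) x \<and>
        (is_direct (x ! k) \<longleftrightarrow> word_less (hat Q) (drop (Suc k) x) (winv (take k x)))) \<and>
     (punctured Q (hd x) \<and> punctured Q (last x) \<longrightarrow> completion Q x \<in> pbands Q)"

text \<open>For a band \<open>w\<close> this is the word \<open>w\<^sub>k\<^sub>+\<^sub>1 \<dots> w\<^sub>n w\<^sub>0 \<dots> w\<^sub>k\<^sub>-\<^sub>1\<close>.\<close>

definition cut :: "nat \<Rightarrow> ('v, 'a) word \<Rightarrow> ('v, 'a) word" where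
  "cut k w = drop (Suc k) w @ take k w"

definition admissible_band :: "('v, 'a) polarized_quiver \<Rightarrow> ('v, 'a) word \<Rightarrow> bool" where
  "admissible_band Q x \<longleftrightarrow>
     x \<in> bands (hat Q) \<and>
     (\<forall>k\<in>{0..<length x}. is_special (F_letter Q (x ! k)) \<longrightarrow>
        winv (cut k x) \<noteq> cut k x \<and>
        (is_direct (x ! k) \<longleftrightarrow> word_less (hat Q) (cut k x) (winv (cut k x)))) \<and>
     F_word Q x \<in> pbands Q \<and> \<not> symmetric_band (F_word Q x)"

definition admissible :: "('v, 'a) polarized_quiver \<Rightarrow> ('v, 'a) word \<Rightarrow> bool" where
  "admissible Q x \<longleftrightarrow> admissible_string Q x \<or> admissible_band Q x"


section \<open>The words \<open>A(w)\<close>\<close>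

text \<open>The letter replacing \<open>x\<close> in \<open>A(w)\<close>, where \<open>v\<close> and \<open>v'\<close> are the two words read from the
  position of \<open>x\<close> in the inverse and in the given direction. For the words \<open>w\<close> and positions
  considered, these are always comparable when \<open>x\<close> is special.\<close>

definition A_letter ::
  "('v, 'a) polarized_quiver \<Rightarrow> ('v, 'a) letter \<Rightarrow> ('v, 'a) word \<Rightarrow> ('v, 'a) word
     \<Rightarrow> ('v, 'a) letter" where
  "A_letter Q x v v' =
     (if is_special x then
        (if word_less Q v' v then Dir (special_loop Q (star_vertex x))
         else if word_less Q v v' then Inv (special_loop Q (star_vertex x))
         else undefined)
      else x)"

definition A_string_letter ::
  "('v, 'a) polarized_quiver \<Rightarrow> ('v, 'a) word \<Rightarrow> nat \<Rightarrow> ('v, 'a) letter" where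
  "A_string_letter Q w i = A_letter Q (w ! i) (winv (take i w)) (drop (Suc i) w)"

definition A_band_letter ::
  "('v, 'a) polarized_quiver \<Rightarrow> ('v, 'a) word \<Rightarrow> nat \<Rightarrow> ('v, 'a) letter" where
  "A_band_letter Q w i = A_letter Q (w ! i) (winv (cut i w)) (cut i w)"

text \<open>A symmetric string has odd length \<open>2 m + 1\<close> and its special middle letter sits at position
  \<open>m\<close>; a symmetric band in standard form has even length \<open>2 n\<close> and the two special letters
  \<open>\<epsilon>\<^sub>a\<^sup>*\<close>, \<open>\<epsilon>\<^sub>b\<^sup>*\<close> sit at positions \<open>0\<close> and \<open>n\<close>.\<close>

definition A_string ::
  "('v, 'a) polarized_quiver \<Rightarrow> ('v, 'a) word \<Rightarrow> ('v, 'a) word" where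
  "A_string Q w =
     (if symmetric_string w then
        (let m = length w div 2 in
         map (A_string_letter Q w) [0..<m] @ [Triv (star_vertex (w ! m)) (-1)])
      else map (A_string_letter Q w) [0..<length w])"

definition A_band ::
  "('v, 'a) polarized_quiver \<Rightarrow> ('v, 'a) word \<Rightarrow> ('v, 'a) word" where
  "A_band Q w =
     (if symmetric_band w then
        (let n = length w div 2 in
         TrivInv (star_vertex (w ! 0)) (-1) # map (A_band_letter Q w) [1..<n] @
           [Triv (star_vertex (w ! n)) (-1)])
      else map (A_band_letter Q w) [0..<length w])"

definition A_word :: "('v, 'a) polarized_quiver \<Rightarrow> ('v, 'a) word \<Rightarrow> ('v, 'a) word" where
  "A_word Q w = (if w \<in> strings Q then A_string Q w else A_band Q w)"

end

(* A special letter is lifted according to the comparison of the two words obtained by reading away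
   from it. Strings and bands are treated alike, as periodic sequences of letters (a string wraps
   around from its last letter to its first), so the comparison at a position k asks for the first
   deviation from mirror symmetry about k. Suppose that the reading to the right is the larger one
   in w, and that before the deviation the two readings pass special letters at k - d and k + d.
   Then at one of these two positions the reading to the right is larger as well, and the deviation
   occurs at a smaller distance. So one of them is lifted to an inverse loop, and whatever the lift
   of the other one is, the lifted readings at k agree there or deviate in the same direction as
   those of w. By induction on the distance, lifting by the comparisons of w and lifting by the
   comparisons of the lifted word itself amount to the same. A string ending in a punctured letter
   is unfolded by reflection, keeping the special letter at the centre in the place of the punctured
   one. *)
theory Submission
  imports Defs
begin

section \<open>Comparing a bi-infinite word with its mirror image\<close>

text \<open>All special letters are lifted at once, so a comparison in the lifted word runs into
  letters whose own lifts depend on other comparisons. From \<open>w\<close> to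
  \<open>A_word Q w\<close> this is harmless, since the comparisons of \<open>w\<close> give all
  lifts in advance. The converse starts from lifts only known to fit one another, and there the
  decreasing distance makes the argument well founded. Periodicity turns both readings into infinite
  half-lines, so neither is a proper prefix of the other: at a special letter they deviate, or the
  whole word is symmetric about it. Such centres are the only places without a decision. As two
  reflections compose to a translation, primitivity leaves at most one special centre per period in
  a string and two in a band. Condition (i) also demands that the two readings of the lift differ,
  which no comparison in \<open>w\<close> states directly. This comes from the asymmetry of
  \<open>w\<close>, from an unpunctured end facing a punctured one, or, between two punctured ends,
  from the middle letter being compared with its own inverse.\<close>

text \<open>The distance \<open>n\<close> of the first deviation is an argument because the
  induction runs on it. The left reading is the inverted one and is the first argument of
  \<open>R\<close>; so \<open>letter_less\<close> calls for an inverse loop at \<open>k\<close>, and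
  its converse for a direct one.\<close>

definition mirror_less ::
  "(('v, 'a) letter \<Rightarrow> ('v, 'a) letter \<Rightarrow> bool) \<Rightarrow> (int \<Rightarrow> ('v, 'a) letter) \<Rightarrow> int \<Rightarrow> int \<Rightarrow> bool"
  where "mirror_less R w k n \<longleftrightarrow>
    1 \<le> n \<and> (\<forall>s\<in>{1..<n}. w (k + s) = linv (w (k - s))) \<and> R (linv (w (k - n))) (w (k + n))"

text \<open>\<open>a\<close> is the sum of two mirrored positions, twice the centre, so that mirrors
  between two letters are covered too. Symmetry about the letter \<open>k\<close> has sum
  \<open>2 * k\<close>; a periodic word repeating some \<open>w = winv w\<close> has a mirror with
  sum -1.\<close>

definition reflects :: "(int \<Rightarrow> ('v, 'a) letter) \<Rightarrow> int \<Rightarrow> bool" where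
  "reflects w a \<longleftrightarrow> (\<forall>s. w (a - s) = linv (w s))"

lemma linv_linv [simp]: "linv (linv x) = x"
  by (cases x) auto

lemma linv_special: "is_special x \<Longrightarrow> linv x = x"
  by (auto simp: is_special_def)

lemma is_special_linv [simp]: "is_special (linv x) = is_special x"
  by (cases x) (auto simp: is_special_def)

text \<open>At the smaller of two different distances the other comparison demands equal letters; at
  equal distances both orders would hold.\<close>

lemma mirror_less_asym:
  assumes "mirror_less R w k n" "mirror_less R\<inverse>\<inverse> w k m"
    and "\<And>x y. R x y \<Longrightarrow> R y x \<Longrightarrow> False"
  shows False
proof -
  have irr: "\<not> R x x" for x using assms(3) by blast
  consider "n < m" | "m < n" | "n = m" by linarith
  then show False
  proof cases
    case 1
    then have "w (k + n) = linv (w (k - n))"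
      using assms(1,2) by (auto simp: mirror_less_def)
    then show False using assms(1) irr by (simp add: mirror_less_def)
  next
    case 2
    then have "w (k + m) = linv (w (k - m))"
      using assms(1,2) by (auto simp: mirror_less_def)
    then show False using assms(2) irr by (simp add: mirror_less_def)
  next
    case 3
    then show False using assms by (auto simp: mirror_less_def)
  qed
qed

lemma mirror_less_not_reflects:
  assumes "mirror_less R w k n" and "\<And>x. \<not> R x x"
  shows "\<not> reflects w (2 * k)"
proof
  assume "reflects w (2 * k)"
  then have "w (2 * k - (k - n)) = linv (w (k - n))" unfolding reflects_def by blast
  moreover have "2 * k - (k - n) = k + n" by simp
  ultimately show False using assms by (simp add: mirror_less_def)
qed

text \<open>A mirror exchanges the two readings, hence the converse relation.\<close>

lemma mirror_less_reflect:
  assumes "reflects w a" "mirror_less R w k n"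
  shows "mirror_less R\<inverse>\<inverse> w (a - k) n"
proof -
  have r: "w (a - k + s) = linv (w (k - s))" for s
    using assms(1) unfolding reflects_def by (metis diff_diff_eq2 diff_add_eq add_diff_eq)
  have "w (a - k - s) = linv (w (k + s))" for s
    using r[of "- s"] by simp
  with r assms(2) show ?thesis unfolding mirror_less_def by auto
qed

lemma mirror_less_shift:
  assumes "\<And>i. w (i + d) = w i" "mirror_less R w k n"
  shows "mirror_less R w (k + d) n"
proof -
  have "w (k + d + s) = w (k + s)" for s
    using assms(1)[of "k + s"] by (simp add: algebra_simps)
  moreover have "w (k + d - s) = w (k - s)" for s
    using assms(1)[of "k - s"] by (simp add: algebra_simps)
  ultimately show ?thesis using assms(2) by (simp add: mirror_less_def)
qed

text \<open>Two mirrors compose to a translation; this turns a second centre of symmetry into a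
  period.\<close>

lemma reflects_period:
  assumes "reflects w a" "reflects w b"
  shows "w (s + (a - b)) = w s"
proof -
  have "w (a - (b - s)) = w s" using assms unfolding reflects_def by (metis linv_linv)
  then show ?thesis by (simp add: algebra_simps)
qed

lemma reflects_shift:
  assumes "reflects w a" "\<And>i. w (i + d) = w i"
  shows "reflects w (a + d)"
  unfolding reflects_def
proof
  fix s
  have "w (a + d - s) = w (a - s)" using assms(2)[of "a - s"] by (simp add: algebra_simps)
  then show "w (a + d - s) = linv (w s)" using assms(1) by (simp add: reflects_def)
qed

text \<open>\<open>R\<close> orders the letters of \<open>w\<close>, \<open>r\<close> those of the
  lift \<open>X\<close>. No rule is imposed on \<open>X\<close> yet: both loops are allowed, and
  also the unlifted letter, which is meant for centres of symmetry. Comparability is demanded only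
  at a first deviation, where both readings continue from the same end.\<close>

locale lift_pair =
  fixes R r :: "('v, 'a) letter \<Rightarrow> ('v, 'a) letter \<Rightarrow> bool"
    and lo hi :: "('v, 'a) letter \<Rightarrow> ('v, 'a) letter"
    and w X :: "int \<Rightarrow> ('v, 'a) letter"
  assumes R_trans: "R x y \<Longrightarrow> R y z \<Longrightarrow> R x z"
    and R_asym: "R x y \<Longrightarrow> \<not> R y x"
    and R_ordinary: "R x y \<Longrightarrow> \<not> is_special x \<and> \<not> is_special y"
    and R_total: "is_special (w k) \<Longrightarrow> 1 \<le> n \<Longrightarrow>
      (\<forall>s\<in>{1..<n}. w (k + s) = linv (w (k - s))) \<Longrightarrow>
      w (k + n) = linv (w (k - n)) \<or> R (linv (w (k - n))) (w (k + n)) \<or>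
      R (w (k + n)) (linv (w (k - n)))"
    and X_ordinary: "\<not> is_special (w k) \<Longrightarrow> X k = w k"
    and X_special: "is_special (w k) \<Longrightarrow> X k = lo (w k) \<or> X k = w k \<or> X k = hi (w k)"
    and linv_lo: "is_special x \<Longrightarrow> linv (lo x) = hi x"
    and r_R: "R x y \<Longrightarrow> r x y"
    and r_special: "is_special (w k) \<Longrightarrow>
      r (lo (w k)) (w k) \<and> r (w k) (hi (w k)) \<and> r (lo (w k)) (hi (w k))"
begin

lemma linv_hi: "is_special x \<Longrightarrow> linv (hi x) = lo x"
  by (metis linv_lo linv_linv)

text \<open>Reversing the orders exchanges \<open>lo\<close> with \<open>hi\<close>, so each
  argument is carried out for inverse loops only.\<close>

lemma lift_pair_converse: "lift_pair R\<inverse>\<inverse> r\<inverse>\<inverse> hi lo w X"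
proof
  fix k n assume "is_special (w k)" "1 \<le> n" "\<forall>s\<in>{1..<n}. w (k + s) = linv (w (k - s))"
  from R_total[OF this] show "w (k + n) = linv (w (k - n)) \<or>
      R\<inverse>\<inverse> (linv (w (k - n))) (w (k + n)) \<or> R\<inverse>\<inverse> (w (k + n)) (linv (w (k - n)))"
    by auto
qed (use R_trans R_asym R_ordinary X_ordinary X_special linv_hi r_R r_special in blast)+

text \<open>Three letters compete: the outer ones at \<open>k - d - i\<close> and \<open>k + d + i\<close>, and the inner one at
  \<open>k - d + i\<close>, which is the mirror image of the one at \<open>k + d - i\<close>. At the first \<open>i\<close> where they do not
  all agree, the inner letter is below the right or above the left outer letter.\<close>

lemma mirror_less_descend:
  assumes k: "is_special (w k)" and less: "mirror_less R w k n"
    and d: "1 \<le> d" "d < n" and sp: "is_special (w (k - d))"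
  shows "\<exists>i<n. mirror_less R w (k - d) i \<or> mirror_less R w (k + d) i"
proof -
  let ?p = "k - d" and ?q = "k + d"
  \<comment> \<open>The symmetry extends to distance 0, where the special letter is its own inverse,
    and to negative distances by inverting the equation.\<close>
  have sym: "w (k + s) = linv (w (k - s))" if "\<bar>s\<bar> < n" for s
  proof -
    consider "s = 0" | "s \<ge> 1" | "- s \<ge> 1" by linarith
    then show ?thesis
    proof cases
      case 3
      then have "- s \<in> {1..<n}" using that by simp
      then have "w (k + (- s)) = linv (w (k - (- s)))"
        using less unfolding mirror_less_def by blast
      then show ?thesis by simp
    qed (use linv_special[OF k] that less in \<open>auto simp: mirror_less_def\<close>)
  qed
  \<comment> \<open>At distance \<open>n - d\<close> the outer letters sit at \<open>k - n\<close>
    and \<open>k + n\<close>, where \<open>w\<close> deviates, so \<open>ok\<close> fails there at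
    the latest.\<close>
  define M where "M = nat (n - d)"
  define ok where "ok i \<longleftrightarrow> linv (w (?p - int i)) = w (?q + int i) \<and>
      linv (w (?p - int i)) = w (?p + int i)" for i
  have M: "int M = n - d" using d by (simp add: M_def)
  have lessM: "R (linv (w (?p - int M))) (w (?q + int M))"
    using less by (simp add: M mirror_less_def)
  have irr: "\<not> R x x" for x using R_asym by blast
  have "\<not> ok M" using lessM irr by (auto simp: ok_def)
  moreover have "ok 0" using sym[of d] sp d linv_special by (auto simp: ok_def)
  ultimately obtain j where j: "j < M" "\<forall>i\<le>j. ok i" "\<not> ok (Suc j)"
    using ex_least_nat_less[of "\<lambda>i. \<not> ok i" M] by force
  define i where "i = int (Suc j)"
  have i: "1 \<le> i" "i \<le> n - d" "i < n" using j(1) M d by (auto simp: i_def)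
  have inner: "w (?p + s) = linv (w (?q - s))" if "0 \<le> s" "s \<le> i" for s
    using sym[of "s - d"] that i d by (simp add: algebra_simps)
  have ok': "linv (w (?p - s)) = w (?q + s)" "linv (w (?p - s)) = w (?p + s)"
    if "0 \<le> s" "s < i" for s
  proof -
    have "nat s \<le> j" using that by (simp add: i_def)
    then have "ok (nat s)" and "int (nat s) = s" using j(2) that by simp_all
    then show "linv (w (?p - s)) = w (?q + s)" "linv (w (?p - s)) = w (?p + s)"
      unfolding ok_def by metis+
  qed
  have p_sym: "\<forall>s\<in>{1..<i}. w (?p + s) = linv (w (?p - s))" using ok'(2) by auto
  have q_sym: "\<forall>s\<in>{1..<i}. w (?q + s) = linv (w (?q - s))"
    using ok' inner by (metis atLeastLessThan_iff less_imp_le order_trans zero_le_one)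
  have total: "w (?p + i) = linv (w (?p - i)) \<or> R (linv (w (?p - i))) (w (?p + i)) \<or>
      R (w (?p + i)) (linv (w (?p - i)))"
    by (rule R_total[OF sp i(1) p_sym])
  have nok: "linv (w (?p - i)) \<noteq> w (?q + i) \<or> linv (w (?p - i)) \<noteq> w (?p + i)"
    using j(3) by (auto simp: ok_def i_def)
  \<comment> \<open>For \<open>i = n - d\<close> the outer letters are strictly ordered and
    transitivity places the inner one. For smaller \<open>i\<close> they coincide by the symmetry
    about \<open>k\<close>, so the inner one differs from both.\<close>
  have "R (linv (w (?p - i))) (w (?p + i)) \<or> R (w (?p + i)) (w (?q + i))"
  proof (cases "i = n - d")
    case True
    then show ?thesis using total lessM R_trans by (metis M)
  next
    case False
    then have "i < n - d" using i by simp
    have "\<bar>d + i\<bar> < n" using \<open>i < n - d\<close> i d by simp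
    from sym[OF this] have "linv (w (?p - i)) = w (?q + i)" by (simp add: algebra_simps)
    then show ?thesis using nok total by metis
  qed
  then have "mirror_less R w ?p i \<or> mirror_less R w ?q i"
    using i(1) p_sym q_sym inner[of i] by (auto simp: mirror_less_def)
  then show ?thesis using i(3) by blast
qed

text \<open>Before distance \<open>n\<close> the lift can lose the symmetry only at a mirrored pair
  of special letters. By \<open>mirror_less_descend\<close> one of them is \<open>hi\<close>, which
  is the top choice on the right and, once inverted, the bottom choice on the left; so inequality at
  the pair already means \<open>r\<close>.\<close>

lemma mirror_less_lift:
  assumes k: "is_special (w k)" and less: "mirror_less R w k n"
    and hi: "\<And>p i. is_special (w p) \<Longrightarrow> i < n \<Longrightarrow> mirror_less R w p i \<Longrightarrow> X p = hi (w p)"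
  shows "\<exists>i. mirror_less r X k i"
proof (cases "\<forall>s\<in>{1..<n}. X (k + s) = linv (X (k - s))")
  case True
  \<comment> \<open>Letters related by \<open>R\<close> are not special, hence unlifted: the
    deviation of \<open>w\<close> survives in \<open>X\<close>.\<close>
  have "R (linv (w (k - n))) (w (k + n))" using less by (simp add: mirror_less_def)
  then have "mirror_less r X k n"
    using True less R_ordinary[of "linv (w (k - n))" "w (k + n)"] r_R X_ordinary
    by (auto simp: mirror_less_def)
  then show ?thesis ..
next
  case False
  define bad where "bad i \<longleftrightarrow> 1 \<le> i \<and> X (k + int i) \<noteq> linv (X (k - int i))" for i
  from False obtain s where s: "1 \<le> s" "s < n" "X (k + s) \<noteq> linv (X (k - s))" by auto
  then have bad_s: "bad (nat s)" by (auto simp: bad_def)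
  define d where "d = int (LEAST i. bad i)"
  have bad_d: "bad (nat d)" and d_le: "d \<le> s"
    using LeastI[of bad, OF bad_s] Least_le[of bad, OF bad_s] s(1) by (auto simp: d_def)
  have d: "1 \<le> d" "d < n" "X (k + d) \<noteq> linv (X (k - d))"
    using bad_d d_le s(2) by (auto simp: bad_def d_def)
  have sym: "X (k + i) = linv (X (k - i))" if "i \<in> {1..<d}" for i
    using not_less_Least[of "nat i" bad] that by (auto simp: bad_def d_def)
  let ?p = "k - d" and ?q = "k + d"
  have w_eq: "w ?q = linv (w ?p)" using less d by (auto simp: mirror_less_def)
  have sp: "is_special (w ?p)"
    using d(3) w_eq X_ordinary[of ?p] X_ordinary[of ?q] by (metis is_special_linv)
  have wq: "w ?q = w ?p" using w_eq sp linv_special by metis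
  obtain i where i: "i < n" "mirror_less R w ?p i \<or> mirror_less R w ?q i"
    using mirror_less_descend[OF k less d(1,2) sp] by blast
  have "X ?p = hi (w ?p) \<or> X ?q = hi (w ?p)"
    using hi i sp wq by metis
  moreover have "X ?p = lo (w ?p) \<or> X ?p = w ?p \<or> X ?p = hi (w ?p)"
    and "X ?q = lo (w ?p) \<or> X ?q = w ?p \<or> X ?q = hi (w ?p)"
    using X_special sp wq by metis+
  ultimately have "r (linv (X ?p)) (X ?q)"
    using d(3) r_special[OF sp] linv_lo[OF sp] linv_hi[OF sp] linv_special[OF sp] by metis
  then have "mirror_less r X k d"
    using d(1) sym by (simp add: mirror_less_def)
  then show ?thesis ..
qed

text \<open>A lift obeying the rule for its own comparisons is forced. What
  \<open>mirror_less_lift\<close> asks about smaller distances is exactly the induction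
  hypothesis.\<close>

lemma lift_determined:
  assumes "\<And>k i. is_special (w k) \<Longrightarrow> \<not> reflects w (2 * k) \<Longrightarrow> mirror_less r X k i \<Longrightarrow> X k = hi (w k)"
    and "is_special (w k)" "mirror_less R w k n"
  shows "X k = hi (w k)"
  using assms(2,3)
proof (induction "nat n" arbitrary: k n rule: less_induct)
  case less
  have "X p = hi (w p)" if "is_special (w p)" "i < n" "mirror_less R w p i" for p i
    using less.hyps that less.prems(2) by (auto simp: mirror_less_def)
  then obtain i where "mirror_less r X k i"
    using mirror_less_lift[OF less.prems] by blast
  moreover have "\<not> reflects w (2 * k)"
    using mirror_less_not_reflects[OF less.prems(2)] R_asym by blast
  ultimately show ?case using assms(1) less.prems(1) by blast
qed

text \<open>At the first failure of symmetry \<open>R_total\<close> orders the two letters; if there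
  is none, the symmetry holds at every distance.\<close>

lemma mirror_trichotomy:
  assumes "is_special (w k)"
  shows "reflects w (2 * k) \<or> (\<exists>n. mirror_less R w k n) \<or> (\<exists>n. mirror_less R\<inverse>\<inverse> w k n)"
proof (rule ccontr)
  assume neg: "\<not> ?thesis"
  have sym: "w (k + int s) = linv (w (k - int s))" for s
  proof (induction s rule: less_induct)
    case (less s)
    show ?case
    proof (cases "s = 0")
      case True
      then show ?thesis using linv_special[OF assms] by auto
    next
      case False
      have prev: "\<forall>i\<in>{1..<int s}. w (k + i) = linv (w (k - i))"
      proof
        fix i assume "i \<in> {1..<int s}"
        then show "w (k + i) = linv (w (k - i))" using less[of "nat i"] by auto
      qed
      moreover have "1 \<le> int s" using False by simp
      ultimately show ?thesis
        using R_total[OF assms, of "int s"] neg unfolding mirror_less_def conversep_iff by blast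
    qed
  qed
  have "w (2 * k - s) = linv (w s)" for s
  proof (cases "s \<le> k")
    case True
    then show ?thesis using sym[of "nat (k - s)"] by simp
  next
    case False
    then show ?thesis using sym[of "nat (s - k)"] by simp
  qed
  then show False using neg by (simp add: reflects_def)
qed

end

section \<open>Letters of a skewed-gentle quiver and of its gentle quiver\<close>

lemma neg_neg [simp]: "neg (neg p) = p"
  by (simp add: neg_def)

lemma lsrc_linv [simp]: "lsrc Q (linv x) = ltgt Q x"
  by (cases x) auto

lemma ltgt_linv [simp]: "ltgt Q (linv x) = lsrc Q x"
  by (cases x) auto

lemma linv_in_letters [simp]: "linv x \<in> letters Q \<longleftrightarrow> x \<in> letters Q"
  by (cases x) (auto simp: letters_def)

lemma linv_inject [simp]: "linv x = linv y \<longleftrightarrow> x = y"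
  by (metis linv_linv)

lemma F_letter_linv [simp]: "F_letter Q (linv x) = linv (F_letter Q x)"
  by (cases x) auto

lemma ltgt_special: "is_special x \<Longrightarrow> lsrc Q x = Some (star_vertex x, -1) \<and> ltgt Q x = lsrc Q x"
  by (auto simp: is_special_def)

lemma letter_less_trans: "letter_less Q x y \<Longrightarrow> letter_less Q y z \<Longrightarrow> letter_less Q x z"
  by (auto simp: letter_less_def)

lemma letter_less_asym: "letter_less Q x y \<Longrightarrow> \<not> letter_less Q y x"
  by (auto simp: letter_less_def)

lemma letter_less_irrefl: "\<not> letter_less Q x x"
  using letter_less_asym by blast

lemma letter_less_ordinary: "letter_less Q x y \<Longrightarrow> \<not> is_special x \<and> \<not> is_special y"
  by (auto simp: letter_less_def is_special_def)

lemma skewed_gentle_tgt_inj: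
  "skewed_gentle Q \<Longrightarrow> a \<in> arrows Q \<Longrightarrow> b \<in> arrows Q \<Longrightarrow> tgt Q a = tgt Q b \<longleftrightarrow> a = b"
  by (auto simp: skewed_gentle_def inj_on_def)

lemma skewed_gentle_src_inj:
  "skewed_gentle Q \<Longrightarrow> a \<in> arrows Q \<Longrightarrow> b \<in> arrows Q \<Longrightarrow> src Q a = src Q b \<longleftrightarrow> a = b"
  by (auto simp: skewed_gentle_def inj_on_def)

lemma special_src_tgt:
  "skewed_gentle Q \<Longrightarrow> e \<in> special Q \<Longrightarrow> src Q e = (fst (src Q e), -1) \<and> tgt Q e = src Q e"
  by (auto simp: skewed_gentle_def prod_eq_iff)

lemma special_loop_src:
  assumes Q: "skewed_gentle Q" and e: "e \<in> special Q"
  shows "special_loop Q (fst (src Q e)) = e"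
  unfolding special_loop_def
proof (rule the_equality)
  fix e' assume e': "e' \<in> special Q \<and> fst (src Q e') = fst (src Q e)"
  then have "src Q e' = src Q e" using special_src_tgt[OF Q] e by (metis prod.collapse)
  then show "e' = e" using e e' skewed_gentle_src_inj[OF Q] by (auto simp: arrows_def)
qed (use e in simp)

lemma special_loop:
  assumes Q: "skewed_gentle Q" and i: "i \<in> special_verts Q"
  shows "special_loop Q i \<in> special Q" "src Q (special_loop Q i) = (i, -1)"
    "tgt Q (special_loop Q i) = (i, -1)"
proof -
  obtain e where e: "e \<in> special Q" "i = fst (src Q e)"
    using i by (auto simp: special_verts_def)
  then have "special_loop Q i = e" using special_loop_src[OF Q] by blast
  then show "special_loop Q i \<in> special Q" "src Q (special_loop Q i) = (i, -1)"
    "tgt Q (special_loop Q i) = (i, -1)"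
    using e special_src_tgt[OF Q e(1)] by metis+
qed

lemma special_verts_subset: "skewed_gentle Q \<Longrightarrow> special_verts Q \<subseteq> verts Q"
  by (auto simp: skewed_gentle_def special_verts_def arrows_def)

lemma letter_end_range:
  assumes "skewed_gentle Q" "x \<in> letters Q" "ltgt Q x = Some p \<or> lsrc Q x = Some p"
  shows "fst p \<in> verts Q \<and> snd p \<in> {-1, 1}"
proof -
  have "src Q ` arrows Q \<subseteq> verts Q \<times> {-1, 1}" "tgt Q ` arrows Q \<subseteq> verts Q \<times> {-1, 1}"
    using assms(1) by (auto simp: skewed_gentle_def)
  moreover have "i \<in> verts Q" if "i \<in> special_verts Q" for i
    using that special_verts_subset[OF assms(1)] by blast
  ultimately show ?thesis
    using assms(2,3) by (auto simp: letters_def arrows_def image_subset_iff mem_Times_iff)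
qed

text \<open>Injectivity allows at most one arrow and one inverse arrow with a given target, and
  these and the trivial letter there are ordered by kind. A special letter has no competitor at all:
  its end is taken by the special loop, which is not ordinary.\<close>

lemma letter_total:
  assumes Q: "skewed_gentle Q" and x: "x \<in> letters Q" and y: "y \<in> letters Q"
    and xy: "ltgt Q x = Some p" "ltgt Q y = Some p"
  shows "x = y \<or> letter_less Q x y \<or> letter_less Q y x"
proof -
  have ord: "a \<in> arrows Q" "a \<notin> special Q" if "a \<in> ordinary Q" for a
    using that Q by (auto simp: skewed_gentle_def arrows_def)
  \<comment> \<open>The special loop at \<open>i\<close> already has source and target
    \<open>(i, -1)\<close>, so by injectivity no other arrow does.\<close>
  have noloop: "src Q a \<noteq> (i, -1) \<and> tgt Q a \<noteq> (i, -1) \<and> (i, -1) \<noteq> src Q a \<and> (i, -1) \<noteq> tgt Q a"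
    if a: "a \<in> ordinary Q" and i: "i \<in> special_verts Q" for a i
  proof -
    have "special_loop Q i \<in> arrows Q" "a \<noteq> special_loop Q i"
      using special_loop(1)[OF Q i] ord[OF a] by (auto simp: arrows_def)
    then have "src Q a \<noteq> (i, -1)" "tgt Q a \<noteq> (i, -1)"
      using skewed_gentle_src_inj[OF Q ord(1)[OF a]] skewed_gentle_tgt_inj[OF Q ord(1)[OF a]]
        special_loop(2,3)[OF Q i] by metis+
    then show ?thesis by auto
  qed
  have mem: "Dir a \<in> letters Q \<longleftrightarrow> a \<in> ordinary Q" "Inv a \<in> letters Q \<longleftrightarrow> a \<in> ordinary Q"
    "Star i \<in> letters Q \<longleftrightarrow> i \<in> special_verts Q"
    "Triv i t \<in> letters Q \<Longrightarrow> \<not> (i \<in> special_verts Q \<and> t = -1)" for a i t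
    by (auto simp: letters_def)
  note inj = skewed_gentle_src_inj[OF Q] skewed_gentle_tgt_inj[OF Q]
  show ?thesis
    using x y xy
    by (cases x; cases y) (auto simp: letter_less_def mem inj ord noloop dest: mem(4))
qed

lemma hat_simps [simp]:
  "verts (hat Q) = verts Q" "special (hat Q) = {}" "ordinary (hat Q) = arrows Q"
  "src (hat Q) = src Q" "tgt (hat Q) = tgt Q" "arrows (hat Q) = arrows Q"
  "special_verts (hat Q) = {}"
  by (auto simp: hat_def arrows_def special_verts_def)

lemma lsrc_hat [simp]: "lsrc (hat Q) x = lsrc Q x"
  by (cases x) auto

lemma ltgt_hat [simp]: "ltgt (hat Q) x = ltgt Q x"
  by (cases x) auto

lemma skewed_gentle_hat:
  assumes "skewed_gentle Q"
  shows "skewed_gentle (hat Q)"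
proof -
  have "admissible_path (hat Q) = admissible_path Q"
    by (auto simp: admissible_path_def fun_eq_iff)
  moreover have "finite (arrows Q)" using assms by (auto simp: skewed_gentle_def arrows_def)
  ultimately show ?thesis using assms by (auto simp: skewed_gentle_def)
qed

section \<open>Lifted letters and their order\<close>

text \<open>The result is always the trivial letter that has a target, since comparisons take place
  at targets; letters of the left reading are inverted before they are punctured.\<close>

definition puncture :: "('v, 'a) letter \<Rightarrow> ('v, 'a) letter" where
  "puncture x = (case x of Star i \<Rightarrow> Triv i (-1) | _ \<Rightarrow> x)"

text \<open>Here \<open>\<epsilon>\<^sub>i\<^sup>*\<close> takes the place of the punctured letter between \<open>\<epsilon>\<^sub>i\<close> and its inverse: being its
  own inverse, it allows to unfold a string ending in a punctured letter by reflection.\<close>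

definition hat_less ::
  "('v, 'a) polarized_quiver \<Rightarrow> ('v, 'a) letter \<Rightarrow> ('v, 'a) letter \<Rightarrow> bool" where
  "hat_less Q x y \<longleftrightarrow> letter_less (hat Q) (puncture x) (puncture y)"

lemma puncture_simps [simp]:
  "puncture (Star i) = Triv i (-1)" "puncture (Dir a) = Dir a" "puncture (Inv a) = Inv a"
  "puncture (Triv i t) = Triv i t" "puncture (TrivInv i t) = TrivInv i t"
  by (auto simp: puncture_def)

lemma hat_less_asym: "hat_less Q x y \<Longrightarrow> \<not> hat_less Q y x"
  using letter_less_asym by (auto simp: hat_less_def)

lemma letter_less_hat: "letter_less Q x y \<Longrightarrow> hat_less Q x y"
  by (auto simp: letter_less_def hat_less_def letters_def arrows_def)

definition lo :: "('v, 'a) polarized_quiver \<Rightarrow> ('v, 'a) letter \<Rightarrow> ('v, 'a) letter" where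
  "lo Q x = Dir (special_loop Q (star_vertex x))"

definition hi :: "('v, 'a) polarized_quiver \<Rightarrow> ('v, 'a) letter \<Rightarrow> ('v, 'a) letter" where
  "hi Q x = Inv (special_loop Q (star_vertex x))"

lemma linv_lo_hi [simp]: "linv (lo Q x) = hi Q x" "linv (hi Q x) = lo Q x"
  by (auto simp: lo_def hi_def)

lemma lo_hi_ends:
  assumes "skewed_gentle Q" "x \<in> letters Q" "is_special x"
  shows "lsrc Q (lo Q x) = lsrc Q x" "ltgt Q (lo Q x) = ltgt Q x" "F_letter Q (lo Q x) = x"
    "lsrc Q (hi Q x) = lsrc Q x" "ltgt Q (hi Q x) = ltgt Q x" "F_letter Q (hi Q x) = x"
    "lo Q x \<in> letters (hat Q)" "hi Q x \<in> letters (hat Q)"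
  using assms special_loop[OF assms(1)]
  by (auto simp: is_special_def lo_def hi_def letters_def arrows_def)

lemma hat_less_special:
  assumes "skewed_gentle Q" "x \<in> letters Q" "is_special x"
  shows "hat_less Q (lo Q x) x \<and> hat_less Q x (hi Q x) \<and> hat_less Q (lo Q x) (hi Q x)"
  using assms special_loop[OF assms(1)] special_verts_subset[OF assms(1)]
  by (auto simp: is_special_def lo_def hi_def letters_def arrows_def hat_less_def letter_less_def)


section \<open>Cyclic words\<close>

text \<open>\<open>map_option neg\<close> also carries \<open>None\<close> to \<open>None\<close>,
  which lets the last letter of a string be followed by its first. The last two conditions make all
  ends of one kind equal, as in repetitions of one string; for a band they are vacuous.\<close>

definition cyclic_word :: "('v, 'a) polarized_quiver \<Rightarrow> (int \<Rightarrow> ('v, 'a) letter) \<Rightarrow> bool" where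
  "cyclic_word Q w \<longleftrightarrow>
     (\<forall>i. w i \<in> letters Q) \<and> (\<forall>i. ltgt Q (w (i + 1)) = map_option neg (lsrc Q (w i))) \<and>
     (\<forall>i j. lsrc Q (w i) = None \<longrightarrow> lsrc Q (w j) = None \<longrightarrow> w i = w j) \<and>
     (\<forall>i j. ltgt Q (w i) = None \<longrightarrow> ltgt Q (w j) = None \<longrightarrow> w i = w j)"

text \<open>Symmetry below distance \<open>n\<close> forces both readings to continue from the same
  end; for \<open>n = 1\<close> this is where the letter at \<open>k\<close> must be a loop. Then
  \<open>letter_total\<close> applies.\<close>

lemma cyclic_word_total:
  assumes Q: "skewed_gentle Q" and w: "cyclic_word Q w"
    and k: "lsrc Q (w k) = Some q" "ltgt Q (w k) = Some q"
    and n: "1 \<le> n" and sym: "\<forall>s\<in>{1..<n}. w (k + s) = linv (w (k - s))"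
  shows "w (k + n) = linv (w (k - n)) \<or> letter_less Q (linv (w (k - n))) (w (k + n)) \<or>
      letter_less Q (w (k + n)) (linv (w (k - n)))"
proof -
  have step: "ltgt Q (w (i + 1)) = map_option neg (lsrc Q (w i))" for i
    using w by (simp add: cyclic_word_def)
  have right: "ltgt Q (w (k + n)) = map_option neg (lsrc Q (w (k + (n - 1))))"
    using step[of "k + (n - 1)"] by (simp add: algebra_simps)
  have left: "map_option neg (lsrc Q (w (k - n))) = ltgt Q (w (k - (n - 1)))"
    using step[of "k - n"] by (simp add: algebra_simps)
  have mid: "lsrc Q (w (k + (n - 1))) = ltgt Q (w (k - (n - 1)))"
  proof (cases "n = 1")
    case False
    then have "w (k + (n - 1)) = linv (w (k - (n - 1)))" using sym n by simp
    then show ?thesis by simp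
  qed (use k in simp)
  have eq: "ltgt Q (w (k + n)) = lsrc Q (w (k - n))"
  proof -
    have "map_option neg (map_option neg z) = z" for z :: "('a \<times> int) option"
      by (cases z) auto
    then show ?thesis using right left mid by metis
  qed
  have let_w: "w i \<in> letters Q" for i using w by (simp add: cyclic_word_def)
  show ?thesis
  proof (cases "ltgt Q (w (k + n))")
    case (Some p)
    then show ?thesis
      using letter_total[OF Q, of "linv (w (k - n))" "w (k + n)" p] let_w eq by auto
  next
    \<comment> \<open>Both readings have just run over the ends of a string. Now the right one meets
      the first letter and the left one the last letter, which are the letters the other side showed
      at distance \<open>n - 1\<close>; so the symmetry persists and wrapping around creates no
      deviation.\<close>
    case None
    then have "lsrc Q (w (k + (n - 1))) = None" using right by simp
    moreover from this have "n \<noteq> 1" using k by auto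
    moreover have "lsrc Q (w (k - n)) = None" "ltgt Q (w (k - (n - 1))) = None"
      using None eq left by auto
    ultimately have "w (k - n) = w (k + (n - 1))" "w (k - (n - 1)) = w (k + n)"
      using w None unfolding cyclic_word_def by blast+
    moreover have "w (k + (n - 1)) = linv (w (k - (n - 1)))"
      using sym n \<open>n \<noteq> 1\<close> by simp
    ultimately show ?thesis by simp
  qed
qed

lemma lift_pair_letters:
  assumes Q: "skewed_gentle Q" and w: "cyclic_word Q w"
    and X: "\<And>k. X k = (if is_special (w k) then X k else w k)"
    and sp: "\<And>k. is_special (w k) \<Longrightarrow> X k \<in> {lo Q (w k), w k, hi Q (w k)}"
  shows "lift_pair (letter_less Q) (hat_less Q) (lo Q) (hi Q) w X"
proof
  have let_w: "w i \<in> letters Q" for i using w by (simp add: cyclic_word_def)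
  fix k assume k: "is_special (w k)"
  then show "hat_less Q (lo Q (w k)) (w k) \<and> hat_less Q (w k) (hi Q (w k)) \<and>
      hat_less Q (lo Q (w k)) (hi Q (w k))"
    using hat_less_special[OF Q] let_w by blast
  fix n :: int assume "1 \<le> n" "\<forall>s\<in>{1..<n}. w (k + s) = linv (w (k - s))"
  with ltgt_special[OF k, of Q]
  show "w (k + n) = linv (w (k - n)) \<or> letter_less Q (linv (w (k - n))) (w (k + n)) \<or>
      letter_less Q (w (k + n)) (linv (w (k - n)))"
    by (intro cyclic_word_total[OF Q w]) auto
next
  fix k assume "\<not> is_special (w k)"
  then show "X k = w k" using X[of k] by simp
next
  fix k assume "is_special (w k)"
  then show "X k = lo Q (w k) \<or> X k = w k \<or> X k = hi Q (w k)" using sp by blast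
qed (use letter_less_trans letter_less_asym letter_less_ordinary letter_less_hat in \<open>blast | simp\<close>)+

section \<open>Periodic extension of a finite word\<close>

definition cyc :: "'l list \<Rightarrow> int \<Rightarrow> 'l" where
  "cyc w i = w ! nat (i mod int (length w))"

lemma cyc_nth: "0 \<le> i \<Longrightarrow> i < int (length w) \<Longrightarrow> cyc w i = w ! nat i"
  by (simp add: cyc_def)

lemma cyc_period [simp]: "cyc w (i + int (length w)) = cyc w i"
  by (simp add: cyc_def)

lemma cyc_period_dvd: "int (length w) dvd d \<Longrightarrow> cyc w (i + d) = cyc w i"
  by (auto simp: cyc_def)

lemma cyc_ex: "w \<noteq> [] \<Longrightarrow> \<exists>j<length w. cyc w i = w ! j \<and> i mod int (length w) = int j"
  by (intro exI[of _ "nat (i mod int (length w))"])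
    (simp add: cyc_def nat_less_iff)

lemma cyc_eq_imp: 
  assumes "length v = length w" "\<And>i. cyc v i = cyc w i"
  shows "v = w"
proof (rule nth_equalityI)
  fix i assume "i < length v"
  then show "v ! i = w ! i" using assms(2)[of "int i"] assms(1) by (simp add: cyc_nth)
qed (use assms in simp)

lemma length_winv [simp]: "length (winv w) = length w"
  by (simp add: winv_def)

lemma nth_winv: "i < length w \<Longrightarrow> winv w ! i = linv (w ! (length w - Suc i))"
  by (simp add: winv_def rev_nth)

lemma winv_append: "winv (u @ v) = winv v @ winv u"
  by (simp add: winv_def)

lemma winv_winv [simp]: "winv (winv w) = w"
  by (simp add: winv_def rev_map comp_def)

lemma winv_Nil [simp]: "winv w = [] \<longleftrightarrow> w = []" "winv [] = []"
  by (auto simp: winv_def)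

text \<open>Position 0 is mirrored to the last position of a period, which is -1; hence
  \<open>- 1 - i\<close>.\<close>

lemma cyc_winv: 
  assumes "w \<noteq> []"
  shows "cyc (winv w) (- 1 - i) = linv (cyc w i)"
proof -
  obtain j where j: "j < length w" "cyc w i = w ! j" "i mod int (length w) = int j"
    using cyc_ex[OF assms] by blast
  have "(- 1 - i) mod int (length w) = (- 1 - int j) mod int (length w)"
    using j(3) by (metis mod_diff_right_eq)
  also have "\<dots> = (int (length w) - 1 - int j) mod int (length w)"
    using mod_add_self2[of "- 1 - int j" "int (length w)"] by (simp add: algebra_simps)
  also have "\<dots> = int (length w - Suc j)"
    using j(1) by (subst mod_pos_pos_trivial) (simp_all add: of_nat_diff)
  finally have "cyc (winv w) (- 1 - i) = winv w ! (length w - Suc j)"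
    by (simp add: cyc_def)
  then show ?thesis using j by (simp add: nth_winv)
qed

lemma cyc_rotate: 
  assumes "w \<noteq> []"
  shows "cyc (rotate m w) i = cyc w (i + int m)"
proof -
  have "nat (i mod int (length w)) < length w" using assms by (simp add: nat_less_iff)
  then have "cyc (rotate m w) i = w ! ((nat (i mod int (length w)) + m) mod length w)"
    by (simp add: cyc_def nth_rotate add.commute)
  also have "(nat (i mod int (length w)) + m) mod length w = nat ((i + int m) mod int (length w))"
  proof -
    have "int ((nat (i mod int (length w)) + m) mod length w) = (i + int m) mod int (length w)"
      using assms by (simp add: zmod_int mod_add_left_eq)
    then show ?thesis by linarith
  qed
  finally show ?thesis by (simp add: cyc_def)
qed

text \<open>By \<open>cyc_winv\<close>, inversion is the mirror with sum -1. A mirror with sum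
  \<open>a\<close> differs from it by a rotation by \<open>a + 1\<close>.\<close>

lemma reflects_cyc_iff:
  assumes "w \<noteq> []"
  shows "reflects (cyc w) a \<longleftrightarrow> winv w = rotate (nat ((a + 1) mod int (length w))) w"
proof -
  define m where "m = nat ((a + 1) mod int (length w))"
  have m: "int m = a + 1 + int (length w) * (- ((a + 1) div int (length w)))"
    using assms by (simp add: m_def minus_mult_div_eq_mod)
  have rot: "cyc (rotate m w) (- 1 - s) = cyc w (a - s)" for s
  proof -
    have "cyc (rotate m w) (- 1 - s) = cyc w (- 1 - s + int m)"
      by (rule cyc_rotate[OF assms])
    also have "- 1 - s + int m = a - s + int (length w) * (- ((a + 1) div int (length w)))"
      unfolding m by simp
    finally show ?thesis by (simp only: cyc_period_dvd[OF dvd_triv_left])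
  qed
  show ?thesis
    unfolding m_def[symmetric]
  proof
    assume "reflects (cyc w) a"
    then have "cyc (winv w) (- 1 - s) = cyc (rotate m w) (- 1 - s)" for s
      using assms rot by (simp add: cyc_winv reflects_def)
    from this[of "- 1 - s" for s] have "cyc (winv w) s = cyc (rotate m w) s" for s
      by simp
    then show "winv w = rotate m w" by (intro cyc_eq_imp) auto
  next
    assume "winv w = rotate m w"
    then show "reflects (cyc w) a"
      unfolding reflects_def using rot cyc_winv[OF assms] by metis
  qed
qed

lemma symmetric_band_iff:
  assumes "w \<noteq> []"
  shows "symmetric_band w \<longleftrightarrow> (\<exists>a. reflects (cyc w) a)"
proof
  assume "symmetric_band w"
  then obtain k where k: "winv w = rotate k w" by (auto simp: symmetric_band_def)
  have "nat ((int k - 1 + 1) mod int (length w)) = k mod length w"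
    by (simp add: nat_mod_distrib)
  then have "reflects (cyc w) (int k - 1)"
    using k by (subst reflects_cyc_iff[OF assms]) (metis rotate_conv_mod)
  then show "\<exists>a. reflects (cyc w) a" ..
qed (use reflects_cyc_iff[OF assms] symmetric_band_def in blast)

section \<open>Strings and bands as cyclic words\<close>

lemma is_word_nth:
  "is_word Q w \<longleftrightarrow> (\<forall>i<length w. w ! i \<in> letters Q) \<and>
     (\<forall>i. Suc i < length w \<longrightarrow> lsrc Q (w ! i) \<noteq> None \<and>
        ltgt Q (w ! Suc i) = map_option neg (lsrc Q (w ! i)))"
proof -
  have "(\<exists>p. lsrc Q x = Some p \<and> ltgt Q y = Some (neg p)) \<longleftrightarrow>
      lsrc Q x \<noteq> None \<and> ltgt Q y = map_option neg (lsrc Q x)" for x y :: "('a, 'b) letter"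
    by auto
  moreover have "set w \<subseteq> letters Q \<longleftrightarrow> (\<forall>i<length w. w ! i \<in> letters Q)"
    using all_set_conv_all_nth[of w "\<lambda>x. x \<in> letters Q"] by blast
  ultimately show ?thesis
    unfolding is_word_def successively_conv_nth by simp
qed

lemma is_word_step:
  "is_word Q w \<Longrightarrow> Suc i < length w \<Longrightarrow> lsrc Q (w ! i) \<noteq> None"
  "is_word Q w \<Longrightarrow> Suc i < length w \<Longrightarrow> ltgt Q (w ! Suc i) = map_option neg (lsrc Q (w ! i))"
  unfolding is_word_nth by blast+

lemma is_word_append:
  "is_word Q (u @ v) \<longleftrightarrow> is_word Q u \<and> is_word Q v \<and>
     (u = [] \<or> v = [] \<or> (\<exists>p. lsrc Q (last u) = Some p \<and> ltgt Q (hd v) = Some (neg p)))"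
  by (auto simp: is_word_def successively_append_iff)

lemma is_word_Cons:
  "is_word Q (x # v) \<longleftrightarrow> x \<in> letters Q \<and> is_word Q v \<and>
     (v = [] \<or> (\<exists>p. lsrc Q x = Some p \<and> ltgt Q (hd v) = Some (neg p)))"
  using is_word_append[of Q "[x]" v] by (simp add: is_word_def)

lemma is_word_winv:
  assumes "is_word Q w"
  shows "is_word Q (winv w)"
  using assms
proof (induction w)
  case (Cons x w)
  have "winv (x # w) = winv w @ [linv x]" by (simp add: winv_def)
  moreover have "is_word Q (winv w)" and "x \<in> letters Q"
    using Cons by (auto simp: is_word_Cons)
  moreover have "\<exists>p. lsrc Q (last (winv w)) = Some p \<and> lsrc Q x = Some (neg p)" if ne: "w \<noteq> []"
  proof -
    obtain p where "lsrc Q x = Some p" "ltgt Q (hd w) = Some (neg p)"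
      using Cons.prems ne unfolding is_word_Cons by blast
    then show ?thesis using ne by (auto simp: winv_def last_rev hd_map)
  qed
  moreover have "is_word Q [linv x]" using Cons.prems by (simp add: is_word_def)
  ultimately show ?case by (auto simp: is_word_append)
qed (simp add: is_word_def)

text \<open>Consecutive letters of a word meet at an actual end, so a missing source can occur only
  in the last place and a missing target only in the first.\<close>

lemma strings_nth:
  assumes "w \<in> strings Q"
  shows "2 \<le> length w" "\<exists>i r. w ! 0 = TrivInv i r" "\<exists>i r. w ! (length w - 1) = Triv i r"
    "j < length w \<Longrightarrow> lsrc Q (w ! j) = None \<longleftrightarrow> Suc j = length w"
    "j < length w \<Longrightarrow> ltgt Q (w ! j) = None \<longleftrightarrow> j = 0"
proof -
  have w: "is_word Q w" "w \<noteq> []" and first: "\<exists>i r. w ! 0 = TrivInv i r"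
    and lst: "\<exists>i r. w ! (length w - 1) = Triv i r"
    using assms by (auto simp: strings_def hd_conv_nth last_conv_nth)
  then have len: "2 \<le> length w"
  proof -
    have "length w \<noteq> 1" using first lst by auto
    moreover have "length w \<noteq> 0" using w(2) by simp
    ultimately show ?thesis by linarith
  qed
  show "2 \<le> length w" "\<exists>i r. w ! 0 = TrivInv i r" "\<exists>i r. w ! (length w - 1) = Triv i r"
    by fact+
  show "lsrc Q (w ! j) = None \<longleftrightarrow> Suc j = length w" if "j < length w"
  proof
    assume "lsrc Q (w ! j) = None"
    then have "\<not> Suc j < length w" using w(1) unfolding is_word_nth by blast
    then show "Suc j = length w" using that by simp
  next
    assume "Suc j = length w"
    then have "j = length w - 1" by simp
    then show "lsrc Q (w ! j) = None" using lst by auto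
  qed
  show "ltgt Q (w ! j) = None \<longleftrightarrow> j = 0" if "j < length w"
  proof
    assume none: "ltgt Q (w ! j) = None"
    show "j = 0"
    proof (rule ccontr)
      assume "j \<noteq> 0"
      then have "Suc (j - 1) = j" by simp
      then have "lsrc Q (w ! (j - 1)) \<noteq> None" "ltgt Q (w ! j) = map_option neg (lsrc Q (w ! (j - 1)))"
        using is_word_step[OF w(1), of "j - 1"] that by simp_all
      then show False using none by simp
    qed
  qed (use first in auto)
qed

lemma bands_nth:
  assumes "w \<in> bands Q" and "j < length w"
  shows "lsrc Q (w ! j) \<noteq> None" "ltgt Q (w ! j) \<noteq> None"
    "ltgt Q (w ! 0) = map_option neg (lsrc Q (w ! (length w - 1)))"
proof -
  have w: "is_word Q (w @ w)" "w \<noteq> []" using assms by (auto simp: bands_def)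
  have "lsrc Q ((w @ w) ! j) \<noteq> None" using w assms(2) unfolding is_word_nth by simp
  then show "lsrc Q (w ! j) \<noteq> None" using assms(2) by (simp add: nth_append)
  have "Suc (j + length w - 1) < length (w @ w)" "Suc (j + length w - 1) = length w + j"
    using assms(2) by simp_all
  then have "ltgt Q ((w @ w) ! (length w + j)) \<noteq> None"
    using is_word_step[OF w(1), of "j + length w - 1"] by simp
  then show "ltgt Q (w ! j) \<noteq> None" using assms(2) by (simp add: nth_append)
  have "Suc (length w - 1) = length w" using assms(2) by simp
  then have "ltgt Q ((w @ w) ! length w) = map_option neg (lsrc Q ((w @ w) ! (length w - 1)))"
    using is_word_step(2)[OF w(1), of "length w - 1"] assms(2) w(2) by simp
  then show "ltgt Q (w ! 0) = map_option neg (lsrc Q (w ! (length w - 1)))"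
    using assms(2) by (simp add: nth_append)
qed

lemma cyc_Suc:
  assumes "w \<noteq> []"
  obtains j where "j < length w" "i mod int (length w) = int j" "cyc w i = w ! j"
    "cyc w (i + 1) = w ! (if Suc j = length w then 0 else Suc j)"
proof -
  obtain j where j: "j < length w" "cyc w i = w ! j" "i mod int (length w) = int j"
    using cyc_ex[OF assms] by blast
  have "(i + 1) mod int (length w) = (int j + 1) mod int (length w)"
    using j(3) by (metis mod_add_left_eq)
  also have "\<dots> = int (Suc j mod length w)" by (simp add: zmod_int add.commute)
  finally have "cyc w (i + 1) = w ! (Suc j mod length w)" by (simp add: cyc_def)
  then show ?thesis using that j by (auto simp: mod_Suc)
qed

lemma cyclic_word_cyc:
  assumes "w \<in> strings Q \<union> bands Q"
  shows "cyclic_word Q (cyc w)"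
proof -
  have w: "is_word Q w" "w \<noteq> []" using assms by (auto simp: strings_def bands_def)
  \<comment> \<open>For a string both sides are \<open>None\<close>.\<close>
  have wrap: "ltgt Q (w ! 0) = map_option neg (lsrc Q (w ! (length w - 1)))"
  proof (cases "w \<in> strings Q")
    case True
    then show ?thesis using strings_nth(2,3)[OF True] by auto
  qed (use assms bands_nth(3) w in auto)
  have "cyc w i \<in> letters Q \<and> ltgt Q (cyc w (i + 1)) = map_option neg (lsrc Q (cyc w i))" for i
  proof -
    obtain j where j: "j < length w" "cyc w i = w ! j"
      "cyc w (i + 1) = w ! (if Suc j = length w then 0 else Suc j)"
      using cyc_Suc[OF w(2), of i] by blast
    have "ltgt Q (cyc w (i + 1)) = map_option neg (lsrc Q (cyc w i))"
    proof (cases "Suc j = length w")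
      case True
      then have "j = length w - 1" by simp
      then show ?thesis using j True wrap by simp
    qed (use j w(1) in \<open>auto simp: is_word_nth\<close>)
    then show ?thesis using j w(1) by (auto simp: is_word_nth)
  qed
  moreover have "cyc w i = cyc w j" if "lsrc Q (cyc w i) = None" "lsrc Q (cyc w j) = None" for i j
  proof -
    obtain a b where "a < length w" "b < length w" "cyc w i = w ! a" "cyc w j = w ! b"
      using cyc_ex[OF w(2)] by meson
    then show ?thesis
      using that assms bands_nth(1)[of w Q] strings_nth(4)[of w Q] by (metis Un_iff nat.inject)
  qed
  moreover have "cyc w i = cyc w j" if "ltgt Q (cyc w i) = None" "ltgt Q (cyc w j) = None" for i j
  proof -
    obtain a b where "a < length w" "b < length w" "cyc w i = w ! a" "cyc w j = w ! b"
      using cyc_ex[OF w(2)] by meson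
    then show ?thesis
      using that assms bands_nth(2)[of w Q] strings_nth(5)[of w Q] by (metis Un_iff)
  qed
  ultimately show ?thesis by (auto simp: cyclic_word_def)
qed

lemma strings_cyc_end:
  assumes "w \<in> strings Q"
  shows "lsrc Q (cyc w i) = None \<longleftrightarrow> int (length w) dvd i + 1"
    "ltgt Q (cyc w i) = None \<longleftrightarrow> int (length w) dvd i"
proof -
  have "w \<noteq> []" using strings_nth(1)[OF assms] by auto
  then obtain j where j: "j < length w" "i mod int (length w) = int j" "cyc w i = w ! j"
    using cyc_Suc by blast
  have "(i + 1) mod int (length w) = (int j + 1) mod int (length w)"
    using j(2) by (metis mod_add_left_eq)
  also have "\<dots> = int (Suc j mod length w)" by (simp add: zmod_int add.commute)
  finally show "lsrc Q (cyc w i) = None \<longleftrightarrow> int (length w) dvd i + 1"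
    using j strings_nth(4)[OF assms j(1)] by (auto simp: dvd_eq_mod_eq_0 mod_Suc)
  show "ltgt Q (cyc w i) = None \<longleftrightarrow> int (length w) dvd i"
    using j strings_nth(5)[OF assms j(1)] by (auto simp: dvd_eq_mod_eq_0)
qed

text \<open>In a string the letter without target occurs once per period. In a band a nontrivial
  rotation fixing the word makes two factors commute, and commuting words are powers of a common
  one.\<close>

lemma cyc_primitive:
  assumes w: "w \<in> strings Q \<union> pbands Q" and period: "\<And>i. cyc w (i + d) = cyc w i"
  shows "int (length w) dvd d"
proof (cases "w \<in> strings Q")
  case True
  have "ltgt Q (cyc w 0) = None" using strings_cyc_end(2)[OF True, of 0] by simp
  then have "ltgt Q (cyc w d) = None" using period[of 0] by simp
  then show ?thesis using strings_cyc_end(2)[OF True] by blast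
next
  case False
  then have w: "w \<in> pbands Q" and ne: "w \<noteq> []" using w by (auto simp: pbands_def bands_def)
  define m where "m = nat (d mod int (length w))"
  have m: "int m = d mod int (length w)" using ne by (simp add: m_def)
  have "cyc (rotate m w) i = cyc w i" for i
  proof -
    have "cyc (rotate m w) i = cyc w (i + d + int (length w) * (- (d div int (length w))))"
      unfolding cyc_rotate[OF ne] m by (simp add: minus_mult_div_eq_mod[symmetric] algebra_simps)
    then show ?thesis using period[of i] by (simp only: cyc_period_dvd[OF dvd_triv_left])
  qed
  then have rot: "rotate m w = w" by (intro cyc_eq_imp) auto
  have "m = 0"
  proof (rule ccontr)
    assume "m \<noteq> 0"
    have "m < length w" using ne by (simp add: m_def nat_less_iff)
    then have "drop m w @ take m w = take m w @ drop m w"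
      using rot by (simp add: rotate_drop_take)
    moreover have "drop m w \<noteq> []" "take m w \<noteq> []"
      using \<open>m < length w\<close> \<open>m \<noteq> 0\<close> ne by auto
    ultimately obtain n u where "n > 1" "concat (replicate n u) = take m w @ drop m w"
      using comm_append_is_replicate by metis
    then have "2 \<le> n \<and> w = concat (replicate n u)" by simp
    then show False using w unfolding pbands_def by blast
  qed
  then show ?thesis using m by (simp add: dvd_eq_mod_eq_0)
qed

text \<open>Every mirror carries the letter without target to one without source, that is, the first
  letter to the last; this fixes its sum as -1 modulo the length.\<close>

lemma symmetric_string_iff:
  assumes "w \<in> strings Q"
  shows "symmetric_string w \<longleftrightarrow> (\<exists>a. reflects (cyc w) a)"
proof
  have ne: "w \<noteq> []" using strings_nth(1)[OF assms] by auto
  have *: "reflects (cyc w) (-1) \<longleftrightarrow> symmetric_string w"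
    using reflects_cyc_iff[OF ne, of "-1"] by (auto simp: symmetric_string_def)
  then show "symmetric_string w \<Longrightarrow> \<exists>a. reflects (cyc w) a" by blast
  assume "\<exists>a. reflects (cyc w) a"
  then obtain a where a: "reflects (cyc w) a" ..
  then have "cyc w (a - 0) = linv (cyc w 0)" unfolding reflects_def by blast
  then have "lsrc Q (cyc w a) = None" using strings_cyc_end(2)[OF assms, of 0] by simp
  then have "int (length w) dvd a + 1" using strings_cyc_end(1)[OF assms] by blast
  then have "reflects (cyc w) (a + (- (a + 1)))"
    by (intro reflects_shift[OF a] cyc_period_dvd) (simp only: dvd_minus_iff)
  then show "symmetric_string w" using * by simp
qed

lemma strings_winv:
  assumes "w \<in> strings Q"
  shows "winv w \<in> strings Q"
proof -
  have "is_word Q w" "w \<noteq> []" using assms by (auto simp: strings_def)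
  moreover from this have "hd (winv w) = linv (last w)" "last (winv w) = linv (hd w)"
    by (auto simp: winv_def hd_rev last_rev hd_map last_map)
  moreover obtain i r j t where "hd w = TrivInv i r" "last w = Triv j t"
    using assms by (auto simp: strings_def)
  ultimately show ?thesis using is_word_winv by (auto simp: strings_def)
qed

lemma strings_not_bands: "w \<in> strings Q \<Longrightarrow> w \<notin> bands Q"
proof
  assume w: "w \<in> strings Q" "w \<in> bands Q"
  then have "w \<noteq> []" by (auto simp: bands_def)
  then have "ltgt Q (w ! 0) \<noteq> None" using bands_nth(2)[OF w(2), of 0] by simp
  then show False using strings_nth(2)[OF w(1)] by auto
qed


section \<open>Comparing words\<close>

lemma word_less_Cons: "word_less Q (x # v) (x # w) \<longleftrightarrow> word_less Q v w"
proof
  assume "word_less Q v w"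
  then obtain u a b v' w' where "v = u @ a # v'" "w = u @ b # w'" "letter_less Q a b"
    by (auto simp: word_less_def)
  then show "word_less Q (x # v) (x # w)"
    unfolding word_less_def by (intro exI[of _ "x # u"]) auto
next
  assume "word_less Q (x # v) (x # w)"
  then obtain u a b v' w' where *: "x # v = u @ a # v'" "x # w = u @ b # w'" "letter_less Q a b"
    by (auto simp: word_less_def)
  then have "u \<noteq> []" using letter_less_irrefl[of Q b] by auto
  then obtain u' where "u = x # u'" using * by (cases u) auto
  then show "word_less Q v w" using * by (auto simp: word_less_def)
qed

lemma word_less_iff:
  "word_less Q v w \<longleftrightarrow> (\<exists>n. n < length v \<and> n < length w \<and> (\<forall>i<n. v ! i = w ! i) \<and>
     letter_less Q (v ! n) (w ! n))"
proof
  assume "word_less Q v w"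
  then obtain u x y v' w' where "v = u @ x # v'" "w = u @ y # w'" "letter_less Q x y"
    by (auto simp: word_less_def)
  then show "\<exists>n. n < length v \<and> n < length w \<and> (\<forall>i<n. v ! i = w ! i) \<and>
     letter_less Q (v ! n) (w ! n)"
    by (intro exI[of _ "length u"]) (auto simp: nth_append)
next
  assume "\<exists>n. n < length v \<and> n < length w \<and> (\<forall>i<n. v ! i = w ! i) \<and>
     letter_less Q (v ! n) (w ! n)"
  then obtain n where n: "n < length v" "n < length w" "\<forall>i<n. v ! i = w ! i"
    "letter_less Q (v ! n) (w ! n)" by blast
  moreover have "take n v = take n w" using n by (auto intro: nth_equalityI)
  ultimately show "word_less Q v w"
    unfolding word_less_def using id_take_nth_drop by metis
qed

text \<open>With the letter order as a parameter, both comparisons at a position take the form of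
  left reading against right reading, with an order or with its converse.\<close>

definition lex_less :: "('l \<Rightarrow> 'l \<Rightarrow> bool) \<Rightarrow> 'l list \<Rightarrow> 'l list \<Rightarrow> bool" where
  "lex_less R v w \<longleftrightarrow> (\<exists>n. n < length v \<and> n < length w \<and> (\<forall>i<n. v ! i = w ! i) \<and> R (v ! n) (w ! n))"

lemma word_less_lex:
  "word_less Q v w \<longleftrightarrow> lex_less (letter_less Q) v w"
  "word_less Q v w \<longleftrightarrow> lex_less (letter_less Q)\<inverse>\<inverse> w v"
  unfolding word_less_iff lex_less_def by (auto; metis)+

text \<open>A letter without source can only end a word, so neither word is a proper prefix of the
  other.\<close>

lemma word_total:
  assumes "skewed_gentle Q" "is_word Q v" "is_word Q w" "v \<noteq> []" "w \<noteq> []"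
    and "ltgt Q (hd v) = ltgt Q (hd w)" "ltgt Q (hd v) \<noteq> None"
    and "lsrc Q (last v) = None" "lsrc Q (last w) = None"
  shows "v = w \<or> word_less Q v w \<or> word_less Q w v"
  using assms(2-)
proof (induction v arbitrary: w)
  case (Cons x v)
  obtain y w' where w: "w = y # w'" using Cons.prems(4) by (cases w) auto
  have xy: "x \<in> letters Q" "y \<in> letters Q" using Cons.prems(1,2) w by (auto simp: is_word_Cons)
  show ?case
  proof (cases "x = y")
    case False
    then have "letter_less Q x y \<or> letter_less Q y x"
      using letter_total[OF assms(1) xy] Cons.prems(5,6) w by auto
    then show ?thesis unfolding w word_less_iff by (metis length_greater_0_conv list.distinct(1) not_less0 nth_Cons_0)
  next
    case True
    have "v = [] \<longleftrightarrow> lsrc Q x = None"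
      using Cons.prems(1,7) by (cases v) (auto simp: is_word_Cons)
    moreover have "w' = [] \<longleftrightarrow> lsrc Q x = None"
      using Cons.prems(2,8) True w by (cases w') (auto simp: is_word_Cons)
    moreover have "v = w' \<or> word_less Q v w' \<or> word_less Q w' v" if "v \<noteq> []" "w' \<noteq> []"
      by (rule Cons.IH) (use that Cons.prems w True in \<open>auto simp: is_word_Cons\<close>)
    ultimately show ?thesis using True w by (auto simp: word_less_Cons)
  qed
qed simp

text \<open>\<open>X\<close> need only agree with \<open>x\<close> in the interior: the end letters are compared at most once, as
  the last letters of the two directions.\<close>

lemma lex_less_mirror:
  assumes less: "lex_less R' (winv (take k x)) (drop (Suc k) x)" and k: "k < length x"
    and int: "\<And>i. 0 < i \<Longrightarrow> Suc i < length x \<Longrightarrow> X (int i) = x ! i"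
    and R: "\<And>i j. i < j \<Longrightarrow> j < length x \<Longrightarrow> R' (linv (x ! i)) (x ! j) \<Longrightarrow>
      R (linv (X (int i))) (X (int j))"
  shows "\<exists>n. mirror_less R X (int k) n"
proof -
  obtain n where n: "n < k" "Suc (k + n) < length x"
    and eq: "\<And>i. i < n \<Longrightarrow> winv (take k x) ! i = drop (Suc k) x ! i"
    and ne: "R' (winv (take k x) ! n) (drop (Suc k) x ! n)"
    using less k unfolding lex_less_def by auto
  have nth: "winv (take k x) ! i = linv (x ! (k - Suc i))" "drop (Suc k) x ! i = x ! (Suc (k + i))"
    if "i \<le> n" for i
    using that n k by (simp_all add: nth_winv)
  have "X (int k + s) = linv (X (int k - s))" if "s \<in> {1..<int (Suc n)}" for s
  proof -
    define i where "i = nat (s - 1)"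
    have i: "i < n" "s = int (Suc i)" using that by (auto simp: i_def)
    have "X (int (Suc (k + i))) = linv (X (int (k - Suc i)))"
      using int[of "Suc (k + i)"] int[of "k - Suc i"] eq[OF i(1)] nth[of i] i n by simp
    moreover have "int (Suc (k + i)) = int k + s" "int (k - Suc i) = int k - s"
      using i n by auto
    ultimately show ?thesis by metis
  qed
  moreover have "R (linv (X (int k - int (Suc n)))) (X (int k + int (Suc n)))"
  proof -
    have "R (linv (X (int (k - Suc n)))) (X (int (Suc (k + n))))"
      by (rule R) (use ne nth[of n] n in auto)
    moreover have "int (Suc (k + n)) = int k + int (Suc n)" "int (k - Suc n) = int k - int (Suc n)"
      using n by auto
    ultimately show ?thesis by metis
  qed
  ultimately have "mirror_less R X (int k) (int (Suc n))" by (simp add: mirror_less_def)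
  then show ?thesis ..
qed

section \<open>Comparisons in bands, and totality at loops\<close>

lemma nth_cut:
  assumes "k < length w" "Suc i < length w"
  shows "cut k w ! i = cyc w (int k + int (Suc i))"
    "winv (cut k w) ! i = linv (cyc w (int k - int (Suc i)))"
proof -
  have *: "cut k w ! i = cyc w (int k + int (Suc i))" if "Suc i < length w" for i
  proof (cases "Suc (k + i) < length w")
    case True
    then have "i < length w - Suc k" by simp
    moreover have "int k + int (Suc i) = int (Suc (k + i))" by simp
    then have "cyc w (int k + int (Suc i)) = w ! Suc (k + i)"
      using True by (simp only: cyc_nth of_nat_less_iff of_nat_0_le_iff nat_int)
    ultimately show ?thesis using assms(1) by (simp add: cut_def nth_append)
  next
    case False
    then obtain j where j: "Suc (k + i) = length w + j"
      using le_iff_add[of "length w" "Suc (k + i)"] by auto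
    then have "j < k" "i - (length w - Suc k) = j" using that assms(1) by auto
    moreover have "int k + int (Suc i) = int j + int (length w)" using j by simp
    then have "cyc w (int k + int (Suc i)) = w ! j"
      using \<open>j < k\<close> assms(1) by (simp add: cyc_nth del: of_nat_Suc)
    moreover have "\<not> i < length w - Suc k" using False by simp
    ultimately show ?thesis using assms(1) by (simp add: cut_def nth_append)
  qed
  then show "cut k w ! i = cyc w (int k + int (Suc i))" using assms(2) .
  have len: "length (cut k w) = length w - 1" using assms(1) by (simp add: cut_def)
  have "winv (cut k w) ! i = linv (cut k w ! (length w - 1 - Suc i))"
    using assms by (simp add: nth_winv len)
  also have "cut k w ! (length w - 1 - Suc i) = cyc w (int k + int (Suc (length w - 1 - Suc i)))"
    by (rule *) (use assms in auto)
  also have "int k + int (Suc (length w - 1 - Suc i)) = int k - int (Suc i) + int (length w)"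
    using assms by simp
  finally show "winv (cut k w) ! i = linv (cyc w (int k - int (Suc i)))" by simp
qed

text \<open>\<open>cut k w\<close> shows exactly the distances from 1 to \<open>length w - 1\<close>
  around \<open>k\<close>, whence the bound on \<open>n\<close>.\<close>

lemma lex_less_cut:
  assumes k: "k < length w"
  shows "lex_less R (winv (cut k w)) (cut k w) \<longleftrightarrow>
    (\<exists>n<int (length w). mirror_less R (cyc w) (int k) n)"
proof -
  have len: "length (cut k w) = length w - 1" using k by (simp add: cut_def)
  show ?thesis
  proof
    assume "lex_less R (winv (cut k w)) (cut k w)"
    then obtain n where "n < length w - 1" and n: "R (winv (cut k w) ! n) (cut k w ! n)"
      and eq: "\<forall>i<n. winv (cut k w) ! i = cut k w ! i"
      unfolding lex_less_def len by blast
    then have n: "Suc n < length w" "R (winv (cut k w) ! n) (cut k w ! n)" by simp_all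
    have "cyc w (int k + s) = linv (cyc w (int k - s))" if "s \<in> {1..<int (Suc n)}" for s
    proof -
      define i where "i = nat (s - 1)"
      have i: "i < n" "s = int (Suc i)" using that by (auto simp: i_def)
      show ?thesis using eq nth_cut[OF k, of i] i n(1) by simp
    qed
    then have "mirror_less R (cyc w) (int k) (int (Suc n))"
      using n nth_cut[OF k n(1)] by (simp add: mirror_less_def)
    then show "\<exists>n<int (length w). mirror_less R (cyc w) (int k) n"
      using n(1) by (intro exI[of _ "int (Suc n)"]) simp
  next
    assume "\<exists>n<int (length w). mirror_less R (cyc w) (int k) n"
    then obtain n where n: "n < int (length w)" "mirror_less R (cyc w) (int k) n" by blast
    define m where "m = nat (n - 1)"
    have m: "n = int (Suc m)" "Suc m < length w" using n by (auto simp: m_def mirror_less_def)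
    have "winv (cut k w) ! i = cut k w ! i" if "i < m" for i
    proof -
      have "int (Suc i) \<in> {1..<n}" using that m by simp
      then have "cyc w (int k + int (Suc i)) = linv (cyc w (int k - int (Suc i)))"
        using n(2) unfolding mirror_less_def by blast
      then show ?thesis using nth_cut[OF k, of i] that m by simp
    qed
    moreover have "R (winv (cut k w) ! m) (cut k w ! m)"
      using n(2) nth_cut[OF k m(2)] unfolding mirror_less_def m by simp
    ultimately show "lex_less R (winv (cut k w)) (cut k w)"
      using m by (auto simp: lex_less_def len intro!: exI[of _ m])
  qed
qed

text \<open>The cut leaves out only \<open>w ! k\<close>, which recurs at multiples of the length
  and is its own inverse, so the symmetry of one period spreads to all distances.\<close>

lemma cut_symmetric:
  assumes k: "k < length w" and sym: "winv (cut k w) = cut k w" and loop: "linv (w ! k) = w ! k"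
  shows "reflects (cyc w) (2 * int k)"
proof -
  have ne: "w \<noteq> []" using k by auto
  have *: "cyc w (int k + int s) = linv (cyc w (int k - int s))" for s
  proof -
    define i where "i = s mod length w"
    have i: "i < length w" "s = i + length w * (s div length w)" using ne by (auto simp: i_def)
    have s: "int s = int i + int (length w) * int (s div length w)"
      using i(2) by (metis of_nat_add of_nat_mult)
    then have "int k + int s = int k + int i + int (length w) * int (s div length w)" by simp
    then have p: "cyc w (int k + int s) = cyc w (int k + int i)"
      by (simp only: cyc_period_dvd[OF dvd_triv_left])
    have "int k - int s = int k - int i + int (length w) * (- int (s div length w))"
      using s by simp
    then have m: "cyc w (int k - int s) = cyc w (int k - int i)"
      by (simp only: cyc_period_dvd[OF dvd_triv_left])
    show ?thesis
    proof (cases i)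
      case 0
      then show ?thesis using p m loop k by (simp add: cyc_nth)
    next
      case (Suc j)
      then show ?thesis using nth_cut[OF k, of j] i(1) sym p m by metis
    qed
  qed
  show ?thesis unfolding reflects_def
  proof
    fix s
    show "cyc w (2 * int k - s) = linv (cyc w s)"
    proof (cases "s \<le> int k")
      case True
      then show ?thesis using *[of "nat (int k - s)"] by simp
    next
      case False
      then show ?thesis using *[of "nat (s - int k)"] by simp
    qed
  qed
qed

text \<open>A loop is asked for at \<open>k\<close>, not a special letter, so that the result serves
  \<open>Q\<close> as well as \<open>hat Q\<close>, where special letters have become ordinary
  loops.\<close>

lemma band_total:
  assumes P: "skewed_gentle P" and w: "w \<in> bands P" and k: "k < length w"
    and loop: "lsrc P (w ! k) = ltgt P (w ! k)" and ne: "winv (cut k w) \<noteq> cut k w"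
  shows "word_less P (winv (cut k w)) (cut k w) \<or> word_less P (cut k w) (winv (cut k w))"
proof -
  have len: "length (cut k w) = length w - 1" using k by (simp add: cut_def)
  define bad where "bad i \<longleftrightarrow> i < length w - 1 \<and> winv (cut k w) ! i \<noteq> cut k w ! i" for i
  have "\<exists>i. bad i"
    using ne len by (auto simp: bad_def list_eq_iff_nth_eq)
  then obtain m where m: "bad m" "\<And>i. i < m \<Longrightarrow> \<not> bad i"
    by (metis LeastI not_less_Least)
  define n where "n = int (Suc m)"
  have n: "1 \<le> n" "n < int (length w)" using m(1) by (auto simp: n_def bad_def)
  obtain q where q: "lsrc P (w ! k) = Some q" using bands_nth(1)[OF w k] by blast
  have ck: "cyc w (int k) = w ! k" using k by (simp add: cyc_nth)
  have "cyc w (int k + s) = linv (cyc w (int k - s))" if "s \<in> {1..<n}" for s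
  proof -
    define i where "i = nat (s - 1)"
    have i: "i < m" "s = int (Suc i)" using that by (auto simp: i_def n_def)
    have "winv (cut k w) ! i = cut k w ! i" using m(2)[OF i(1)] m(1) i(1) by (auto simp: bad_def)
    then show ?thesis using nth_cut[OF k, of i] i n by (simp add: n_def)
  qed
  then have sym: "\<forall>s\<in>{1..<n}. cyc w (int k + s) = linv (cyc w (int k - s))" by blast
  have "cyc w (int k + n) \<noteq> linv (cyc w (int k - n))"
    using m(1) nth_cut[OF k, of m] n by (auto simp: bad_def n_def)
  then have "mirror_less (letter_less P) (cyc w) (int k) n \<or>
      mirror_less (letter_less P)\<inverse>\<inverse> (cyc w) (int k) n"
    using cyclic_word_total[OF P cyclic_word_cyc, of w "int k" q n] w q loop ck n sym
    by (auto simp: mirror_less_def)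
  then show ?thesis
    using lex_less_cut[OF k] n(2) unfolding word_less_lex(1)[of P "winv (cut k w)"] word_less_lex(2)[of P "cut k w"]
    by blast
qed

text \<open>Starting from a loop, both readings begin at the same end, and both finish in a trivial
  letter, so \<open>word_total\<close> applies.\<close>

lemma string_total:
  assumes P: "skewed_gentle P" and w: "w \<in> strings P" and k: "0 < k" "Suc k < length w"
    and loop: "lsrc P (w ! k) = ltgt P (w ! k)"
  shows "winv (take k w) = drop (Suc k) w \<or> word_less P (winv (take k w)) (drop (Suc k) w) \<or>
    word_less P (drop (Suc k) w) (winv (take k w))"
proof (rule word_total[OF P])
  have ww: "is_word P w" using w by (simp add: strings_def)
  then have "is_word P (take k w @ drop k w)" "is_word P (take (Suc k) w @ drop (Suc k) w)" by simp_all
  then show "is_word P (winv (take k w))" "is_word P (drop (Suc k) w)"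
    using is_word_winv unfolding is_word_append by blast+
  show ne: "winv (take k w) \<noteq> []" "drop (Suc k) w \<noteq> []" using k by auto
  have "Suc (k - 1) = k" using k by simp
  then have step: "ltgt P (w ! k) = map_option neg (lsrc P (w ! (k - 1)))"
    "ltgt P (w ! Suc k) = map_option neg (lsrc P (w ! k))" "lsrc P (w ! k) \<noteq> None"
    using is_word_step[OF ww, of k] is_word_step[OF ww, of "k - 1"] k by simp_all
  have hd1: "hd (drop (Suc k) w) = w ! Suc k" using k by (simp add: hd_drop_conv_nth)
  have "hd (winv (take k w)) = linv (w ! (k - 1))"
    using k by (simp add: hd_conv_nth[OF ne(1)] nth_winv)
  then show "ltgt P (hd (winv (take k w))) = ltgt P (hd (drop (Suc k) w))"
    using step loop hd1 by (cases "lsrc P (w ! (k - 1))") auto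
  then show "ltgt P (hd (winv (take k w))) \<noteq> None" using step hd1 by simp
  have "last (winv (take k w)) = linv (w ! 0)"
    using k by (simp add: last_conv_nth[OF ne(1)] nth_winv)
  then show "lsrc P (last (winv (take k w))) = None" using strings_nth(2)[OF w] by auto
  have "last (drop (Suc k) w) = w ! (length w - 1)"
    using k last_conv_nth[of w] by fastforce
  then show "lsrc P (last (drop (Suc k) w)) = None" using strings_nth(3)[OF w] by auto
qed

lemma string_symmetric:
  assumes w: "w \<in> strings P" and k: "k < length w" and sym: "winv (take k w) = drop (Suc k) w"
    and s: "linv (w ! k) = w ! k"
  shows "reflects (cyc w) (2 * int k)"
proof -
  have w_eq: "w = take k w @ w ! k # drop (Suc k) w" using k by (simp add: id_take_nth_drop)
  have "winv w = winv (drop (Suc k) w) @ linv (w ! k) # winv (take k w)"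
    by (subst w_eq) (simp add: winv_def)
  also have "\<dots> = w"
    unfolding sym using w_eq s sym[symmetric] by simp
  finally have "rotate 0 w = winv w" by simp
  moreover have "w \<noteq> []" using k by auto
  ultimately have "reflects (cyc w) (-1)" by (simp add: reflects_cyc_iff)
  \<comment> \<open>The mirror of the whole string has sum -1. One period further its centre is the
    position \<open>k\<close>, as the length is \<open>2 * k + 1\<close>.\<close>
  then have "reflects (cyc w) (-1 + int (length w))"
    by (rule reflects_shift) simp
  moreover have "length w = 2 * k + 1"
    using arg_cong[OF sym, of length] k by simp
  ultimately show ?thesis by simp
qed


section \<open>The words \<open>A(w)\<close>\<close>

text \<open>The rule of \<open>A_string\<close> and \<open>A_band\<close> for bi-infinite words. In
  a cyclic word the special letter is kept exactly at centres of symmetry, where the two readings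
  cannot be compared.\<close>

definition A_seq ::
  "('v, 'a) polarized_quiver \<Rightarrow> (int \<Rightarrow> ('v, 'a) letter) \<Rightarrow> int \<Rightarrow> ('v, 'a) letter" where
  "A_seq Q w k =
     (if is_special (w k) then
        (if \<exists>n. mirror_less (letter_less Q)\<inverse>\<inverse> w k n then lo Q (w k)
         else if \<exists>n. mirror_less (letter_less Q) w k n then hi Q (w k) else w k)
      else w k)"

lemma lift_pair_A_seq:
  assumes "skewed_gentle Q" "cyclic_word Q w"
  shows "lift_pair (letter_less Q) (hat_less Q) (lo Q) (hi Q) w (A_seq Q w)"
  by (rule lift_pair_letters[OF assms]) (auto simp: A_seq_def)

lemma A_seq_hi: 
  assumes "is_special (w k)" "mirror_less (letter_less Q) w k n"
  shows "A_seq Q w k = hi Q (w k)"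
  using assms mirror_less_asym[OF assms(2)] letter_less_asym[of Q] by (auto simp: A_seq_def)

lemma A_seq_lo: 
  assumes "is_special (w k)" "mirror_less (letter_less Q)\<inverse>\<inverse> w k n"
  shows "A_seq Q w k = lo Q (w k)"
  using assms by (auto simp: A_seq_def)

text \<open>The lifts that \<open>mirror_less_lift\<close> asks for at smaller distances are those
  of \<open>A_seq\<close> by definition, so this direction takes no induction.\<close>

lemma A_seq_mirror:
  assumes Q: "skewed_gentle Q" "cyclic_word Q w" and k: "is_special (w k)" 
    and nc: "\<not> reflects w (2 * k)"
  shows "A_seq Q w k = lo Q (w k) \<and> (\<exists>n. mirror_less (hat_less Q)\<inverse>\<inverse> (A_seq Q w) k n) \<or>
    A_seq Q w k = hi Q (w k) \<and> (\<exists>n. mirror_less (hat_less Q) (A_seq Q w) k n)"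
proof -
  interpret up: lift_pair "letter_less Q" "hat_less Q" "lo Q" "hi Q" w "A_seq Q w"
    by (rule lift_pair_A_seq[OF Q])
  interpret down: lift_pair "(letter_less Q)\<inverse>\<inverse>" "(hat_less Q)\<inverse>\<inverse>" "hi Q" "lo Q" w "A_seq Q w"
    by (rule up.lift_pair_converse)
  show ?thesis
    using up.mirror_trichotomy[OF k] nc up.mirror_less_lift[OF k] down.mirror_less_lift[OF k]
      A_seq_hi A_seq_lo k by metis
qed

text \<open>The mirror exchanges the two comparisons, and \<open>lo\<close> and \<open>hi\<close>
  are inverse to each other.\<close>

lemma A_seq_reflects:
  assumes a: "reflects w a"
  shows "reflects (A_seq Q w) a"
  unfolding reflects_def
proof
  fix s
  have w: "w (a - s) = linv (w s)" using a by (simp add: reflects_def)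
  have "mirror_less R\<inverse>\<inverse> w (a - s) n \<longleftrightarrow> mirror_less R w s n" for R n
    using mirror_less_reflect[OF a, of R s n] mirror_less_reflect[OF a, of "R\<inverse>\<inverse>" "a - s" n] by auto
  from this[of "letter_less Q"] this[of "(letter_less Q)\<inverse>\<inverse>"]
  have flip: "mirror_less (letter_less Q)\<inverse>\<inverse> w (a - s) n \<longleftrightarrow> mirror_less (letter_less Q) w s n"
    "mirror_less (letter_less Q) w (a - s) n \<longleftrightarrow> mirror_less (letter_less Q)\<inverse>\<inverse> w s n" for n
    by simp_all
  have asym: "\<not> (mirror_less (letter_less Q) w s n \<and> mirror_less (letter_less Q)\<inverse>\<inverse> w s m)" for n m
    using mirror_less_asym[of "letter_less Q" w s n m] letter_less_asym by blast
  show "A_seq Q w (a - s) = linv (A_seq Q w s)"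
    using asym linv_special[of "w s"] by (auto simp: A_seq_def flip w)
qed

lemma A_seq_period:
  assumes "\<And>i. w (i + d) = w i"
  shows "A_seq Q w (k + d) = A_seq Q w k"
proof -
  have "w (i + - d) = w i" for i using assms[of "i - d"] by simp
  then have *: "mirror_less R w (k + d) = mirror_less R w k" for R
    using mirror_less_shift[of w d R k, OF assms] mirror_less_shift[of w "- d" R "k + d"]
    by (auto simp: fun_eq_iff)
  show ?thesis unfolding A_seq_def assms * by (rule refl)
qed

lemma F_letter_letters: "skewed_gentle Q \<Longrightarrow> x \<in> letters Q \<Longrightarrow> F_letter Q x = x"
  by (auto simp: letters_def skewed_gentle_def)

lemma letters_hat_ordinary: "x \<in> letters Q \<Longrightarrow> \<not> is_special x \<Longrightarrow> x \<in> letters (hat Q)"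
  by (auto simp: letters_def is_special_def arrows_def)

lemma A_seq_ends:
  assumes "skewed_gentle Q" "w k \<in> letters Q"
  shows "lsrc Q (A_seq Q w k) = lsrc Q (w k)" "ltgt Q (A_seq Q w k) = ltgt Q (w k)"
    "F_letter Q (A_seq Q w k) = w k"
  using assms lo_hi_ends[OF assms] F_letter_letters[OF assms] by (auto simp: A_seq_def)

lemma A_seq_letters_hat:
  assumes Q: "skewed_gentle Q" "cyclic_word Q w" and nc: "is_special (w k) \<Longrightarrow> \<not> reflects w (2 * k)"
  shows "A_seq Q w k \<in> letters (hat Q)"
proof -
  have w: "w k \<in> letters Q" using Q(2) by (simp add: cyclic_word_def)
  show ?thesis
  proof (cases "is_special (w k)")
    case True
    then show ?thesis using A_seq_mirror[OF Q True nc[OF True]] lo_hi_ends[OF Q(1) w True] by metis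
  next
    case False
    then show ?thesis using letters_hat_ordinary[OF w] by (simp add: A_seq_def)
  qed
qed

text \<open>A comparison of the finite readings is one of the periodic readings at the same
  distance. Away from centres \<open>string_total\<close> supplies one, so the value
  \<open>undefined\<close> of \<open>A_letter\<close> does not occur.\<close>

lemma A_string_letter_eq:
  assumes Q: "skewed_gentle Q" and w: "w \<in> strings Q" and k: "k < length w"
    and nc: "is_special (w ! k) \<Longrightarrow> \<not> reflects (cyc w) (2 * int k)"
  shows "A_string_letter Q w k = A_seq Q (cyc w) (int k)"
proof (cases "is_special (w ! k)")
  case False
  then show ?thesis using k by (simp add: A_string_letter_def A_letter_def A_seq_def cyc_nth)
next
  case True
  have ck: "cyc w (int i) = w ! i" if "i < length w" for i using that by (simp add: cyc_nth)
  have "w ! k \<noteq> w ! 0" "w ! k \<noteq> w ! (length w - 1)"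
    using True strings_nth(2,3)[OF w] by (auto simp: is_special_def)
  then have "0 < k" "k \<noteq> length w - 1" by (auto intro: gr0I)
  then have k': "0 < k" "Suc k < length w" using k by auto
  have "winv (take k w) \<noteq> drop (Suc k) w"
    using string_symmetric[OF w k] nc[OF True] linv_special[OF True] by blast
  then have total: "word_less Q (winv (take k w)) (drop (Suc k) w) \<or>
      word_less Q (drop (Suc k) w) (winv (take k w))"
    using string_total[OF Q w k'] ltgt_special[OF True, of Q] by metis
  have up: "\<exists>n. mirror_less (letter_less Q) (cyc w) (int k) n"
    if "word_less Q (winv (take k w)) (drop (Suc k) w)"
    by (rule lex_less_mirror[OF that[unfolded word_less_lex(1)] k]) (simp_all add: ck)
  have down: "\<exists>n. mirror_less (letter_less Q)\<inverse>\<inverse> (cyc w) (int k) n"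
    if "word_less Q (drop (Suc k) w) (winv (take k w))"
    by (rule lex_less_mirror[OF that[unfolded word_less_lex(2)] k]) (simp_all add: ck)
  have sp: "is_special (cyc w (int k))" using True k ck by simp
  show ?thesis
  proof (cases "word_less Q (drop (Suc k) w) (winv (take k w))")
    case less: True
    then show ?thesis using down A_seq_lo[of "cyc w" "int k" Q] sp True ck[OF k]
      by (auto simp: A_string_letter_def A_letter_def lo_def)
  next
    case False
    then show ?thesis using total up A_seq_hi[of "cyc w" "int k" Q] sp True ck[OF k]
      by (auto simp: A_string_letter_def A_letter_def hi_def)
  qed
qed

lemma A_band_letter_eq:
  assumes Q: "skewed_gentle Q" and w: "w \<in> bands Q" and k: "k < length w"
    and nc: "is_special (w ! k) \<Longrightarrow> \<not> reflects (cyc w) (2 * int k)"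
  shows "A_band_letter Q w k = A_seq Q (cyc w) (int k)"
proof (cases "is_special (w ! k)")
  case False
  then show ?thesis using k by (simp add: A_band_letter_def A_letter_def A_seq_def cyc_nth)
next
  case True
  have ck: "cyc w (int k) = w ! k" using k by (simp add: cyc_nth)
  have "winv (cut k w) \<noteq> cut k w"
    using cut_symmetric[OF k] nc[OF True] linv_special[OF True] by blast
  then have total: "word_less Q (winv (cut k w)) (cut k w) \<or> word_less Q (cut k w) (winv (cut k w))"
    using band_total[OF Q w k] ltgt_special[OF True, of Q] by metis
  have up: "\<exists>n. mirror_less (letter_less Q) (cyc w) (int k) n"
    if "word_less Q (winv (cut k w)) (cut k w)"
    using that lex_less_cut[OF k] unfolding word_less_lex(1) by blast
  have down: "\<exists>n. mirror_less (letter_less Q)\<inverse>\<inverse> (cyc w) (int k) n"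
    if "word_less Q (cut k w) (winv (cut k w))"
    using that lex_less_cut[OF k] unfolding word_less_lex(2) by blast
  have sp: "is_special (cyc w (int k))" using True ck by simp
  show ?thesis
  proof (cases "word_less Q (cut k w) (winv (cut k w))")
    case less: True
    then show ?thesis using down A_seq_lo[of "cyc w" "int k" Q] sp True ck
      by (auto simp: A_band_letter_def A_letter_def lo_def)
  next
    case False
    then show ?thesis using total up A_seq_hi[of "cyc w" "int k" Q] sp True ck
      by (auto simp: A_band_letter_def A_letter_def hi_def)
  qed
qed

section \<open>Comparisons in strings of the gentle quiver\<close>

lemma puncture_hat: "x \<in> letters (hat Q) \<Longrightarrow> puncture x = x"
  by (auto simp: letters_def)

text \<open>\<open>X\<close> may carry a special letter where \<open>x\<close> ends in a punctured
  one. The left end enters comparisons inverted, which explains the form of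
  \<open>first\<close>.\<close>

lemma hat_string_mirror:
  assumes x: "x \<in> strings (hat Q)"
    and int: "\<And>i. 0 < i \<Longrightarrow> Suc i < length x \<Longrightarrow> X (int i) = x ! i"
    and first: "puncture (linv (X 0)) = linv (x ! 0)"
    and last: "puncture (X (int (length x - 1))) = x ! (length x - 1)"
    and k: "k < length x"
  shows "word_less (hat Q) (winv (take k x)) (drop (Suc k) x) \<Longrightarrow>
      \<exists>n. mirror_less (hat_less Q) X (int k) n"
    and "word_less (hat Q) (drop (Suc k) x) (winv (take k x)) \<Longrightarrow>
      \<exists>n. mirror_less (hat_less Q)\<inverse>\<inverse> X (int k) n"
proof -
  have let_x: "x ! i \<in> letters (hat Q)" if "i < length x" for i
    using x that by (simp add: strings_def is_word_nth)
  have left: "puncture (linv (X (int i))) = linv (x ! i)" if "Suc i < length x" for i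
  proof (cases "i = 0")
    case False
    then show ?thesis using int[of i] that puncture_hat[of "linv (x ! i)" Q] let_x[of i] by simp
  qed (use first in simp)
  have right: "puncture (X (int j)) = x ! j" if "0 < j" "j < length x" for j
  proof (cases "Suc j = length x")
    case True
    then have "j = length x - 1" by simp
    then show ?thesis using last by simp
  next
    case False
    then show ?thesis using int[of j] that puncture_hat[of "x ! j" Q] let_x[of j] by simp
  qed
  have cmp: "puncture (linv (X (int i))) = linv (x ! i)" "puncture (X (int j)) = x ! j"
    if "i < j" "j < length x" for i j
    using left[of i] right[of j] that by auto
  show "\<exists>n. mirror_less (hat_less Q) X (int k) n"
    if "word_less (hat Q) (winv (take k x)) (drop (Suc k) x)"
    by (rule lex_less_mirror[OF that[unfolded word_less_lex(1)] k])
      (simp_all add: int hat_less_def cmp)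
  show "\<exists>n. mirror_less (hat_less Q)\<inverse>\<inverse> X (int k) n"
    if "word_less (hat Q) (drop (Suc k) x) (winv (take k x))"
    by (rule lex_less_mirror[OF that[unfolded word_less_lex(2)] k])
      (simp_all add: int hat_less_def cmp)
qed

lemma A_seq_center:
  assumes "reflects w (2 * k)"
  shows "A_seq Q w k = w k"
proof -
  have "\<not> (\<exists>n. mirror_less (letter_less Q) w k n)"
    "\<not> (\<exists>n. mirror_less (letter_less Q)\<inverse>\<inverse> w k n)"
    using mirror_less_not_reflects[of _ w k] assms letter_less_irrefl conversepD by metis+
  then show ?thesis unfolding A_seq_def by presburger
qed

lemma is_direct_lo_hi [simp]: "is_direct (lo Q x)" "\<not> is_direct (hi Q x)"
  by (auto simp: is_direct_def lo_def hi_def)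

text \<open>By \<open>A_seq_mirror\<close> the lifted word deviates at \<open>k\<close> in the
  direction that fits its letter there. The finite comparison of \<open>x\<close> goes one way or
  the other and transfers to \<open>A_seq Q w\<close>, so it can only go that way.\<close>

lemma A_seq_string_rule:
  assumes Q: "skewed_gentle Q" and w: "cyclic_word Q w" and x: "x \<in> strings (hat Q)"
    and int: "\<And>i. 0 < i \<Longrightarrow> Suc i < length x \<Longrightarrow> A_seq Q w (int i) = x ! i"
    and first: "puncture (linv (A_seq Q w 0)) = linv (x ! 0)"
    and last: "puncture (A_seq Q w (int (length x - 1))) = x ! (length x - 1)"
    and k: "0 < k" "Suc k < length x" "is_special (F_letter Q (x ! k))" "\<not> reflects w (2 * int k)"
    and ne: "winv (take k x) \<noteq> drop (Suc k) x"
  shows "is_direct (x ! k) \<longleftrightarrow> word_less (hat Q) (drop (Suc k) x) (winv (take k x))"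
proof -
  have wk: "w (int k) \<in> letters Q" using w by (simp add: cyclic_word_def)
  have xk: "x ! k = A_seq Q w (int k)" using int k by simp
  then have sp: "is_special (w (int k))" using k(3) A_seq_ends(3)[OF Q, of w, OF wk] by simp
  have "lsrc (hat Q) (x ! k) = ltgt (hat Q) (x ! k)"
    using A_seq_ends(1,2)[OF Q, of w, OF wk] ltgt_special[OF sp, of Q] xk by simp
  then have total: "word_less (hat Q) (winv (take k x)) (drop (Suc k) x) \<or>
      word_less (hat Q) (drop (Suc k) x) (winv (take k x))"
    using string_total[OF skewed_gentle_hat[OF Q] x k(1,2)] ne by blast
  have "k < length x" using k by simp
  note mirror = hat_string_mirror[OF x int first last this]
  have excl: "\<not> (mirror_less (hat_less Q) (A_seq Q w) (int k) n \<and>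
      mirror_less (hat_less Q)\<inverse>\<inverse> (A_seq Q w) (int k) m)" for n m
    using mirror_less_asym[of "hat_less Q"] hat_less_asym by blast
  show ?thesis
    using A_seq_mirror[OF Q w sp k(4)] total mirror excl xk is_direct_lo_hi by metis
qed

text \<open>The end letters have hypotheses of their own, because in the symmetric cases punctured
  letters stand there in place of the values of \<open>A_seq\<close>.\<close>

lemma strings_hatI:
  assumes Q: "skewed_gentle Q" and w: "cyclic_word Q w" and len: "2 \<le> length x"
    and int: "\<And>i. 0 < i \<Longrightarrow> Suc i < length x \<Longrightarrow> x ! i = A_seq Q w (int i)"
    and nc: "\<And>i. 0 < i \<Longrightarrow> Suc i < length x \<Longrightarrow> is_special (w (int i)) \<Longrightarrow> \<not> reflects w (2 * int i)"
    and dom: "\<And>i. Suc i < length x \<Longrightarrow> lsrc Q (w (int i)) \<noteq> None"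
    and first: "x ! 0 = TrivInv i r" "x ! 0 \<in> letters (hat Q)" "lsrc Q (x ! 0) = lsrc Q (w 0)"
    and last: "x ! (length x - 1) = Triv j t" "x ! (length x - 1) \<in> letters (hat Q)"
      "ltgt Q (x ! (length x - 1)) = ltgt Q (w (int (length x - 1)))"
  shows "x \<in> strings (hat Q)"
proof -
  have let_w: "w i \<in> letters Q" and step: "ltgt Q (w (i + 1)) = map_option neg (lsrc Q (w i))" for i
    using w by (auto simp: cyclic_word_def)
  have "x ! i \<in> letters (hat Q)" if "i < length x" for i
  proof -
    have "i = 0 \<or> i = length x - 1 \<or> 0 < i \<and> Suc i < length x" using that by linarith
    then show ?thesis using first(2) last(2) int nc A_seq_letters_hat[OF Q w] by metis
  qed
  moreover have "lsrc Q (x ! i) = lsrc Q (w (int i))" if "Suc i < length x" for i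
    using that first(3) int[of i] A_seq_ends(1)[OF Q let_w] by (cases "i = 0") auto
  moreover have "ltgt Q (x ! Suc i) = ltgt Q (w (int i + 1))" if "Suc i < length x" for i
  proof (cases "Suc (Suc i) = length x")
    case True
    then have "length x - 1 = Suc i" "int (Suc i) = int i + 1" by simp_all
    then show ?thesis using last(3) by metis
  next
    case False
    then show ?thesis using that int[of "Suc i"] A_seq_ends(2)[OF Q let_w] by (simp add: add.commute)
  qed
  ultimately have "is_word (hat Q) x" using dom step by (simp add: is_word_nth)
  moreover have "x \<noteq> []" using len by auto
  ultimately show ?thesis using first last by (simp add: strings_def hd_conv_nth last_conv_nth)
qed

section \<open>Lifts of strings\<close>

lemma letters_not_punctured: "x \<in> letters Q \<Longrightarrow> \<not> punctured Q x"
  by (auto simp: letters_def punctured_def)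

lemma F_word_winv: "F_word Q (winv x) = winv (F_word Q x)"
  by (simp add: F_word_def winv_def rev_map)

lemma A_string_asymmetric:
  assumes Q: "skewed_gentle Q" and w: "w \<in> strings Q" and asym: "\<not> symmetric_string w"
  shows "A_string Q w \<in> strings (hat Q)" "admissible_string Q (A_string Q w)"
    "completion Q (A_string Q w) = w"
proof -
  let ?W = "cyc w" and ?X = "A_seq Q (cyc w)" and ?x = "A_string Q w"
  have cw: "cyclic_word Q ?W" using cyclic_word_cyc w by blast
  have nc: "\<not> reflects ?W a" for a using asym symmetric_string_iff[OF w] by blast
  have len: "length ?x = length w" using asym by (simp add: A_string_def)
  have nth: "?x ! i = ?X (int i)" if "i < length w" for i
    using that asym A_string_letter_eq[OF Q w that] nc by (simp add: A_string_def)
  have let_w: "w ! i \<in> letters Q" if "i < length w" for i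
    using w that by (simp add: strings_def is_word_nth)
  have ck: "?W (int i) = w ! i" if "i < length w" for i using that by (simp add: cyc_nth)
  note ends = strings_nth[OF w]
  obtain i r where i: "w ! 0 = TrivInv i r" using ends(2) by blast
  obtain j t where j: "w ! (length w - 1) = Triv j t" using ends(3) by blast
  have ne: "w \<noteq> []" using ends(1) by auto
  then have W0: "?W 0 = w ! 0" using ck[of 0] by simp
  have X0: "?X 0 = w ! 0" unfolding A_seq_def W0 using i by (simp add: is_special_def)
  have lt: "length w - 1 < length w" using ends(1) by simp
  have Xl: "?X (int (length w - 1)) = w ! (length w - 1)"
    unfolding A_seq_def ck[OF lt] using j by (simp add: is_special_def)
  have x0: "?x ! 0 = w ! 0" using nth[of 0] X0 ne by simp
  have xl: "?x ! (length w - 1) = w ! (length w - 1)" using nth[of "length w - 1"] Xl ends(1) by simp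
  have hat0: "w ! 0 \<in> letters (hat Q)" and hatl: "w ! (length w - 1) \<in> letters (hat Q)"
    using letters_hat_ordinary[OF let_w[of 0]] letters_hat_ordinary[OF let_w[OF lt]] i j ne
    by (auto simp: is_special_def)
  show st: "?x \<in> strings (hat Q)"
  proof (rule strings_hatI[OF Q cw, where i = i and r = r and j = j and t = t])
    show "lsrc Q (?W (int i)) \<noteq> None" if "Suc i < length ?x" for i
      using ends(4)[of i] that ck[of i] len by auto
    show "lsrc Q (?x ! 0) = lsrc Q (?W 0)" using x0 W0 by simp
    show "ltgt Q (?x ! (length ?x - 1)) = ltgt Q (?W (int (length ?x - 1)))"
      unfolding len xl ck[OF lt] ..
  qed (use nth nc len ends(1) hat0 hatl i j x0 xl in auto)
  have Fx: "F_word Q ?x = w"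
  proof (rule nth_equalityI)
    fix i assume "i < length (F_word Q ?x)"
    then have "i < length w" by (simp add: F_word_def len)
    then show "F_word Q ?x ! i = w ! i"
      using nth A_seq_ends(3)[OF Q, of ?W "int i"] ck let_w by (simp add: F_word_def len)
  qed (simp add: F_word_def len)
  have "?x \<noteq> []" using len ends(1) by auto
  then have hdl: "hd ?x = w ! 0" "last ?x = w ! (length w - 1)"
    using x0 xl len by (simp_all add: hd_conv_nth last_conv_nth)
  have unp: "\<not> punctured Q (hd ?x)" "\<not> punctured Q (last ?x)"
    unfolding hdl using letters_not_punctured[OF let_w[of 0]] letters_not_punctured[OF let_w[OF lt]] ne
    by simp_all
  then show "completion Q ?x = w"
    using st Fx by (simp add: completion_def completion_string_def)
  \<comment> \<open>Equality would descend along \<open>F_word\<close> and make \<open>w\<close>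
    symmetric about \<open>k\<close>.\<close>
  have "winv (take k ?x) \<noteq> drop (Suc k) ?x"
    if "0 < k" "Suc k < length ?x" "is_special (F_letter Q (?x ! k))" for k
  proof
    assume "winv (take k ?x) = drop (Suc k) ?x"
    then have "F_word Q (winv (take k ?x)) = F_word Q (drop (Suc k) ?x)" by simp
    then have "winv (take k w) = drop (Suc k) w"
      using Fx unfolding F_word_winv by (simp add: F_word_def flip: take_map drop_map)
    moreover have "F_word Q ?x ! k = F_letter Q (?x ! k)" using that by (simp add: F_word_def)
    then have "is_special (w ! k)" using that Fx by simp
    moreover have "k < length w" using that len by simp
    ultimately show False using string_symmetric[OF w] linv_special nc by blast
  qed
  note neq = this
  have first: "puncture (linv (?X 0)) = linv (?x ! 0)"
    unfolding x0 X0 using i by simp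
  have last: "puncture (?X (int (length ?x - 1))) = ?x ! (length ?x - 1)"
    unfolding len xl Xl using j by simp
  show "admissible_string Q ?x"
    unfolding admissible_string_def
  proof (intro conjI ballI impI)
    fix k assume "k \<in> {0<..<length ?x - 1}" and sp: "is_special (F_letter Q (?x ! k))"
    then have k: "0 < k" "Suc k < length ?x" by auto
    show ne: "winv (take k ?x) \<noteq> drop (Suc k) ?x" by (rule neq[OF k sp])
    show "is_direct (?x ! k) \<longleftrightarrow> word_less (hat Q) (drop (Suc k) ?x) (winv (take k ?x))"
      by (rule A_seq_string_rule[OF Q cw st _ first last k sp _ ne]) (use nth nc k len in simp_all)
  qed (use st unp in blast)+
qed

lemma reflects_twice_dvd:
  assumes "w \<in> strings Q \<union> pbands Q" "reflects (cyc w) a" "reflects (cyc w) b"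
  shows "int (length w) dvd a - b"
  using cyc_primitive[OF assms(1)] reflects_period[OF assms(2,3)] by blast

lemma linv_fixed: "linv x = x \<Longrightarrow> is_special x"
  by (cases x) (auto simp: is_special_def)

text \<open>With even length two mutually inverse letters would meet in the middle, at an end
  \<open>p\<close> with \<open>neg p = p\<close>; but signs are 1 or -1. In odd length the middle
  letter is its own inverse, hence special.\<close>

lemma symmetric_string_middle:
  assumes Q: "skewed_gentle Q" and w: "w \<in> strings Q" and sym: "symmetric_string w"
  obtains m b where "length w = 2 * m + 1" "w ! m = Star b" "b \<in> special_verts Q" "0 < m"
    "w = take m w @ Star b # winv (take m w)"
proof -
  note ends = strings_nth[OF w]
  have winv: "winv w = w" using sym by (simp add: symmetric_string_def)
  have ww: "is_word Q w" using w by (simp add: strings_def)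
  define m where "m = length w div 2"
  have nth: "w ! i = linv (w ! (length w - Suc i))" if "i < length w" for i
    using nth_winv[OF that] winv by simp
  have odd: "length w = 2 * m + 1"
  proof (rule ccontr)
    assume "length w \<noteq> 2 * m + 1"
    then have l: "length w = 2 * m" "0 < m" using ends(1) by (auto simp: m_def)
    then have "w ! m = linv (w ! (m - 1))" using nth[of m] by simp
    moreover have "Suc (m - 1) = m" using l by simp
    ultimately have "map_option neg (lsrc Q (w ! (m - 1))) = lsrc Q (w ! (m - 1))"
      "lsrc Q (w ! (m - 1)) \<noteq> None"
      using is_word_step[OF ww, of "m - 1"] l by auto
    then obtain p where p: "lsrc Q (w ! (m - 1)) = Some p" "neg p = p" by auto
    have "w ! (m - 1) \<in> letters Q" using ww l by (simp add: is_word_nth)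
    then show False using letter_end_range[OF Q _ disjI2[OF p(1)]] p(2)
      by (auto simp: neg_def prod_eq_iff)
  qed
  moreover have "0 < m" using ends(1) odd by simp
  moreover have "linv (w ! m) = w ! m" using nth[of m] odd by simp
  then obtain b where b: "w ! m = Star b" using linv_fixed by (auto simp: is_special_def)
  moreover have "w ! m \<in> letters Q" using ww odd by (simp add: is_word_nth)
  then have "b \<in> special_verts Q" using b by (auto simp: letters_def)
  moreover have "w = take m w @ Star b # winv (take m w)"
  proof -
    have "drop (Suc m) w = winv (take m w)"
    proof (rule nth_equalityI)
      fix i assume "i < length (drop (Suc m) w)"
      then have i: "i < m" using odd by simp
      have "w ! Suc (m + i) = linv (w ! (length w - Suc (Suc (m + i))))"
        by (rule nth) (use i odd in simp)
      also have "length w - Suc (Suc (m + i)) = m - Suc i" using i odd by simp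
      finally show "drop (Suc m) w ! i = winv (take m w) ! i"
        using i odd by (simp add: nth_winv)
    qed (use odd in simp)
    then show ?thesis using b odd id_take_nth_drop[of m w] by simp
  qed
  ultimately show ?thesis using that by blast
qed

lemma Triv_hat: "b \<in> special_verts Q \<Longrightarrow> skewed_gentle Q \<Longrightarrow>
    Triv b (-1) \<in> letters (hat Q) \<and> TrivInv b (-1) \<in> letters (hat Q)"
  using special_verts_subset[of Q] by (auto simp: letters_def)

lemma A_string_symmetric:
  assumes Q: "skewed_gentle Q" and w: "w \<in> strings Q" and sym: "symmetric_string w"
  shows "A_string Q w \<in> strings (hat Q)" "admissible_string Q (A_string Q w)"
    "completion Q (A_string Q w) = w"
proof -
  let ?W = "cyc w" and ?X = "A_seq Q (cyc w)" and ?x = "A_string Q w"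
  obtain m b where m: "length w = 2 * m + 1" "w ! m = Star b" "b \<in> special_verts Q" "0 < m"
    "w = take m w @ Star b # winv (take m w)"
    by (rule symmetric_string_middle[OF Q w sym])
  have cw: "cyclic_word Q ?W" using cyclic_word_cyc w by blast
  note ends = strings_nth[OF w]
  have ne: "w \<noteq> []" using m(1) by auto
  have ck: "?W (int i) = w ! i" if "i < length w" for i using that by (simp add: cyc_nth)
  have let_w: "w ! i \<in> letters Q" if "i < length w" for i
    using w that by (simp add: strings_def is_word_nth)
  have "reflects ?W (-1)" using sym reflects_cyc_iff[OF ne, of "-1"] by (simp add: symmetric_string_def)
  then have "reflects ?W (-1 + int (length w))" by (rule reflects_shift) (rule cyc_period)
  then have refl: "reflects ?W (2 * int m)" using m(1) by simp
  \<comment> \<open>The sums of two mirrors agree modulo the length \<open>2 * m + 1\<close>, so no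
    position before \<open>m\<close> is a centre.\<close>
  have nc: "\<not> reflects ?W (2 * int k)" if "k < m" for k
  proof
    assume "reflects ?W (2 * int k)"
    then have "int (length w) dvd 2 * int m - 2 * int k"
      using reflects_twice_dvd[OF _ refl] w by blast
    then have "int (length w) \<le> 2 * int m - 2 * int k" using that by (intro zdvd_imp_le) auto
    then show False using m(1) by simp
  qed
  have div: "length w div 2 = m" using m(1) by simp
  have x: "?x = map (A_string_letter Q w) [0..<m] @ [Triv b (-1)]"
    using sym div m(2) by (simp add: A_string_def Let_def)
  have len: "length ?x = m + 1" by (simp add: x)
  have nth: "?x ! i = ?X (int i)" if "i < m" for i
    using that A_string_letter_eq[OF Q w, of i] nc[OF that] m(1) by (simp add: x nth_append)
  have xm: "?x ! m = Triv b (-1)" by (simp add: x nth_append)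
  obtain i r where i: "w ! 0 = TrivInv i r" using ends(2) by blast
  have W0: "?W 0 = w ! 0" using ck[of 0] ne by simp
  have X0: "?X 0 = w ! 0" unfolding A_seq_def W0 using i by (simp add: is_special_def)
  have Wm: "?W (int m) = Star b" using ck[of m] m(1,2) by simp
  have Xm: "?X (int m) = Star b" using A_seq_center[OF refl] Wm by simp
  have x0: "?x ! 0 = w ! 0" using nth[of 0] X0 m(4) by simp
  have hat0: "w ! 0 \<in> letters (hat Q)"
    using letters_hat_ordinary[OF let_w[of 0]] i m(1) by (auto simp: is_special_def)
  have lx: "length ?x - 1 = m" by (simp add: len)
  show st: "?x \<in> strings (hat Q)"
  proof (rule strings_hatI[OF Q cw, where i = i and r = r and j = b and t = "-1"])
    show "lsrc Q (?W (int i)) \<noteq> None" if "Suc i < length ?x" for i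
      using ends(4)[of i] that ck[of i] len m(1) by auto
    show "lsrc Q (?x ! 0) = lsrc Q (?W 0)" using x0 ck[of 0] ne by simp
    show "ltgt Q (?x ! (length ?x - 1)) = ltgt Q (?W (int (length ?x - 1)))"
      unfolding lx xm Wm by simp
    show "?x ! (length ?x - 1) \<in> letters (hat Q)"
      unfolding lx xm using Triv_hat[OF m(3) Q] by blast
  qed (use nth nc len hat0 i x0 xm lx m(4) in auto)
  have Fx: "F_word Q (butlast ?x) = take m w"
  proof (rule nth_equalityI)
    fix i assume "i < length (F_word Q (butlast ?x))"
    then have "i < m" by (simp add: F_word_def len)
    then show "F_word Q (butlast ?x) ! i = take m w ! i"
      using nth A_seq_ends(3)[OF Q, of ?W "int i"] ck let_w m(1)
      by (simp add: F_word_def len nth_butlast)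
  qed (simp add: F_word_def len m(1))
  have hdx: "hd ?x = w ! 0" using x0 len by (subst hd_conv_nth) auto
  have lastx: "last ?x = Triv b (-1)" by (simp add: x)
  have unp: "\<not> punctured Q (hd ?x)" "punctured Q (last ?x)"
    unfolding hdx lastx using letters_not_punctured[OF let_w[of 0]] m(1,3)
    by (auto simp: punctured_def)
  have "F_word Q ?x = F_word Q (butlast ?x) @ [Star b]"
    using m(3) by (simp add: x F_word_def)
  then have "completion Q ?x = w"
    using st unp Fx m(5) by (simp add: completion_def completion_string_def F_word_winv)
  then show "completion Q ?x = w" .
  \<comment> \<open>The left reading ends in the inverse of the unpunctured letter
    \<open>w ! 0\<close>, the right one in a punctured letter.\<close>
  have "winv (take k ?x) \<noteq> drop (Suc k) ?x"
    if "0 < k" "Suc k < length ?x" "is_special (F_letter Q (?x ! k))" for k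
  proof
    assume *: "winv (take k ?x) = drop (Suc k) ?x"
    have "winv (take k ?x) \<noteq> []" using that by auto
    then have "last (winv (take k ?x)) = linv (w ! 0)"
      using that x0 by (simp add: last_conv_nth nth_winv)
    moreover have "last (drop (Suc k) ?x) = Triv b (-1)"
      using that lastx by simp
    ultimately have "linv (w ! 0) = Triv b (-1)" using * by simp
    then have "Triv b (-1) \<in> letters Q" using let_w[of 0] ne linv_in_letters[of "w ! 0" Q] by simp
    then show False using m(3) letters_not_punctured[of "Triv b (-1)" Q] by (auto simp: punctured_def)
  qed
  note neq = this
  have first: "puncture (linv (?X 0)) = linv (?x ! 0)"
    unfolding x0 X0 using i by simp
  have last: "puncture (?X (int (length ?x - 1))) = ?x ! (length ?x - 1)"
    unfolding lx xm Xm by simp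
  show "admissible_string Q ?x"
    unfolding admissible_string_def
  proof (intro conjI ballI impI)
    fix k assume "k \<in> {0<..<length ?x - 1}" and sp: "is_special (F_letter Q (?x ! k))"
    then have k: "0 < k" "Suc k < length ?x" by auto
    show ne: "winv (take k ?x) \<noteq> drop (Suc k) ?x" by (rule neq[OF k sp])
    show "is_direct (?x ! k) \<longleftrightarrow> word_less (hat Q) (drop (Suc k) ?x) (winv (take k ?x))"
      by (rule A_seq_string_rule[OF Q cw st _ first last k sp _ ne]) (use nth nc k len in simp_all)
  qed (use st unp in blast)+
qed

text \<open>The two reflections fixing the ends of \<open>x\<close> show that the comparison at the middle position
  \<open>k\<close> is decided at distance \<open>2 * k\<close> at the latest, where it compares \<open>X k\<close> with its inverse. So
  \<open>X k\<close> would have to be chosen opposite to the rule.\<close>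

lemma middle_not_symmetric:
  assumes refl: "reflects X 0" "reflects X (4 * k)" and k: "0 < k"
    and sym: "\<And>s. 0 < s \<Longrightarrow> s \<le> k \<Longrightarrow> X (k + s) = linv (X (k - s))"
    and less: "mirror_less R X k n" and ne: "linv (X k) \<noteq> X k" and R: "\<not> R (X k) (linv (X k))" and irrefl: "\<And>y. \<not> R y y"
  shows False
proof -
  have r0: "X (- s) = linv (X s)" for s using refl(1) unfolding reflects_def by (metis diff_0)
  have r4: "X (4 * k - s) = linv (X s)" for s using refl(2) by (simp add: reflects_def)
  \<comment> \<open>For \<open>s = k + i\<close> one passes from \<open>k + s\<close> to
    \<open>2 * k - i\<close> by the mirror with sum \<open>4 * k\<close>, on to \<open>i\<close> by
    the symmetry about \<open>k\<close>, and to \<open>- i\<close>, which is \<open>k - s\<close>,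
    by the mirror with sum 0.\<close>
  have sym': "X (k + s) = linv (X (k - s))" if "0 < s" "s < 2 * k" for s
  proof (cases "s \<le> k")
    case False
    define i where "i = s - k"
    have i: "0 < i" "i < k" "s = k + i" using False that by (auto simp: i_def)
    have "X (k + s) = linv (X (2 * k - i))" using r4[of "2 * k - i"] i by (simp add: algebra_simps)
    also have "X (2 * k - i) = linv (X i)" using sym[of "k - i"] i by (simp add: algebra_simps)
    also have "linv (X i) = X (k - s)" using r0[of i] i by (simp add: algebra_simps)
    finally show ?thesis .
  qed (use that sym in simp)
  have far: "X (k - 2 * k) = linv (X k)" "X (k + 2 * k) = linv (X k)"
    using r0[of k] r4[of k] by (simp_all add: algebra_simps)
  have n: "1 \<le> n" "R (linv (X (k - n))) (X (k + n))" using less by (auto simp: mirror_less_def)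
  consider "n < 2 * k" | "n = 2 * k" | "2 * k < n" by linarith
  then show False
  proof cases
    case 1
    then have "X (k + n) = linv (X (k - n))" using sym' n by simp
    then show False using n irrefl by simp
  next
    case 2
    then show False using n far R by simp
  next
    case 3
    then have "2 * k \<in> {1..<n}" using k by simp
    then have "X (k + 2 * k) = linv (X (k - 2 * k))" using less unfolding mirror_less_def by blast
    then show False using far ne by simp
  qed
qed


section \<open>Lifts of bands\<close>

lemma bandsI:
  assumes "w \<noteq> []" "\<And>i. i < length w \<Longrightarrow> w ! i \<in> letters P"
    and "\<And>i. lsrc P (cyc w i) \<noteq> None \<and> ltgt P (cyc w (i + 1)) = map_option neg (lsrc P (cyc w i))"
  shows "w \<in> bands P"
proof -
  have nth: "(w @ w) ! i = cyc w (int i)" if "i < length (w @ w)" for i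
  proof (cases "i < length w")
    case True
    then show ?thesis by (simp add: nth_append cyc_nth)
  next
    case False
    then have "cyc w (int i) = cyc w (int (i - length w))"
      using cyc_period[of w "int (i - length w)"] by simp
    also have "\<dots> = w ! (i - length w)"
      using False that cyc_nth[of "int (i - length w)" w] by (simp only: nat_int) simp
    finally show ?thesis using False by (simp add: nth_append)
  qed
  have "is_word P (w @ w)"
    unfolding is_word_nth
  proof (intro conjI allI impI)
    fix i assume i: "Suc i < length (w @ w)"
    then show "lsrc P ((w @ w) ! i) \<noteq> None"
      "ltgt P ((w @ w) ! Suc i) = map_option neg (lsrc P ((w @ w) ! i))"
      using nth[of i] nth[of "Suc i"] assms(3)[of "int i"] by (simp_all add: add.commute)
  qed (use assms(2) in \<open>auto simp: nth_append\<close>)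
  then show ?thesis using assms(1) by (simp add: bands_def is_word_append)
qed

lemma mirror_less_mono:
  "mirror_less R w k n \<Longrightarrow> (\<And>x y. R x y \<Longrightarrow> R' x y) \<Longrightarrow> mirror_less R' w k n"
  by (simp add: mirror_less_def)

lemma letter_less_hat_less: "letter_less (hat Q) x y \<Longrightarrow> hat_less Q x y"
  unfolding hat_less_def by (metis letter_less_def puncture_hat)

lemma F_word_replicate: "F_word Q (concat (replicate n u)) = concat (replicate n (F_word Q u))"
  by (simp add: F_word_def map_concat)

lemma F_word_cut: "F_word Q (cut k x) = cut k (F_word Q x)"
  by (simp add: F_word_def cut_def take_map drop_map)

lemma A_band_asymmetric:
  assumes Q: "skewed_gentle Q" and w: "w \<in> pbands Q" and asym: "\<not> symmetric_band w"
  shows "A_band Q w \<in> pbands (hat Q)" "admissible_band Q (A_band Q w)"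
    "F_word Q (A_band Q w) = w"
proof -
  let ?W = "cyc w" and ?X = "A_seq Q (cyc w)" and ?x = "A_band Q w"
  have wb: "w \<in> bands Q" and ne: "w \<noteq> []" using w by (auto simp: pbands_def bands_def)
  have cw: "cyclic_word Q ?W" using cyclic_word_cyc wb by blast
  have nc: "\<not> reflects ?W a" for a using asym symmetric_band_iff[OF ne] by blast
  have len: "length ?x = length w" using asym by (simp add: A_band_def)
  have nth: "?x ! i = ?X (int i)" if "i < length w" for i
    using that asym A_band_letter_eq[OF Q wb that] nc by (simp add: A_band_def)
  have let_W: "?W i \<in> letters Q" for i using cw by (simp add: cyclic_word_def)
  have ck: "?W (int i) = w ! i" if "i < length w" for i using that by (simp add: cyc_nth)
  have cx: "cyc ?x = ?X"
  proof
    fix i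
    have j: "nat (i mod int (length w)) < length w" using ne by (simp add: nat_less_iff)
    have "cyc ?x i = ?X (i mod int (length w))"
      using nth[OF j] ne by (simp add: cyc_def len)
    also have "\<dots> = ?X (i mod int (length w) + int (length w) * (i div int (length w)))"
      by (rule A_seq_period[symmetric]) (rule cyc_period_dvd[OF dvd_triv_left])
    finally show "cyc ?x i = ?X i" by simp
  qed
  have nex: "?x \<noteq> []" using len ne by auto
  have xb: "?x \<in> bands (hat Q)"
  proof (rule bandsI[OF nex])
    fix i assume "i < length ?x"
    then show "?x ! i \<in> letters (hat Q)"
      using nth len A_seq_letters_hat[OF Q cw] nc by simp
  next
    fix i
    have "lsrc Q (?W i) \<noteq> None"
      using cyc_ex[OF ne, of i] bands_nth(1)[OF wb] by auto
    moreover have "ltgt Q (?W (i + 1)) = map_option neg (lsrc Q (?W i))"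
      using cw by (simp add: cyclic_word_def)
    ultimately show "lsrc (hat Q) (cyc ?x i) \<noteq> None \<and>
        ltgt (hat Q) (cyc ?x (i + 1)) = map_option neg (lsrc (hat Q) (cyc ?x i))"
      unfolding cx lsrc_hat ltgt_hat using A_seq_ends(1,2)[OF Q, of ?W] let_W by simp
  qed
  show Fx: "F_word Q ?x = w"
  proof (rule nth_equalityI)
    fix i assume "i < length (F_word Q ?x)"
    then have "i < length w" by (simp add: F_word_def len)
    then show "F_word Q ?x ! i = w ! i"
      using nth A_seq_ends(3)[OF Q, of ?W "int i", OF let_W] ck by (simp add: F_word_def len)
  qed (simp add: F_word_def len)
  \<comment> \<open>\<open>F_word\<close> carries a decomposition of the lift as a proper power to
    one of \<open>w\<close>.\<close>
  show "?x \<in> pbands (hat Q)"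
    unfolding pbands_def
  proof (intro CollectI conjI notI)
    assume "\<exists>u n. 2 \<le> n \<and> ?x = concat (replicate n u)"
    then obtain u n where "2 \<le> n" "w = concat (replicate n (F_word Q u))"
      using Fx F_word_replicate by metis
    then show False using w unfolding pbands_def by blast
  qed (rule xb)
  show "admissible_band Q ?x"
    unfolding admissible_band_def Fx
  proof (intro conjI ballI impI)
    fix k assume "k \<in> {0..<length ?x}" and "is_special (F_letter Q (?x ! k))"
    then have k: "k < length w" "k < length ?x" and sp: "is_special (?W (int k))"
      using nth A_seq_ends(3)[OF Q, of ?W "int k"] let_W by (auto simp: len)
    show neq: "winv (cut k ?x) \<noteq> cut k ?x"
    proof
      assume "winv (cut k ?x) = cut k ?x"
      then have "winv (cut k w) = cut k w" by (metis F_word_cut F_word_winv Fx)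
      then show False using cut_symmetric[OF k(1)] linv_special[OF sp] ck[OF k(1)] nc by auto
    qed
    have "lsrc (hat Q) (?x ! k) = ltgt (hat Q) (?x ! k)"
      using A_seq_ends(1,2)[OF Q, of ?W "int k"] let_W ltgt_special[OF sp, of Q] nth[OF k(1)] by simp
    then have total: "word_less (hat Q) (winv (cut k ?x)) (cut k ?x) \<or>
        word_less (hat Q) (cut k ?x) (winv (cut k ?x))"
      using band_total[OF skewed_gentle_hat[OF Q] xb k(2)] neq by blast
    have up: "\<exists>n. mirror_less (hat_less Q) ?X (int k) n"
      if less: "word_less (hat Q) (winv (cut k ?x)) (cut k ?x)"
    proof -
      obtain n where "mirror_less (letter_less (hat Q)) ?X (int k) n"
        using less lex_less_cut[OF k(2), of "letter_less (hat Q)"] unfolding word_less_lex(1) cx by blast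
      then have "mirror_less (hat_less Q) ?X (int k) n"
        by (rule mirror_less_mono) (rule letter_less_hat_less)
      then show ?thesis ..
    qed
    have down: "\<exists>n. mirror_less (hat_less Q)\<inverse>\<inverse> ?X (int k) n"
      if less: "word_less (hat Q) (cut k ?x) (winv (cut k ?x))"
    proof -
      obtain n where "mirror_less (letter_less (hat Q))\<inverse>\<inverse> ?X (int k) n"
        using less lex_less_cut[OF k(2), of "(letter_less (hat Q))\<inverse>\<inverse>"]
        unfolding word_less_lex(2) cx by blast
      then have "mirror_less (hat_less Q)\<inverse>\<inverse> ?X (int k) n"
        by (rule mirror_less_mono) (simp add: letter_less_hat_less)
      then show ?thesis ..
    qed
    have excl: "\<not> (mirror_less (hat_less Q) ?X (int k) n \<and>
        mirror_less (hat_less Q)\<inverse>\<inverse> ?X (int k) m)" for n m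
      using mirror_less_asym[of "hat_less Q"] hat_less_asym by blast
    show "is_direct (?x ! k) \<longleftrightarrow> word_less (hat Q) (cut k ?x) (winv (cut k ?x))"
      using A_seq_mirror[OF Q cw sp nc]
    proof (elim disjE conjE exE)
      fix n assume X: "?X (int k) = lo Q (?W (int k))" "mirror_less (hat_less Q)\<inverse>\<inverse> ?X (int k) n"
      then have "word_less (hat Q) (cut k ?x) (winv (cut k ?x))" using total up excl by blast
      then show ?thesis using X(1) nth[OF k(1)] by simp
    next
      fix n assume X: "?X (int k) = hi Q (?W (int k))" "mirror_less (hat_less Q) ?X (int k) n"
      then have "\<not> word_less (hat Q) (cut k ?x) (winv (cut k ?x))" using down excl by blast
      then show ?thesis using X(1) nth[OF k(1)] by simp
    qed
  qed (use xb w asym in blast)+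
qed

lemma A_band_symmetric:
  assumes Q: "skewed_gentle Q" and w: "w \<in> pbands Q" and std: "standard_form w"
  shows "A_band Q w \<in> strings (hat Q)" "admissible_string Q (A_band Q w)"
    "completion Q (A_band Q w) = w"
proof -
  let ?W = "cyc w" and ?X = "A_seq Q (cyc w)" and ?x = "A_band Q w"
  have wb: "w \<in> bands Q" and ne: "w \<noteq> []" using w by (auto simp: pbands_def bands_def)
  obtain a b v where w_eq: "w = Star a # v @ Star b # winv v"
    using std by (auto simp: standard_form_def)
  define n where "n = length v + 1"
  have lenw: "length w = 2 * n" and n: "0 < n" by (simp_all add: w_eq n_def)
  have w0: "w ! 0 = Star a" and wn: "w ! n = Star b" by (simp_all add: w_eq n_def nth_append)
  have wv: "w ! Suc i = v ! i" if "i < length v" for i using that by (simp add: w_eq nth_append)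
  have cw: "cyclic_word Q ?W" using cyclic_word_cyc wb by blast
  have let_W: "?W i \<in> letters Q" for i using cw by (simp add: cyclic_word_def)
  have ck: "?W (int i) = w ! i" if "i < length w" for i using that by (simp add: cyc_nth)
  have W0: "?W 0 = Star a" using ck[of 0] ne w0 by simp
  have Wn: "?W (int n) = Star b" using ck[of n] lenw n wn by simp
  have ab: "a \<in> special_verts Q" "b \<in> special_verts Q"
    using let_W[of 0] let_W[of "int n"] W0 Wn by (auto simp: letters_def)
  have "winv w = winv (winv v) @ [Star b] @ winv v @ [Star a]" by (simp add: w_eq winv_def)
  \<comment> \<open>Inverting the standard form only moves the leading special letter to the end.
    Rotation by 1 means a mirror with sum 0.\<close>
  then have "winv w = rotate1 w" by (simp add: w_eq)
  moreover have "nat ((0 + 1) mod int (length w)) = 1" using lenw n by simp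
  ultimately have refl0: "reflects ?W 0" using reflects_cyc_iff[OF ne, of 0] by simp
  then have "reflects ?W (0 + int (length w))" by (rule reflects_shift) (rule cyc_period)
  then have refln: "reflects ?W (2 * int n)" by (simp add: lenw)
  \<comment> \<open>Together with the mirror at 0, a centre strictly between 0 and \<open>n\<close>
    would give a period shorter than \<open>w\<close>.\<close>
  have nc: "\<not> reflects ?W (2 * int k)" if "0 < k" "k < n" for k
  proof
    assume "reflects ?W (2 * int k)"
    then have "int (length w) dvd 2 * int k - 0"
      using reflects_twice_dvd[OF _ _ refl0] w by blast
    then have "int (length w) \<le> 2 * int k" using that by (intro zdvd_imp_le) auto
    then show False using lenw that by simp
  qed
  have sym: "symmetric_band w" using refl0 symmetric_band_iff[OF ne] by blast
  have x: "?x = TrivInv a (-1) # map (A_band_letter Q w) [1..<n] @ [Triv b (-1)]"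
    using sym lenw w0 wn by (simp add: A_band_def Let_def)
  have len: "length ?x = n + 1" using n by (simp add: x)
  have lx: "length ?x - 1 = n" by (simp add: len)
  have x0: "?x ! 0 = TrivInv a (-1)" by (simp add: x)
  have xn: "?x ! n = Triv b (-1)" using n by (simp add: x nth_append nth_Cons')
  have nth: "?x ! i = ?X (int i)" if "0 < i" "i < n" for i
  proof -
    have "i - 1 < n - 1" "Suc (i - 1) = i" using that by simp_all
    then have "?x ! i = A_band_letter Q w i" using that by (simp add: x nth_append nth_Cons')
    then show ?thesis using A_band_letter_eq[OF Q wb, of i] nc[OF that] that lenw by simp
  qed
  have X0: "?X 0 = Star a" using A_seq_center[of ?W 0] refl0 W0 by simp
  have Xn: "?X (int n) = Star b" using A_seq_center[OF refln] Wn by simp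
  show st: "?x \<in> strings (hat Q)"
  proof (rule strings_hatI[OF Q cw, where i = a and r = "-1" and j = b and t = "-1"])
    show "lsrc Q (?W (int i)) \<noteq> None" if "Suc i < length ?x" for i
      using bands_nth(1)[OF wb, of i] that ck[of i] len lenw by auto
    show "lsrc Q (?x ! 0) = lsrc Q (?W 0)" unfolding x0 W0 by simp
    show "ltgt Q (?x ! (length ?x - 1)) = ltgt Q (?W (int (length ?x - 1)))"
      unfolding lx xn Wn by simp
    show "?x ! (length ?x - 1) \<in> letters (hat Q)"
      unfolding lx xn using Triv_hat[OF ab(2) Q] by blast
    show "?x ! 0 \<in> letters (hat Q)"
      unfolding x0 using Triv_hat[OF ab(1) Q] by blast
  qed (use nth nc len n x0 xn lx in auto)
  have Fv: "F_word Q (map (A_band_letter Q w) [1..<n]) = v"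
  proof (rule nth_equalityI)
    fix i assume "i < length (F_word Q (map (A_band_letter Q w) [1..<n]))"
    then have i: "i < length v" by (simp add: F_word_def n_def del: upt_Suc)
    then have "A_band_letter Q w (Suc i) = ?X (int (Suc i))"
      using A_band_letter_eq[OF Q wb, of "Suc i"] nc[of "Suc i"] lenw by (simp add: n_def)
    then have "F_letter Q (A_band_letter Q w (Suc i)) = v ! i"
      using A_seq_ends(3)[OF Q, of ?W "int (Suc i)", OF let_W] ck[of "Suc i"] wv[OF i] i lenw
      by (simp add: n_def)
    then show "F_word Q (map (A_band_letter Q w) [1..<n]) ! i = v ! i"
      using i by (simp add: F_word_def n_def del: upt_Suc)
  qed (simp add: F_word_def n_def del: upt_Suc)
  have pun: "punctured Q (hd ?x)" "punctured Q (last ?x)" using ab by (auto simp: x punctured_def)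
  have "F_word Q ?x = Star a # v @ [Star b]"
    using ab Fv by (simp add: x F_word_def)
  moreover have "F_word Q (winv (butlast (tl ?x))) = winv v"
    unfolding F_word_winv using Fv by (simp add: x)
  ultimately have "completion_string Q ?x = w"
    using pun by (simp add: completion_string_def w_eq)
  then show compl: "completion Q ?x = w" using st by (simp add: completion_def)
  have first: "puncture (linv (?X 0)) = linv (?x ! 0)" unfolding X0 x0 by simp
  have last: "puncture (?X (int (length ?x - 1))) = ?x ! (length ?x - 1)" unfolding lx xn Xn by simp
  have sp: "is_special (?W (int k))" if "0 < k" "k < n" "is_special (F_letter Q (?x ! k))" for k
    using that nth A_seq_ends(3)[OF Q, of ?W "int k", OF let_W] by simp
  \<comment> \<open>Equal lengths leave only the middle, \<open>n = 2 * k\<close>. There the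
    unfolded lift would be symmetric about \<open>k\<close> up to distance \<open>k\<close>, the
    ends included since \<open>a = b\<close>, and \<open>middle_not_symmetric\<close> refutes this
    for either choice of the loop.\<close>
  have neq: "winv (take k ?x) \<noteq> drop (Suc k) ?x"
    if k: "0 < k" "k < n" "is_special (F_letter Q (?x ! k))" for k
  proof
    assume *: "winv (take k ?x) = drop (Suc k) ?x"
    have nk: "n = 2 * k" using arg_cong[OF *, of length] k by (simp add: len)
    have xs: "?x ! (k + s) = linv (?x ! (k - s))" if "0 < s" "s \<le> k" for s
    proof -
      have "winv (take k ?x) ! (s - 1) = drop (Suc k) ?x ! (s - 1)" using * by simp
      then show ?thesis using that nk k by (simp add: nth_winv len)
    qed
    have "a = b" using xs[of k] k x0 xn nk by (simp add: mult_2)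
    have X_sym: "?X (int k + s) = linv (?X (int k - s))" if "0 < s" "s \<le> int k" for s
    proof (cases "s = int k")
      case True
      then have "int k + s = int n" "int k - s = 0" using nk by simp_all
      then show ?thesis using X0 Xn \<open>a = b\<close> by simp
    next
      case False
      define i where "i = nat s"
      have i: "0 < i" "i < k" "s = int i" using that False by (auto simp: i_def)
      have "int k + s = int (k + i)" "int k - s = int (k - i)" using i by auto
      then show ?thesis using xs[of i] nth[of "k + i"] nth[of "k - i"] i nk by simp
    qed
    have XR: "reflects ?X 0" "reflects ?X (4 * int k)"
      using A_seq_reflects[OF refl0] A_seq_reflects[OF refln] nk by simp_all
    have lh: "hat_less Q (lo Q (?W (int k))) (hi Q (?W (int k)))"
      using hat_less_special[OF Q let_W sp[OF k]] by blast
    have k0: "0 < int k" using k by simp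
    have irr: "\<not> hat_less Q y y" for y using hat_less_asym by auto
    have lohi: "lo Q y \<noteq> hi Q y" for y by (simp add: lo_def hi_def)
    have hl: "\<not> hat_less Q (hi Q (?W (int k))) (lo Q (?W (int k)))"
      using lh hat_less_asym by blast
    have False if X: "?X (int k) = lo Q (?W (int k))"
      "mirror_less (hat_less Q)\<inverse>\<inverse> ?X (int k) m" for m
      by (rule middle_not_symmetric[OF XR k0 _ X(2)])
        (use X_sym hl irr in \<open>simp_all add: X(1) lohi[symmetric]\<close>)
    moreover have False if X: "?X (int k) = hi Q (?W (int k))"
      "mirror_less (hat_less Q) ?X (int k) m" for m
      by (rule middle_not_symmetric[OF XR k0 _ X(2)])
        (use X_sym hl irr in \<open>simp_all add: X(1) lohi\<close>)
    ultimately show False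
      using A_seq_mirror[OF Q cw sp[OF k] nc[OF k(1,2)]] by blast
  qed
  show "admissible_string Q ?x"
    unfolding admissible_string_def
  proof (intro conjI ballI impI)
    fix k assume "k \<in> {0<..<length ?x - 1}" and sp: "is_special (F_letter Q (?x ! k))"
    then have k: "0 < k" "Suc k < length ?x" "k < n" by (auto simp: len)
    show ne: "winv (take k ?x) \<noteq> drop (Suc k) ?x" by (rule neq[OF k(1,3) sp])
    show "is_direct (?x ! k) \<longleftrightarrow> word_less (hat Q) (drop (Suc k) ?x) (winv (take k ?x))"
      by (rule A_seq_string_rule[OF Q cw st _ first last k(1,2) sp _ ne]) (use nth nc k len in simp_all)
  qed (use st compl w in simp_all)
qed

section \<open>Admissibility of the inverse\<close>

lemma take_winv: "k \<le> length x \<Longrightarrow> take k (winv x) = winv (drop (length x - k) x)"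
  by (simp add: winv_def take_rev drop_map)

lemma drop_winv: "k \<le> length x \<Longrightarrow> drop k (winv x) = winv (take (length x - k) x)"
  by (simp add: winv_def drop_rev take_map)

lemma cut_winv: "k < length x \<Longrightarrow> cut k (winv x) = winv (cut (length x - Suc k) x)"
  by (simp add: cut_def take_winv drop_winv winv_append Suc_diff_Suc)

lemma word_less_asym: "word_less Q v w \<Longrightarrow> \<not> word_less Q w v"
proof
  assume "word_less Q v w" "word_less Q w v"
  then obtain n m where n: "\<forall>i<n. v ! i = w ! i" "letter_less Q (v ! n) (w ! n)"
    and m: "\<forall>i<m. w ! i = v ! i" "letter_less Q (w ! m) (v ! m)"
    unfolding word_less_iff by blast
  consider "n < m" | "m < n" | "n = m" by linarith
  then show False
    using n m letter_less_asym[of Q] letter_less_irrefl[of Q] by cases metis+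
qed

text \<open>Once punctured letters are excluded, only the special loop of the vertex and its inverse
  lie over a special letter.\<close>

lemma hat_special_letter:
  assumes Q: "skewed_gentle Q" and x: "x \<in> letters (hat Q)" "is_special (F_letter Q x)"
    and np: "\<not> punctured Q x"
  shows "x = lo Q (F_letter Q x) \<or> x = hi Q (F_letter Q x)" "F_letter Q x \<in> letters Q"
    "lsrc Q x = ltgt Q x"
proof -
  have "special_loop Q (fst (src Q e)) = e" "tgt Q e = src Q e" if "e \<in> special Q" for e
    using that special_loop_src[OF Q] special_src_tgt[OF Q that] by auto
  moreover have "fst (src Q e) \<in> special_verts Q" if "e \<in> special Q" for e
    using that by (simp add: special_verts_def)
  ultimately show "x = lo Q (F_letter Q x) \<or> x = hi Q (F_letter Q x)" "F_letter Q x \<in> letters Q"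
    "lsrc Q x = ltgt Q x"
    using x np
    by (cases x; auto simp: is_special_def lo_def hi_def letters_def punctured_def split: if_splits)+
qed

lemma hat_ordinary_letter:
  assumes "x \<in> letters (hat Q)" "\<not> is_special (F_letter Q x)"
  shows "F_letter Q x = x" "x \<in> letters Q"
  using assms by (auto simp: letters_def is_special_def arrows_def split: if_splits)

lemma string_interior:
  assumes "x \<in> strings (hat Q)" "0 < k" "Suc k < length x"
  shows "\<not> punctured Q (x ! k)" "x ! k \<in> letters (hat Q)"
proof -
  have "lsrc Q (x ! k) \<noteq> None" "ltgt Q (x ! k) \<noteq> None"
    using strings_nth(4,5)[OF assms(1), of k] assms(2,3) by auto
  then show "\<not> punctured Q (x ! k)" by (auto simp: punctured_def)
  show "x ! k \<in> letters (hat Q)" using assms by (simp add: strings_def is_word_nth)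
qed

lemma band_interior:
  assumes "x \<in> bands (hat Q)" "k < length x"
  shows "\<not> punctured Q (x ! k)" "x ! k \<in> letters (hat Q)"
proof -
  have "lsrc Q (x ! k) \<noteq> None" "ltgt Q (x ! k) \<noteq> None"
    using bands_nth(1,2)[OF assms] by auto
  then show "\<not> punctured Q (x ! k)" by (auto simp: punctured_def)
  show "x ! k \<in> letters (hat Q)" using assms by (simp add: bands_def is_word_nth)
qed

lemma is_direct_linv:
  assumes "skewed_gentle Q" "x \<in> letters (hat Q)" "is_special (F_letter Q x)" "\<not> punctured Q x"
  shows "is_direct (linv x) \<longleftrightarrow> \<not> is_direct x"
  using hat_special_letter(1)[OF assms] by (metis is_direct_lo_hi linv_lo_hi)

section \<open>Rotations and inverses of bands\<close>

lemma bands_rotate: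
  assumes "w \<in> bands Q"
  shows "rotate k w \<in> bands Q"
proof -
  have ne: "w \<noteq> []" using assms by (simp add: bands_def)
  have cw: "cyclic_word Q (cyc w)" using cyclic_word_cyc assms by blast
  show ?thesis
  proof (rule bandsI)
    fix i assume "i < length (rotate k w)"
    then have "rotate k w ! i \<in> set (rotate k w)" by (rule nth_mem)
    then show "rotate k w ! i \<in> letters Q" using assms by (auto simp: bands_def is_word_def)
  next
    fix i
    have "lsrc Q (cyc w j) \<noteq> None" for j
      using cyc_ex[OF ne, of j] bands_nth(1)[OF assms] by auto
    moreover have "ltgt Q (cyc w (i + int k + 1)) = map_option neg (lsrc Q (cyc w (i + int k)))"
      using cw unfolding cyclic_word_def by blast
    ultimately show "lsrc Q (cyc (rotate k w) i) \<noteq> None \<and>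
        ltgt Q (cyc (rotate k w) (i + 1)) = map_option neg (lsrc Q (cyc (rotate k w) i))"
      unfolding cyc_rotate[OF ne] by (simp add: algebra_simps)
  qed (use ne in simp)
qed

lemma rotate1_replicate: "rotate1 (concat (replicate n u)) = concat (replicate n (rotate1 u))"
proof (cases u)
  case (Cons a t)
  have *: "concat (replicate n (a # t)) @ [a] = a # concat (replicate n (t @ [a]))" for n
    by (induction n) simp_all
  show ?thesis
  proof (cases n)
    case (Suc m)
    then show ?thesis using *[of m] Cons by simp
  qed simp
qed simp

lemma rotate_replicate: "rotate k (concat (replicate n u)) = concat (replicate n (rotate k u))"
  by (induction k) (simp_all add: rotate1_replicate)

text \<open>A rotation of a power is a power, so rotating back carries a decomposition to
  \<open>w\<close>.\<close>

lemma pbands_rotate: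
  assumes "w \<in> pbands Q"
  shows "rotate k w \<in> pbands Q"
proof -
  have w: "w \<in> bands Q" "w \<noteq> []" using assms by (auto simp: pbands_def bands_def)
  have restore: "rotate (length w - k mod length w) (rotate k w) = w"
  proof -
    have "rotate (length w - k mod length w) (rotate k w) =
        rotate (length w - k mod length w + k mod length w) w"
      by (metis rotate_conv_mod rotate_rotate)
    also have "length w - k mod length w + k mod length w = length w" using w by simp
    finally show ?thesis by simp
  qed
  show ?thesis
    unfolding pbands_def
  proof (intro CollectI conjI notI)
    assume "\<exists>u n. 2 \<le> n \<and> rotate k w = concat (replicate n u)"
    then obtain u n where "2 \<le> n" "w = concat (replicate n (rotate (length w - k mod length w) u))"
      using restore rotate_replicate by metis
    then show False using assms unfolding pbands_def by blast
  qed (rule bands_rotate[OF w(1)])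
qed

lemma bands_winv: "w \<in> bands Q \<Longrightarrow> winv w \<in> bands Q"
  using is_word_winv[of Q w] is_word_winv[of Q "w @ w"] by (auto simp: bands_def winv_append)

lemma winv_replicate: "winv (concat (replicate n u)) = concat (replicate n (winv u))"
  by (simp add: winv_def map_concat rev_concat)

lemma pbands_winv:
  assumes "w \<in> pbands Q"
  shows "winv w \<in> pbands Q"
  unfolding pbands_def
proof (intro CollectI conjI notI)
  assume "\<exists>u n. 2 \<le> n \<and> winv w = concat (replicate n u)"
  then obtain u n where "2 \<le> n" "w = concat (replicate n (winv u))"
    using winv_replicate winv_winv by metis
  then show False using assms unfolding pbands_def by blast
qed (use assms bands_winv in \<open>auto simp: pbands_def\<close>)

lemma symmetric_band_winv:
  assumes "w \<noteq> []" "symmetric_band (winv w)"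
  shows "symmetric_band w"
proof -
  obtain k where k: "w = rotate k (winv w)" using assms(2) by (auto simp: symmetric_band_def)
  have "cyc w (- 1 - int k - s) = linv (cyc w s)" for s
  proof -
    have "cyc w (- 1 - int k - s) = cyc (winv w) (- 1 - int k - s + int k)"
      using assms(1) k cyc_rotate[of "winv w"] by (metis winv_Nil(1))
    also have "- 1 - int k - s + int k = - 1 - s" by simp
    finally show ?thesis using cyc_winv[OF assms(1)] by simp
  qed
  then show ?thesis using symmetric_band_iff[OF assms(1)] unfolding reflects_def by blast
qed

text \<open>Inversion exchanges the two readings and also the two directions of the loop, so the
  rule is preserved.\<close>

lemma admissible_string_winv:
  assumes Q: "skewed_gentle Q" and adm: "admissible_string Q x"
  shows "admissible_string Q (winv x)"
proof -
  have x: "x \<in> strings (hat Q)" using adm by (simp add: admissible_string_def)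
  have wx: "winv x \<in> strings (hat Q)" by (rule strings_winv[OF x])
  have len: "2 \<le> length x" by (rule strings_nth(1)[OF x])
  have ends: "hd (winv x) = linv (last x)" "last (winv x) = linv (hd x)"
    using len by (cases "x = []"; simp add: winv_def hd_rev last_rev hd_map last_map)+
  have pun: "punctured Q (linv y) = punctured Q y" for y
    by (cases y) (auto simp: punctured_def)
  show ?thesis
    unfolding admissible_string_def
  proof (intro conjI ballI impI)
    fix k assume "k \<in> {0<..<length (winv x) - 1}" and sp: "is_special (F_letter Q (winv x ! k))"
    then have k: "0 < k" "Suc k < length x" by auto
    define j where "j = length x - Suc k"
    have j: "0 < j" "Suc j < length x" "length x - k = Suc j" using k by (auto simp: j_def)
    have cuts: "take k (winv x) = winv (drop (Suc j) x)" "drop (Suc k) (winv x) = winv (take j x)"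
      using take_winv[of k x] drop_winv[of "Suc k" x] k j by (simp_all add: j_def)
    have xk: "winv x ! k = linv (x ! j)" using k by (simp add: nth_winv j_def)
    then have spj: "is_special (F_letter Q (x ! j))" using sp by simp
    have rule_j: "winv (take j x) \<noteq> drop (Suc j) x"
      "is_direct (x ! j) \<longleftrightarrow> word_less (hat Q) (drop (Suc j) x) (winv (take j x))"
      using adm j(1,2) spj unfolding admissible_string_def by auto
    note int = string_interior[OF x j(1,2)]
    have "lsrc (hat Q) (x ! j) = ltgt (hat Q) (x ! j)"
      using hat_special_letter(3)[OF Q int(2) spj int(1)] by simp
    then have total: "word_less (hat Q) (winv (take j x)) (drop (Suc j) x) \<or>
        word_less (hat Q) (drop (Suc j) x) (winv (take j x))"
      using string_total[OF skewed_gentle_hat[OF Q] x j(1,2)] rule_j(1) by blast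
    show "winv (take k (winv x)) \<noteq> drop (Suc k) (winv x)" using rule_j(1) cuts by auto
    show "is_direct (winv x ! k) \<longleftrightarrow>
        word_less (hat Q) (drop (Suc k) (winv x)) (winv (take k (winv x)))"
      unfolding cuts xk is_direct_linv[OF Q int(2) spj int(1)] winv_winv
      using rule_j(2) total word_less_asym by blast
  next
    assume p: "punctured Q (hd (winv x)) \<and> punctured Q (last (winv x))"
    then have p': "punctured Q (hd x)" "punctured Q (last x)" by (simp_all add: ends pun)
    then have compl: "completion Q x \<in> pbands Q" using adm by (simp add: admissible_string_def)
    obtain y v z where xyz: "x = y # v @ [z]"
    proof -
      obtain y t where yt: "x = y # t" using len by (cases x) auto
      then have "t \<noteq> []" using len by auto
      then obtain v z where "t = v @ [z]" by (cases t rule: rev_cases) auto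
      then show thesis using that yt by simp
    qed
    have F: "F_letter Q (linv y) = F_letter Q y" "F_letter Q (linv z) = F_letter Q z"
      using p' by (auto simp: xyz punctured_def)
    \<comment> \<open>The completion of \<open>x\<close> is \<open>?u @ ?t\<close>. Inverting
      \<open>x\<close> swaps these two halves, which is a rotation and keeps the band
      primitive.\<close>
    let ?u = "F_letter Q y # F_word Q v" and ?t = "F_letter Q z # winv (F_word Q v)"
    have wxyz: "winv x = linv z # winv v @ [linv y]" by (simp add: xyz winv_def)
    have "completion Q x = ?u @ ?t"
      using x p' by (simp add: completion_def completion_string_def xyz F_word_def winv_def rev_map)
    moreover have "completion Q (winv x) = ?t @ ?u"
      using wx p F by (simp add: completion_def completion_string_def wxyz F_word_winv)
        (simp add: F_word_def winv_def rev_map)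
    ultimately have "completion Q (winv x) = rotate (length ?u) (completion Q x)"
      by (simp only: rotate_append)
    then show "completion Q (winv x) \<in> pbands Q" using pbands_rotate[OF compl] by (simp only:)
  qed (rule wx)
qed

lemma admissible_band_winv:
  assumes Q: "skewed_gentle Q" and adm: "admissible_band Q x"
  shows "admissible_band Q (winv x)"
proof -
  have x: "x \<in> bands (hat Q)" "F_word Q x \<in> pbands Q" "\<not> symmetric_band (F_word Q x)"
    using adm by (auto simp: admissible_band_def)
  have "F_word Q x \<noteq> []" using x(1) by (simp add: bands_def F_word_def)
  then have asym: "\<not> symmetric_band (F_word Q (winv x))"
    using symmetric_band_winv x(3) F_word_winv by metis
  show ?thesis
    unfolding admissible_band_def
  proof (intro conjI ballI impI)
    fix k assume "k \<in> {0..<length (winv x)}" and sp: "is_special (F_letter Q (winv x ! k))"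
    then have k: "k < length x" by auto
    define j where "j = length x - Suc k"
    have j: "j < length x" using k by (auto simp: j_def)
    have c: "cut k (winv x) = winv (cut j x)" using cut_winv[OF k] by (simp add: j_def)
    have xk: "winv x ! k = linv (x ! j)" using k by (simp add: nth_winv j_def)
    then have spj: "is_special (F_letter Q (x ! j))" using sp by simp
    have rule_j: "winv (cut j x) \<noteq> cut j x"
      "is_direct (x ! j) \<longleftrightarrow> word_less (hat Q) (cut j x) (winv (cut j x))"
      using adm j spj unfolding admissible_band_def by auto
    note int = band_interior[OF x(1) j]
    have "lsrc (hat Q) (x ! j) = ltgt (hat Q) (x ! j)"
      using hat_special_letter(3)[OF Q int(2) spj int(1)] by simp
    then have total: "word_less (hat Q) (winv (cut j x)) (cut j x) \<or>
        word_less (hat Q) (cut j x) (winv (cut j x))"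
      using band_total[OF skewed_gentle_hat[OF Q] x(1) j] rule_j(1) by blast
    show "winv (cut k (winv x)) \<noteq> cut k (winv x)" using rule_j(1) c by simp
    show "is_direct (winv x ! k) \<longleftrightarrow> word_less (hat Q) (cut k (winv x)) (winv (cut k (winv x)))"
      unfolding c xk is_direct_linv[OF Q int(2) spj int(1)] winv_winv
      using rule_j(2) total word_less_asym by blast
  next
    show "F_word Q (winv x) \<in> pbands Q" unfolding F_word_winv by (rule pbands_winv[OF x(2)])
  qed (use bands_winv[OF x(1)] asym in blast)+
qed

section \<open>Recovering an admissible word from its completion\<close>

text \<open>Admissibility speaks only of positions inside \<open>x\<close>. This form of its rule is
  carried along by translations and mirrors, and so reaches all positions of the unfolded
  word.\<close>

definition follows_rule ::
  "('v, 'a) polarized_quiver \<Rightarrow> (int \<Rightarrow> ('v, 'a) letter) \<Rightarrow> (int \<Rightarrow> ('v, 'a) letter) \<Rightarrow> int \<Rightarrow> bool"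
  where "follows_rule Q w X k \<longleftrightarrow>
    (\<forall>n. (mirror_less (hat_less Q) X k n \<longrightarrow> X k = hi Q (w k)) \<and>
      (mirror_less (hat_less Q)\<inverse>\<inverse> X k n \<longrightarrow> X k = lo Q (w k)))"

lemma follows_rule_shift:
  assumes X: "\<And>i. X (i + d) = X i" and w: "\<And>i. w (i + d) = w i" and k: "follows_rule Q w X k"
  shows "follows_rule Q w X (k + d)"
proof -
  have X': "X (i + - d) = X i" for i using X[of "i - d"] by simp
  have "mirror_less R X k n" if "mirror_less R X (k + d) n" for R n
    using mirror_less_shift[OF X' that] by simp
  then show ?thesis using k unfolding follows_rule_def X w by blast
qed

lemma follows_rule_reflects:
  assumes X: "reflects X a" and w: "reflects w a" and sp: "is_special (w k)"
    and k: "follows_rule Q w X k"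
  shows "follows_rule Q w X (a - k)"
proof -
  have eq: "X (a - k) = linv (X k)" "w (a - k) = w k"
    using X w linv_special[OF sp] by (simp_all add: reflects_def)
  have "mirror_less R\<inverse>\<inverse> X k n" if "mirror_less R X (a - k) n" for R n
    using mirror_less_reflect[OF X that] by simp
  from this[of "hat_less Q"] this[of "(hat_less Q)\<inverse>\<inverse>"] show ?thesis
    using k unfolding follows_rule_def eq conversep_conversep by (metis linv_lo_hi)
qed

text \<open>\<open>lift_determined\<close>, used in both orientations, reproduces the choices of
  \<open>A_seq\<close>. The rule is asked for at all special letters that are not centres, since
  smaller distances lead to other positions; \<open>nc\<close> concerns only the \<open>k\<close> in
  question.\<close>

lemma lift_eq_A_seq:
  assumes Q: "skewed_gentle Q" and w: "cyclic_word Q w"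
    and ord: "\<And>k. \<not> is_special (w k) \<Longrightarrow> X k = w k"
    and sp: "\<And>k. is_special (w k) \<Longrightarrow> X k \<in> {lo Q (w k), w k, hi Q (w k)}"
    and X: "\<And>k. is_special (w k) \<Longrightarrow> \<not> reflects w (2 * k) \<Longrightarrow> follows_rule Q w X k"
    and nc: "is_special (w k) \<Longrightarrow> \<not> reflects w (2 * k)"
  shows "X k = A_seq Q w k"
proof (cases "is_special (w k)")
  case False
  then show ?thesis using ord by (simp add: A_seq_def)
next
  case k: True
  interpret up: lift_pair "letter_less Q" "hat_less Q" "lo Q" "hi Q" w X
    by (rule lift_pair_letters[OF Q w]) (use ord sp in auto)
  interpret down: lift_pair "(letter_less Q)\<inverse>\<inverse>" "(hat_less Q)\<inverse>\<inverse>" "hi Q" "lo Q" w X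
    by (rule up.lift_pair_converse)
  have hi: "X k = hi Q (w k)" if "mirror_less (letter_less Q) w k n" for n
    by (rule up.lift_determined[OF _ k that]) (use X in \<open>auto simp: follows_rule_def\<close>)
  have lo: "X k = lo Q (w k)" if "mirror_less (letter_less Q)\<inverse>\<inverse> w k n" for n
    by (rule down.lift_determined[OF _ k that]) (use X in \<open>auto simp: follows_rule_def\<close>)
  show ?thesis
    using up.mirror_trichotomy[OF k] nc[OF k] hi lo A_seq_hi[of w k Q, OF k] A_seq_lo[of w k Q, OF k] by metis
qed

text \<open>Totality for \<open>x\<close> and exclusion for \<open>X\<close> force the finite
  comparison to go the way of the periodic one; admissibility then fixes the direction of the
  loop.\<close>

lemma admissible_string_rule:
  assumes Q: "skewed_gentle Q" and adm: "admissible_string Q x"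
    and int: "\<And>i. 0 < i \<Longrightarrow> Suc i < length x \<Longrightarrow> X (int i) = x ! i"
    and first: "puncture (linv (X 0)) = linv (x ! 0)"
    and last: "puncture (X (int (length x - 1))) = x ! (length x - 1)"
    and k: "0 < k" "Suc k < length x" and sp: "is_special (F_letter Q (x ! k))"
    and wk: "w (int k) = F_letter Q (x ! k)"
  shows "follows_rule Q w X (int k)"
proof -
  have x: "x \<in> strings (hat Q)" using adm by (simp add: admissible_string_def)
  have rule: "winv (take k x) \<noteq> drop (Suc k) x"
    "is_direct (x ! k) \<longleftrightarrow> word_less (hat Q) (drop (Suc k) x) (winv (take k x))"
    using adm k sp unfolding admissible_string_def by auto
  note interior = string_interior[OF x k]
  note loop = hat_special_letter[OF Q interior(2) sp interior(1)]
  have "lsrc (hat Q) (x ! k) = ltgt (hat Q) (x ! k)" using loop(3) by simp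
  then have total: "word_less (hat Q) (winv (take k x)) (drop (Suc k) x) \<or>
      word_less (hat Q) (drop (Suc k) x) (winv (take k x))"
    using string_total[OF skewed_gentle_hat[OF Q] x k] rule(1) by blast
  have "k < length x" using k by simp
  note mirror = hat_string_mirror[OF x int first last this]
  have excl: "\<not> (mirror_less (hat_less Q) X (int k) n \<and> mirror_less (hat_less Q)\<inverse>\<inverse> X (int k) m)" for n m
    using mirror_less_asym[of "hat_less Q"] hat_less_asym by blast
  have "x ! k = hi Q (F_letter Q (x ! k))" if less: "mirror_less (hat_less Q) X (int k) n" for n
  proof -
    have "\<not> word_less (hat Q) (drop (Suc k) x) (winv (take k x))" using mirror(2) less excl by blast
    then show ?thesis using rule(2) loop(1) is_direct_lo_hi(1) by metis
  qed
  moreover have "x ! k = lo Q (F_letter Q (x ! k))"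
    if less: "mirror_less (hat_less Q)\<inverse>\<inverse> X (int k) n" for n
  proof -
    have "word_less (hat Q) (drop (Suc k) x) (winv (take k x))" using mirror(1) total less excl by blast
    then show ?thesis using rule(2) loop(1) is_direct_lo_hi(2) by metis
  qed
  ultimately show ?thesis using int[OF k] by (simp add: follows_rule_def wk)
qed

lemma cyc_map: "x \<noteq> [] \<Longrightarrow> cyc (map f x) i = f (cyc x i)"
  by (simp add: cyc_def nat_less_iff)

lemma cyc_F_word: "x \<noteq> [] \<Longrightarrow> cyc (F_word Q x) i = F_letter Q (cyc x i)"
  by (simp add: F_word_def cyc_map)

lemma reflects_F_word: "x \<noteq> [] \<Longrightarrow> reflects (cyc x) a \<Longrightarrow> reflects (cyc (F_word Q x)) a"
  by (simp add: reflects_def cyc_F_word)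

text \<open>\<open>y\<close> is the unfolding of the string \<open>x\<close>, with the special letter at the fixed points.\<close>

lemma unfolding_eq_A_seq:
  assumes Q: "skewed_gentle Q" and adm: "admissible_string Q x"
    and w: "F_word Q y \<in> strings Q \<union> pbands Q"
    and lift: "\<And>z. z \<in> set y \<Longrightarrow> z \<in> letters (hat Q) \<and> \<not> punctured Q z \<or> is_special z"
    and int: "\<And>i. 0 < i \<Longrightarrow> Suc i < length x \<Longrightarrow> cyc y (int i) = x ! i"
    and first: "puncture (linv (cyc y 0)) = linv (x ! 0)"
    and last: "puncture (cyc y (int (length x - 1))) = x ! (length x - 1)"
    and fold: "\<And>j. j < length y \<Longrightarrow> is_special (F_letter Q (y ! j)) \<Longrightarrow>
      reflects (cyc (F_word Q y)) (2 * int j) \<or> 0 < j \<and> Suc j < length x \<or>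
      (\<exists>i. 0 < i \<and> Suc i < length x \<and> reflects (cyc y) (int i + int j))"
    and nc: "is_special (cyc (F_word Q y) k) \<Longrightarrow> \<not> reflects (cyc (F_word Q y)) (2 * k)"
  shows "cyc y k = A_seq Q (cyc (F_word Q y)) k"
proof (rule lift_eq_A_seq[OF Q])
  let ?W = "cyc (F_word Q y)"
  have "F_word Q y \<noteq> []" using w by (auto simp: strings_def pbands_def bands_def)
  then have ne: "y \<noteq> []" by (simp add: F_word_def)
  have lenF: "length (F_word Q y) = length y" by (simp add: F_word_def)
  have mem: "cyc y k \<in> set y" for k using cyc_ex[OF ne, of k] by auto
  show "cyclic_word Q ?W" using w by (intro cyclic_word_cyc) (auto simp: pbands_def)
  fix k
  show "cyc y k = ?W k" if "\<not> is_special (?W k)"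
  proof -
    have ns: "\<not> is_special (F_letter Q (cyc y k))" using that by (simp add: cyc_F_word[OF ne])
    then have "\<not> is_special (cyc y k)" by (auto simp: is_special_def)
    then have "cyc y k \<in> letters (hat Q)" using lift[OF mem[of k]] by blast
    then show ?thesis using hat_ordinary_letter(1)[OF _ ns] by (simp add: cyc_F_word[OF ne])
  qed
  show "cyc y k \<in> {lo Q (?W k), ?W k, hi Q (?W k)}" if "is_special (?W k)"
  proof (cases "is_special (cyc y k)")
    case True
    then show ?thesis by (auto simp: cyc_F_word[OF ne] is_special_def)
  next
    case False
    then have "cyc y k \<in> letters (hat Q)" "\<not> punctured Q (cyc y k)" using lift[OF mem[of k]] by auto
    then show ?thesis using hat_special_letter(1)[OF Q, of "cyc y k"] that
      unfolding cyc_F_word[OF ne] by blast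
  qed
  assume sp: "is_special (?W k)" and nck: "\<not> reflects ?W (2 * k)"
  obtain j where j: "j < length y" "cyc y k = y ! j" "k mod int (length y) = int j"
    using cyc_ex[OF ne] by blast
  \<comment> \<open>Translation by \<open>d\<close> brings \<open>k\<close> into the first period;
    the sum \<open>2 * k\<close> moves by \<open>2 * d\<close>.\<close>
  define d where "d = int (length y) * (k div int (length y))"
  have kd: "k = int j + d" using j(3) by (simp add: d_def flip: j(3))
  have per: "cyc y (i + d) = cyc y i" "?W (i + d) = ?W i" for i
    by (simp_all add: d_def cyc_period_dvd lenF)
  have per': "?W (i + 2 * d) = ?W i" for i using per(2)[of i] per(2)[of "i + d"] by (simp add: algebra_simps)
  have Wj: "?W (int j) = ?W k" using per(2) kd by simp
  have cj: "cyc y (int j) = y ! j" using j(1) by (simp add: cyc_nth)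
  have interior: "follows_rule Q ?W (cyc y) (int i)"
    if "0 < i" "Suc i < length x" "is_special (?W (int i))" for i
    by (rule admissible_string_rule[OF Q adm int first last that(1,2)])
      (use that int[of i] cyc_F_word[OF ne, of Q "int i"] in simp_all)
  have "\<not> reflects ?W (2 * int j)"
    using nck reflects_shift[of ?W "2 * int j" "2 * d", OF _ per'] kd by auto
  \<comment> \<open>A special letter that is no centre lies inside \<open>x\<close>, where
    admissibility gives the rule, or is the mirror image of one that does.\<close>
  then consider "0 < j" "Suc j < length x" |
    i where "0 < i" "Suc i < length x" "reflects (cyc y) (int i + int j)"
    using fold[OF j(1)] sp Wj cyc_F_word[OF ne, of Q "int j"] cj by auto
  then have "follows_rule Q ?W (cyc y) (int j)"
  proof cases
    case 1
    then show ?thesis using interior sp Wj by simp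
  next
    case 2
    have refl: "reflects ?W (int i + int j)" by (rule reflects_F_word[OF ne 2(3)])
    have "?W (int i + int j - int j) = linv (?W (int j))" using refl unfolding reflects_def by blast
    then have spi: "is_special (?W (int i))" using sp Wj by simp
    have "follows_rule Q ?W (cyc y) (int i + int j - int i)"
      by (rule follows_rule_reflects[OF 2(3) refl spi interior[OF 2(1,2) spi]])
    then show ?thesis by simp
  qed
  then show "follows_rule Q ?W (cyc y) k"
    unfolding kd by (intro follows_rule_shift per)
qed (use nc in auto)

section \<open>Admissible words according to their ends\<close>

lemma F_letter_unpunctured:
  assumes "skewed_gentle Q" "x \<in> letters (hat Q)" "\<not> punctured Q x"
  shows "F_letter Q x \<in> letters Q" "lsrc Q (F_letter Q x) = lsrc Q x" "ltgt Q (F_letter Q x) = ltgt Q x"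
proof -
  have "F_letter Q x \<in> letters Q \<and> lsrc Q (F_letter Q x) = lsrc Q x \<and> ltgt Q (F_letter Q x) = ltgt Q x"
  proof (cases "is_special (F_letter Q x)")
    case True
    note l = hat_special_letter[OF assms(1,2) True assms(3)]
    then show ?thesis using lo_hi_ends[OF assms(1) l(2) True] by metis
  next
    case False
    then show ?thesis using hat_ordinary_letter[OF assms(2) False] by simp
  qed
  then show "F_letter Q x \<in> letters Q" "lsrc Q (F_letter Q x) = lsrc Q x"
    "ltgt Q (F_letter Q x) = ltgt Q x" by auto
qed

lemma is_word_F:
  assumes Q: "skewed_gentle Q" and x: "is_word (hat Q) x" and np: "\<And>z. z \<in> set x \<Longrightarrow> \<not> punctured Q z"
  shows "is_word Q (F_word Q x)"
proof -
  have "x ! i \<in> letters (hat Q) \<and> \<not> punctured Q (x ! i)" if "i < length x" for i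
    using x np that by (simp add: is_word_nth)
  then show ?thesis
    using x F_letter_unpunctured[OF Q] by (simp add: is_word_nth F_word_def)
qed

lemma string_letter_cases:
  assumes x: "x \<in> strings (hat Q)" and np: "\<not> punctured Q (hd x)" "\<not> punctured Q (last x)"
    and z: "z \<in> set x"
  shows "z \<in> letters (hat Q) \<and> \<not> punctured Q z"
proof -
  obtain i where i: "i < length x" "z = x ! i" using z by (auto simp: in_set_conv_nth)
  have len: "2 \<le> length x" "x \<noteq> []" using strings_nth(1)[OF x] by auto
  have "i = 0 \<or> i = length x - 1 \<or> 0 < i \<and> Suc i < length x" using i by linarith
  then have "\<not> punctured Q z"
    using np string_interior(1)[OF x, of i] i len by (auto simp: hd_conv_nth last_conv_nth)
  moreover have "x ! i \<in> letters (hat Q)" using x i by (simp add: strings_def is_word_nth)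
  ultimately show ?thesis using i by simp
qed

lemma strings_end_not_special:
  assumes "w \<in> strings Q" "j < length w" "is_special (w ! j)"
  shows "0 < j" "Suc j < length w"
proof -
  have "lsrc Q (w ! j) \<noteq> None" "ltgt Q (w ! j) \<noteq> None" using assms(3) ltgt_special[of "w ! j" Q] by auto
  then show "0 < j" "Suc j < length w" using strings_nth(4,5)[OF assms(1,2)] assms(2) by auto
qed

lemma symmetric_string_not_center:
  assumes w: "w \<in> strings Q" and len: "length w = 2 * m + 1" and sym: "reflects (cyc w) (2 * int m)"
    and k: "k < length w" "k \<noteq> m"
  shows "\<not> reflects (cyc w) (2 * int k)"
proof
  assume "reflects (cyc w) (2 * int k)"
  then have "int (length w) dvd 2 * int k - 2 * int m"
    using reflects_twice_dvd[of w Q] sym w by blast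
  moreover have "\<bar>2 * int k - 2 * int m\<bar> < int (length w)" "2 * int k - 2 * int m \<noteq> 0"
    using k len by auto
  ultimately show False
    using dvd_imp_le_int[of "2 * int k - 2 * int m" "int (length w)"] by simp
qed

lemma admissible_unpunctured:
  assumes Q: "skewed_gentle Q" and adm: "admissible_string Q x"
    and np: "\<not> punctured Q (hd x)" "\<not> punctured Q (last x)"
  shows "F_word Q x \<in> strings Q" "A_string Q (F_word Q x) = x"
proof -
  let ?w = "F_word Q x" and ?W = "cyc (F_word Q x)"
  have x: "x \<in> strings (hat Q)" using adm by (simp add: admissible_string_def)
  note ends = strings_nth[OF x]
  have ne: "x \<noteq> []" using ends(1) by auto
  note let_x = string_letter_cases[OF x np]
  have len: "length ?w = length x" by (simp add: F_word_def)
  obtain i r j t where ij: "hd x = TrivInv i r" "last x = Triv j t"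
    using x by (auto simp: strings_def)
  have "F_letter Q (hd x) = hd x" "F_letter Q (last x) = last x"
    using np unfolding ij by (auto simp: punctured_def)
  moreover have "is_word Q ?w" using is_word_F[OF Q _ let_x[THEN conjunct2]] x by (simp add: strings_def)
  ultimately show w: "?w \<in> strings Q"
    using ij ne by (auto simp: strings_def F_word_def hd_map last_map)
  have cx: "cyc x (int i) = x ! i" if "i < length x" for i using that by (simp add: cyc_nth)
  have cw: "?W (int i) = ?w ! i" if "i < length x" for i using that by (simp add: cyc_nth len)
  have nth: "?w ! i = F_letter Q (x ! i)" if "i < length x" for i using that by (simp add: F_word_def)
  have c0: "cyc x 0 = x ! 0" using cx[of 0] ne by simp
  have first: "puncture (linv (cyc x 0)) = linv (x ! 0)" using ends(2) c0 by auto
  have last: "puncture (cyc x (int (length x - 1))) = x ! (length x - 1)"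
    using ends(3) cx[of "length x - 1"] ne by auto
  have eq: "cyc x k = A_seq Q ?W k" if nc: "is_special (?W k) \<Longrightarrow> \<not> reflects ?W (2 * k)" for k
  proof (rule unfolding_eq_A_seq[OF Q adm _ _ _ first last _ nc])
    show "?w \<in> strings Q \<union> pbands Q" using w by simp
    fix j assume "j < length x" "is_special (F_letter Q (x ! j))"
    then show "reflects ?W (2 * int j) \<or> 0 < j \<and> Suc j < length x \<or>
        (\<exists>i. 0 < i \<and> Suc i < length x \<and> reflects (cyc x) (int i + int j))"
      using strings_end_not_special[OF w, of j] by (simp add: nth len)
  qed (use let_x cx in auto)
  \<comment> \<open>If \<open>?w\<close> were symmetric, \<open>x\<close> would agree with
    \<open>A_seq\<close> everywhere off the middle and inherit the mirror from it, against the
    inequality demanded by condition (i) at the middle.\<close>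
  have asym: "\<not> symmetric_string ?w"
  proof
    assume sym: "symmetric_string ?w"
    obtain m b where m: "length ?w = 2 * m + 1" "?w ! m = Star b" "0 < m"
      by (rule symmetric_string_middle[OF Q w sym])
    have new: "?w \<noteq> []" using ne by (simp add: F_word_def)
    have "reflects ?W (-1)" using sym reflects_cyc_iff[OF new, of "-1"] by (simp add: symmetric_string_def)
    then have "reflects ?W (-1 + int (length ?w))" by (rule reflects_shift) (rule cyc_period)
    then have refl: "reflects ?W (2 * int m)" using m(1) by simp
    have "F_letter Q (x ! m) = Star b" using nth[of m] m len by simp
    then have "is_special (F_letter Q (x ! m))" unfolding is_special_def by blast
    then have ne': "winv (take m x) \<noteq> drop (Suc m) x"
      using adm m len unfolding admissible_string_def by auto
    have "\<exists>i<m. winv (take m x) ! i \<noteq> drop (Suc m) x ! i"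
    proof (rule ccontr)
      assume "\<not> ?thesis"
      then have "winv (take m x) = drop (Suc m) x"
        using m(1) len by (intro nth_equalityI) auto
      then show False using ne' by simp
    qed
    then obtain i where i: "i < m" "winv (take m x) ! i \<noteq> drop (Suc m) x ! i" by blast
    let ?p = "m - Suc i" and ?q = "m + Suc i"
    have pq: "?p < length x" "?q < length x" "?p \<noteq> m" "?q \<noteq> m" using i m len by auto
    have neq: "x ! ?q \<noteq> linv (x ! ?p)" using i m len by (auto simp: nth_winv)
    have off: "cyc x (int k) = A_seq Q ?W (int k)" if "k < length x" "k \<noteq> m" for k
      using eq symmetric_string_not_center[OF w m(1) refl, of k] that len by simp
    have "cyc x (int ?p) = A_seq Q ?W (int ?p)" "cyc x (int ?q) = A_seq Q ?W (int ?q)"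
      by (rule off; fact)+
    moreover have "A_seq Q ?W (2 * int m - int ?p) = linv (A_seq Q ?W (int ?p))"
      using A_seq_reflects[OF refl] unfolding reflects_def by blast
    moreover have "2 * int m - int ?p = int ?q" using i by simp
    ultimately show False using neq cx pq by metis
  qed
  show "A_string Q ?w = x"
  proof (rule nth_equalityI)
    fix i assume "i < length (A_string Q ?w)"
    then have i: "i < length x" using asym len by (simp add: A_string_def)
    have nc: "\<not> reflects ?W (2 * int i)" using asym symmetric_string_iff[OF w] by blast
    show "A_string Q ?w ! i = x ! i"
      using A_string_letter_eq[OF Q w, of i] nc eq[of "int i"] cx i asym len
      by (simp add: A_string_def)
  qed (use asym len in \<open>simp add: A_string_def\<close>)
qed

text \<open>The completion is the image under \<open>F_word\<close> of the unfolding
  \<open>y\<close>. Its only centre is the middle, so every letter of \<open>x\<close> before the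
  punctured one is determined.\<close>

lemma admissible_right_punctured:
  assumes Q: "skewed_gentle Q" and adm: "admissible_string Q x"
    and np: "\<not> punctured Q (hd x)" and pun: "punctured Q (last x)"
  shows "completion Q x \<in> strings Q" "A_string Q (completion Q x) = x"
proof -
  have x: "x \<in> strings (hat Q)" using adm by (simp add: admissible_string_def)
  note ends = strings_nth[OF x]
  have ne: "x \<noteq> []" using ends(1) by auto
  obtain b where b: "last x = Triv b (-1)" "b \<in> special_verts Q"
    using pun x by (auto simp: punctured_def strings_def)
  define u where "u = butlast x"
  have x_eq: "x = u @ [Triv b (-1)]" using ne b by (simp add: u_def flip: b(1))
  have une: "u \<noteq> []" using ends(1) x_eq by auto
  define m where "m = length u"
  have m: "0 < m" "length x = m + 1" using une x_eq by (simp_all add: m_def)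
  define y where "y = u @ Star b # winv u"
  let ?w = "F_word Q y" and ?W = "cyc (F_word Q y)"
  have leny: "length y = 2 * m + 1" by (simp add: y_def m_def)
  have hdx: "hd x = hd u" using une by (simp add: x_eq)
  have let_u: "z \<in> letters (hat Q) \<and> \<not> punctured Q z" if z: "z \<in> set u" for z
  proof -
    obtain i where i: "i < m" "z = u ! i" using z by (auto simp: in_set_conv_nth m_def)
    then have xi: "x ! i = z" by (simp add: x_eq nth_append m_def)
    have "x ! i \<in> letters (hat Q)" using x i m by (simp add: strings_def is_word_nth)
    then have "z \<in> letters (hat Q)" by (simp only: xi)
    moreover have "\<not> punctured Q z"
    proof (cases "i = 0")
      case True
      then show ?thesis using np i une hdx by (simp add: hd_conv_nth)
    next
      case False
      then show ?thesis using string_interior(1)[OF x, of i] xi i m by simp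
    qed
    ultimately show ?thesis by blast
  qed
  have wy: "?w = F_word Q u @ Star b # winv (F_word Q u)"
    by (simp add: y_def F_word_def winv_def rev_map)
  have compl: "completion Q x = ?w"
    using x np pun b by (simp add: completion_def completion_string_def x_eq wy F_word_winv)
      (simp add: F_word_def)
  have xw: "is_word (hat Q) (u @ [Triv b (-1)])" using x by (simp add: strings_def x_eq)
  have Fu: "is_word Q (F_word Q u)" "F_word Q u \<noteq> []"
    using is_word_F[OF Q, of u] xw let_u une by (auto simp: is_word_append F_word_def)
  obtain p where p: "lsrc Q (last u) = Some p" "neg p = (b, -1)"
    using xw une by (auto simp: is_word_append)
  have lastF: "lsrc Q (last (F_word Q u)) = Some p"
    using F_letter_unpunctured(2)[OF Q, of "last u"] let_u[of "last u"] une p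
    by (simp add: F_word_def last_map)
  have hdw: "hd (winv (F_word Q u)) = linv (last (F_word Q u))"
    using Fu(2) by (simp add: winv_def hd_rev last_map)
  have starb: "Star b \<in> letters Q" using b(2) by (simp add: letters_def)
  have pb: "p = neg (b, -1)" using p(2) by (metis neg_neg)
  have "is_word Q ?w"
    unfolding wy is_word_append is_word_Cons
    using Fu is_word_winv[OF Fu(1)] lastF hdw starb pb by simp
  moreover have "hd ?w = hd x" "last ?w = linv (hd x)"
  proof -
    obtain i r where i: "hd x = TrivInv i r" using x by (auto simp: strings_def)
    have "F_letter Q (hd x) = hd x" using np unfolding i by (auto simp: punctured_def)
    then have "hd (F_word Q u) = hd x" using une hdx by (simp add: F_word_def hd_map)
    then show "hd ?w = hd x" "last ?w = linv (hd x)"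
      using Fu(2) by (simp_all add: wy winv_def last_rev hd_map)
  qed
  moreover have "\<exists>i r. hd x = TrivInv i r" using x by (auto simp: strings_def)
  ultimately have w: "?w \<in> strings Q" by (auto simp: strings_def wy)
  then show "completion Q x \<in> strings Q" by (simp add: compl)
  have yne: "y \<noteq> []" by (simp add: y_def)
  have "winv y = winv (winv u) @ Star b # winv u" by (simp add: y_def winv_def)
  then have winvy: "winv y = y" by (simp add: y_def)
  then have "reflects (cyc y) (-1)" using reflects_cyc_iff[OF yne, of "-1"] by simp
  then have "reflects (cyc y) (-1 + int (length y))" by (rule reflects_shift) (rule cyc_period)
  then have refly: "reflects (cyc y) (2 * int m)" using leny by simp
  then have refl: "reflects ?W (2 * int m)" by (rule reflects_F_word[OF yne])
  have len: "length ?w = 2 * m + 1" by (simp add: F_word_def leny)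
  have cy: "cyc y (int i) = x ! i" if "i < m" for i
    using that leny by (simp add: cyc_nth y_def x_eq nth_append m_def)
  have cym: "cyc y (int m) = Star b" using leny by (simp add: cyc_nth y_def nth_append m_def)
  have c0: "cyc y 0 = x ! 0" using cy[of 0] m(1) by simp
  have first: "puncture (linv (cyc y 0)) = linv (x ! 0)" using ends(2) c0 by auto
  have last: "puncture (cyc y (int (length x - 1))) = x ! (length x - 1)"
    using cym m(2) by (simp add: x_eq nth_append m_def)
  note nc = symmetric_string_not_center[OF w len refl]
  have eq: "x ! k = A_seq Q ?W (int k)" if k: "k < m" for k
  proof -
    have "cyc y (int k) = A_seq Q ?W (int k)"
    proof (rule unfolding_eq_A_seq[OF Q adm _ _ _ first last])
      show "?w \<in> strings Q \<union> pbands Q" using w by simp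
      show "z \<in> letters (hat Q) \<and> \<not> punctured Q z \<or> is_special z" if "z \<in> set y" for z
      proof -
        have "punctured Q (linv z) = punctured Q z" for z :: "('a, 'b) letter"
          by (cases z) (auto simp: punctured_def)
        then show ?thesis using that let_u by (auto simp: y_def winv_def is_special_def)
      qed
      show "cyc y (int i) = x ! i" if "0 < i" "Suc i < length x" for i using that cy m by simp
      fix j assume j: "j < length y" "is_special (F_letter Q (y ! j))"
      then have "0 < j" "Suc j < length ?w"
        using strings_end_not_special[OF w, of j] len by (simp_all add: F_word_def)
      then show "reflects ?W (2 * int j) \<or> 0 < j \<and> Suc j < length x \<or>
          (\<exists>i. 0 < i \<and> Suc i < length x \<and> reflects (cyc y) (int i + int j))"
      proof (cases j m rule: linorder_cases)
        \<comment> \<open>Positions after the middle are mirror images of positions inside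
          \<open>x\<close>.\<close>
        case greater
        then have "0 < 2 * m - j" "Suc (2 * m - j) < length x" "int (2 * m - j) + int j = 2 * int m"
          using \<open>Suc j < length ?w\<close> len m by auto
        then show ?thesis using refly by metis
      qed (use m refl \<open>0 < j\<close> in auto)
    next
      show "\<not> reflects ?W (2 * int k)" using nc[of k] k len by simp
    qed
    then show ?thesis using cy[OF k] by simp
  qed
  have sym: "symmetric_string ?w"
    using symmetric_string_iff[OF w] refl by blast
  have "length (F_word Q u) = m" by (simp add: F_word_def m_def)
  then have "?w ! m = Star b" unfolding wy by (metis nth_append_length)
  then have "A_string Q ?w = map (A_string_letter Q ?w) [0..<m] @ [Triv b (-1)]"
    using sym len by (simp add: A_string_def Let_def)
  also have "map (A_string_letter Q ?w) [0..<m] = u"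
  proof (rule nth_equalityI)
    fix k assume "k < length (map (A_string_letter Q ?w) [0..<m])"
    then have k: "k < m" by simp
    then have "A_string_letter Q ?w k = A_seq Q ?W (int k)"
      using A_string_letter_eq[OF Q w, of k] nc[of k] len by simp
    then show "map (A_string_letter Q ?w) [0..<m] ! k = u ! k"
      using eq[OF k] k by (simp add: x_eq nth_append m_def)
  qed (simp add: m_def)
  finally show "A_string Q (completion Q x) = x" by (simp only: compl x_eq[symmetric])
qed

text \<open>Unfolding at both ends gives mirrors with sums 0 and \<open>2 * n\<close>. Condition
  (ii) makes the completion primitive, which excludes centres strictly between the two ends.\<close>

lemma admissible_punctured:
  assumes Q: "skewed_gentle Q" and adm: "admissible_string Q x"
    and pun: "punctured Q (hd x)" "punctured Q (last x)"
  shows "completion Q x \<in> pbands Q" "symmetric_band (completion Q x)" "standard_form (completion Q x)"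
    "A_band Q (completion Q x) = x"
proof -
  have x: "x \<in> strings (hat Q)" using adm by (simp add: admissible_string_def)
  note ends = strings_nth[OF x]
  have ne: "x \<noteq> []" using ends(1) by auto
  obtain a where a: "hd x = TrivInv a (-1)" "a \<in> special_verts Q"
    using pun x by (auto simp: punctured_def strings_def)
  obtain b where b: "last x = Triv b (-1)" "b \<in> special_verts Q"
    using pun x by (auto simp: punctured_def strings_def)
  define v where "v = butlast (tl x)"
  have x_eq: "x = TrivInv a (-1) # v @ [Triv b (-1)]"
  proof -
    have "x = hd x # tl x" "tl x \<noteq> []" using ends(1) by (cases x; auto)+
    moreover from \<open>tl x \<noteq> []\<close> have "tl x = butlast (tl x) @ [last x]"
      by (metis append_butlast_last_id last_tl)
    ultimately show ?thesis using a b by (metis v_def)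
  qed
  define n where "n = length v + 1"
  have lenx: "length x = n + 1" and n: "0 < n" by (simp_all add: n_def x_eq)
  define y where "y = Star a # v @ Star b # winv v"
  let ?w = "F_word Q y" and ?W = "cyc (F_word Q y)"
  have leny: "length y = 2 * n" by (simp add: y_def n_def)
  have yne: "y \<noteq> []" by (simp add: y_def)
  have wy: "?w = Star a # F_word Q v @ Star b # winv (F_word Q v)"
    by (simp add: y_def F_word_def winv_def rev_map)
  have compl: "completion Q x = ?w"
    using x pun a b by (simp add: completion_def completion_string_def wy F_word_winv)
      (simp add: F_word_def x_eq)
  show w: "completion Q x \<in> pbands Q" using adm pun by (simp add: admissible_string_def)
  show std: "standard_form (completion Q x)" unfolding compl wy standard_form_def by blast
  have wp: "?w \<in> pbands Q" using w compl by simp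
  then have wb: "?w \<in> bands Q" by (simp add: pbands_def)
  have len: "length ?w = 2 * n" by (simp add: F_word_def leny)
  have wne: "?w \<noteq> []" by (simp add: wy)
  have "winv y = rotate1 y"
    by (simp add: y_def winv_append) (simp add: winv_def rev_map comp_def)
  moreover have "nat ((0 + 1) mod int (length y)) = 1" using leny n by simp
  ultimately have refly: "reflects (cyc y) 0" using reflects_cyc_iff[OF yne, of 0] by simp
  then have "reflects (cyc y) (0 + int (length y))" by (rule reflects_shift) (rule cyc_period)
  then have reflyn: "reflects (cyc y) (2 * int n)" by (simp add: leny)
  have refl0: "reflects ?W 0" and refln: "reflects ?W (2 * int n)"
    by (rule reflects_F_word[OF yne], fact)+
  show sym: "symmetric_band (completion Q x)"
    unfolding compl symmetric_band_iff[OF wne] using refl0 by blast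
  have nc: "\<not> reflects ?W (2 * int k)" if "0 < k" "k < n" for k
  proof
    assume "reflects ?W (2 * int k)"
    then have "int (length ?w) dvd 2 * int k - 0"
      using reflects_twice_dvd[OF _ _ refl0] wp by blast
    then have "int (length ?w) \<le> 2 * int k" using that by (intro zdvd_imp_le) auto
    then show False using len that by simp
  qed
  have cy: "cyc y (int i) = x ! i" if i: "0 < i" "i < n" for i
  proof -
    obtain j where "i = Suc j" using i(1) by (cases i) auto
    moreover have "cyc y (int i) = y ! i" using i leny by (simp add: cyc_nth)
    ultimately show ?thesis using i by (simp add: y_def x_eq nth_append n_def)
  qed
  have "cyc y (int n) = y ! n" using leny n by (simp add: cyc_nth)
  then have cyn: "cyc y (int n) = Star b" by (simp add: y_def n_def)
  have c0: "cyc y 0 = Star a" using leny n by (simp add: cyc_nth y_def)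
  have xn: "x ! n = Triv b (-1)" by (simp add: x_eq n_def nth_append)
  have first: "puncture (linv (cyc y 0)) = linv (x ! 0)" by (simp add: c0 x_eq)
  have last: "puncture (cyc y (int (length x - 1))) = x ! (length x - 1)"
    using cyn xn by (simp add: lenx)
  have let_v: "z \<in> letters (hat Q) \<and> \<not> punctured Q z" if z: "z \<in> set v" for z
  proof -
    obtain i where i: "i < length v" "z = v ! i" using z by (auto simp: in_set_conv_nth)
    then have "x ! Suc i = z" by (simp add: x_eq nth_append)
    then show ?thesis using string_interior[OF x, of "Suc i"] i lenx by (simp add: n_def)
  qed
  have eq: "x ! k = A_seq Q ?W (int k)" if k: "0 < k" "k < n" for k
  proof -
    have "cyc y (int k) = A_seq Q ?W (int k)"
    proof (rule unfolding_eq_A_seq[OF Q adm _ _ _ first last])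
      show "?w \<in> strings Q \<union> pbands Q" using wp by simp
      show "z \<in> letters (hat Q) \<and> \<not> punctured Q z \<or> is_special z" if "z \<in> set y" for z
      proof -
        have "punctured Q (linv z) = punctured Q z" for z :: "('a, 'b) letter"
          by (cases z) (auto simp: punctured_def)
        then show ?thesis using that let_v by (auto simp: y_def winv_def is_special_def)
      qed
      show "cyc y (int i) = x ! i" if "0 < i" "Suc i < length x" for i using that cy lenx by simp
      fix j assume j: "j < length y"
      have "j = 0 \<or> j = n \<or> 0 < j \<and> j < n \<or> n < j" by linarith
      then show "reflects ?W (2 * int j) \<or> 0 < j \<and> Suc j < length x \<or>
          (\<exists>i. 0 < i \<and> Suc i < length x \<and> reflects (cyc y) (int i + int j))"
      proof (elim disjE)
        \<comment> \<open>The second half of \<open>y\<close> is the mirror image of the first about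
          \<open>n\<close>.\<close>
        assume "n < j"
        then have "0 < 2 * n - j" "Suc (2 * n - j) < length x" "int (2 * n - j) + int j = 2 * int n"
          using j leny lenx by auto
        then show ?thesis using reflyn by metis
      qed (use refl0 refln lenx in auto)
    next
      show "\<not> reflects ?W (2 * int k)" by (rule nc[OF k])
    qed
    then show ?thesis using cy[OF k] by simp
  qed
  have w0: "?w ! 0 = Star a" and wn: "?w ! n = Star b"
  proof -
    have "length (F_word Q v) = length v" by (simp add: F_word_def)
    then show "?w ! 0 = Star a" "?w ! n = Star b" unfolding wy by (simp_all add: nth_append n_def)
  qed
  then have "A_band Q ?w = TrivInv a (-1) # map (A_band_letter Q ?w) [1..<n] @ [Triv b (-1)]"
    using sym len compl by (simp add: A_band_def Let_def)
  also have "map (A_band_letter Q ?w) [1..<n] = v"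
  proof (rule nth_equalityI)
    fix k assume "k < length (map (A_band_letter Q ?w) [1..<n])"
    then have k: "Suc k < n" by simp
    then have "A_band_letter Q ?w (Suc k) = A_seq Q ?W (int (Suc k))"
      using A_band_letter_eq[OF Q wb, of "Suc k"] nc[of "Suc k"] len by simp
    also have "\<dots> = x ! Suc k" using eq[of "Suc k"] k by simp
    also have "\<dots> = v ! k" using k by (simp add: x_eq nth_append n_def)
    finally show "map (A_band_letter Q ?w) [1..<n] ! k = v ! k" using k by simp
  qed (simp add: n_def del: upt_Suc)
  finally show "A_band Q (completion Q x) = x" by (simp only: compl x_eq[symmetric])
qed

text \<open>A band is its own unfolding: every position is a translate of one inside
  \<open>x\<close>, and the asymmetry of \<open>F_word Q x\<close> excludes centres.\<close>

lemma admissible_band_eq: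
  assumes Q: "skewed_gentle Q" and adm: "admissible_band Q x"
  shows "A_band Q (F_word Q x) = x"
proof -
  let ?w = "F_word Q x" and ?W = "cyc (F_word Q x)"
  have x: "x \<in> bands (hat Q)" and w: "?w \<in> pbands Q" and asym: "\<not> symmetric_band ?w"
    using adm by (auto simp: admissible_band_def)
  have ne: "x \<noteq> []" "?w \<noteq> []" using x by (auto simp: bands_def F_word_def)
  have len: "length ?w = length x" by (simp add: F_word_def)
  have wb: "?w \<in> bands Q" using w by (simp add: pbands_def)
  have nc: "\<not> reflects ?W a" for a using asym symmetric_band_iff[OF ne(2)] by blast
  have cW: "?W k = F_letter Q (cyc x k)" for k by (rule cyc_F_word[OF ne(1)])
  have letter: "cyc x k \<in> letters (hat Q)" "\<not> punctured Q (cyc x k)" for k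
    using cyc_ex[OF ne(1), of k] band_interior[OF x] by auto
  have cx: "cyc x (int i) = x ! i" if "i < length x" for i using that by (simp add: cyc_nth)
  have rule: "follows_rule Q ?W (cyc x) (int j)" if j: "j < length x" and sp: "is_special (?W (int j))" for j
  proof -
    have spj: "is_special (F_letter Q (x ! j))" using sp cW cx[OF j] by simp
    have rule_j: "winv (cut j x) \<noteq> cut j x"
      "is_direct (x ! j) \<longleftrightarrow> word_less (hat Q) (cut j x) (winv (cut j x))"
      using adm j spj unfolding admissible_band_def by auto
    note int = band_interior[OF x j]
    note loop = hat_special_letter[OF Q int(2) spj int(1)]
    have "lsrc (hat Q) (x ! j) = ltgt (hat Q) (x ! j)" using loop(3) by simp
    then have total: "word_less (hat Q) (winv (cut j x)) (cut j x) \<or>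
        word_less (hat Q) (cut j x) (winv (cut j x))"
      using band_total[OF skewed_gentle_hat[OF Q] x j] rule_j(1) by blast
    have up: "\<exists>n. mirror_less (hat_less Q) (cyc x) (int j) n"
      if less: "word_less (hat Q) (winv (cut j x)) (cut j x)"
    proof -
      obtain n where "mirror_less (letter_less (hat Q)) (cyc x) (int j) n"
        using less lex_less_cut[OF j, of "letter_less (hat Q)"] unfolding word_less_lex(1) by blast
      then have "mirror_less (hat_less Q) (cyc x) (int j) n"
        by (rule mirror_less_mono) (rule letter_less_hat_less)
      then show ?thesis ..
    qed
    have down: "\<exists>n. mirror_less (hat_less Q)\<inverse>\<inverse> (cyc x) (int j) n"
      if less: "word_less (hat Q) (cut j x) (winv (cut j x))"
    proof -
      obtain n where "mirror_less (letter_less (hat Q))\<inverse>\<inverse> (cyc x) (int j) n"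
        using less lex_less_cut[OF j, of "(letter_less (hat Q))\<inverse>\<inverse>"] unfolding word_less_lex(2) by blast
      then have "mirror_less (hat_less Q)\<inverse>\<inverse> (cyc x) (int j) n"
        by (rule mirror_less_mono) (simp add: letter_less_hat_less)
      then show ?thesis ..
    qed
    have excl: "\<not> (mirror_less (hat_less Q) (cyc x) (int j) n \<and>
        mirror_less (hat_less Q)\<inverse>\<inverse> (cyc x) (int j) m)" for n m
      using mirror_less_asym[of "hat_less Q"] hat_less_asym by blast
    have "x ! j = hi Q (F_letter Q (x ! j))" if less: "mirror_less (hat_less Q) (cyc x) (int j) n" for n
    proof -
      have "\<not> word_less (hat Q) (cut j x) (winv (cut j x))" using down less excl by blast
      then show ?thesis using rule_j(2) loop(1) is_direct_lo_hi(1) by metis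
    qed
    moreover have "x ! j = lo Q (F_letter Q (x ! j))"
      if less: "mirror_less (hat_less Q)\<inverse>\<inverse> (cyc x) (int j) n" for n
    proof -
      have "word_less (hat Q) (cut j x) (winv (cut j x))" using up total less excl by blast
      then show ?thesis using rule_j(2) loop(1) is_direct_lo_hi(2) by metis
    qed
    ultimately show ?thesis using cx[OF j] by (simp add: follows_rule_def cW)
  qed
  have eq: "cyc x k = A_seq Q ?W k" for k
  proof (rule lift_eq_A_seq[OF Q cyclic_word_cyc])
    show "?w \<in> strings Q \<union> bands Q" using wb by simp
    fix k
    show "cyc x k = ?W k" if "\<not> is_special (?W k)"
      using hat_ordinary_letter(1)[OF letter(1)[of k]] that unfolding cW by simp
    show "cyc x k \<in> {lo Q (?W k), ?W k, hi Q (?W k)}" if "is_special (?W k)"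
      using hat_special_letter(1)[OF Q letter(1)[of k] _ letter(2)[of k]] that unfolding cW by blast
    assume sp: "is_special (?W k)"
    obtain j where j: "j < length x" "k mod int (length x) = int j"
      using cyc_ex[OF ne(1)] by blast
    define d where "d = int (length x) * (k div int (length x))"
    have kd: "k = int j + d" by (simp add: d_def flip: j(2))
    have per: "cyc x (i + d) = cyc x i" "?W (i + d) = ?W i" for i
      by (simp_all add: d_def cyc_period_dvd len)
    have "follows_rule Q ?W (cyc x) (int j)" using rule j(1) sp kd per by simp
    then show "follows_rule Q ?W (cyc x) k"
      unfolding kd by (intro follows_rule_shift per)
  qed (rule nc)
  show ?thesis
  proof (rule nth_equalityI)
    fix i assume "i < length (A_band Q ?w)"
    then have i: "i < length x" using asym len by (simp add: A_band_def)
    show "A_band Q ?w ! i = x ! i"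
      using A_band_letter_eq[OF Q wb, of i] nc eq[of "int i"] cx i asym len
      by (simp add: A_band_def)
  qed (use asym len in \<open>simp add: A_band_def\<close>)
qed

section \<open>Both directions of the equivalence\<close>

lemma A_word_admissible:
  assumes Q: "skewed_gentle Q" and w: "w \<in> strings Q \<union> pbands' Q"
  shows "A_word Q w \<in> strings (hat Q) \<union> pbands (hat Q) \<and> admissible Q (A_word Q w) \<and>
    completion Q (A_word Q w) = w"
proof (cases "w \<in> strings Q")
  case True
  then show ?thesis
    using A_string_asymmetric[OF Q True] A_string_symmetric[OF Q True]
    by (cases "symmetric_string w") (auto simp: A_word_def admissible_def)
next
  case False
  then have A: "A_word Q w = A_band Q w" by (simp add: A_word_def)
  have w': "w \<in> pbands Q" "symmetric_band w \<Longrightarrow> standard_form w"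
    using w False by (auto simp: pbands'_def)
  show ?thesis
  proof (cases "symmetric_band w")
    case True
    then show ?thesis using A_band_symmetric[OF Q w'(1) w'(2)] by (simp add: A admissible_def)
  next
    case asym: False
    note band = A_band_asymmetric[OF Q w'(1) asym]
    \<comment> \<open>\<open>completion\<close> tests for strings first, so the lifted band must be
      known not to be one.\<close>
    then have "A_band Q w \<notin> strings (hat Q)"
      using strings_not_bands by (auto simp: pbands_def)
    then show ?thesis using band by (simp add: A admissible_def completion_def)
  qed
qed

lemma admissible_winv:
  "skewed_gentle Q \<Longrightarrow> admissible Q x \<Longrightarrow> admissible Q (winv x)"
  using admissible_string_winv admissible_band_winv unfolding admissible_def by blast

text \<open>The witness is the completion of \<open>x\<close>, except for a string punctured only at
  its left end: \<open>A_string\<close> puts the punctured letter last, so such a string is inverted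
  first.\<close>

lemma admissible_is_A_word:
  assumes Q: "skewed_gentle Q" and adm: "admissible Q x"
  shows "\<exists>w \<in> strings Q \<union> pbands' Q. x = A_word Q w \<or> x = winv (A_word Q w)"
proof (cases "admissible_string Q x")
  case False
  then have band: "admissible_band Q x" using adm by (simp add: admissible_def)
  then have w: "F_word Q x \<in> pbands' Q" "F_word Q x \<in> bands Q"
    by (auto simp: admissible_band_def pbands'_def pbands_def)
  then have "F_word Q x \<notin> strings Q" using strings_not_bands by blast
  then have "A_word Q (F_word Q x) = x" using admissible_band_eq[OF Q band] by (simp add: A_word_def)
  then show ?thesis using w(1) by (metis UnCI)
next
  case string: True
  have ne: "x \<noteq> []" using string by (auto simp: admissible_string_def strings_def)
  consider "\<not> punctured Q (hd x)" "\<not> punctured Q (last x)" |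
    "\<not> punctured Q (hd x)" "punctured Q (last x)" |
    "punctured Q (hd x)" "\<not> punctured Q (last x)" |
    "punctured Q (hd x)" "punctured Q (last x)" by blast
  then show ?thesis
  proof cases
    case 1
    then have "F_word Q x \<in> strings Q" "A_word Q (F_word Q x) = x"
      using admissible_unpunctured[OF Q string] by (simp_all add: A_word_def)
    then show ?thesis by (metis UnCI)
  next
    case 2
    then have "completion Q x \<in> strings Q" "A_word Q (completion Q x) = x"
      using admissible_right_punctured[OF Q string] by (simp_all add: A_word_def)
    then show ?thesis by (metis UnCI)
  next
    case 3
    have "punctured Q (linv z) = punctured Q z" for z :: "('a, 'b) letter"
      by (cases z) (auto simp: punctured_def)
    then have "\<not> punctured Q (hd (winv x))" "punctured Q (last (winv x))"
      using 3 ne by (simp_all add: winv_def hd_rev last_rev hd_map last_map)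
    then have "completion Q (winv x) \<in> strings Q" "A_word Q (completion Q (winv x)) = winv x"
      using admissible_right_punctured[OF Q admissible_string_winv[OF Q string]]
      by (simp_all add: A_word_def)
    then show ?thesis by (metis UnCI winv_winv)
  next
    case 4
    note w = admissible_punctured[OF Q string 4]
    then have "completion Q x \<notin> strings Q"
      using strings_not_bands by (auto simp: pbands_def)
    then have "completion Q x \<in> pbands' Q" "A_word Q (completion Q x) = x"
      using w by (simp_all add: pbands'_def A_word_def)
    then show ?thesis by (metis UnCI)
  qed
qed

theorem proposition3p1:
  fixes Q :: "('v, 'a) polarized_quiver"
  assumes "skewed_gentle Q"
  shows "(\<forall>x \<in> strings (hat Q) \<union> pbands (hat Q).
            admissible Q x \<longleftrightarrow>
              (\<exists>w \<in> strings Q \<union> pbands' Q. x = A_word Q w \<or> x = winv (A_word Q w))) \<and>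
         (\<forall>w \<in> strings Q \<union> pbands' Q.
            A_word Q w \<in> strings (hat Q) \<union> pbands (hat Q) \<and>
            admissible Q (A_word Q w) \<and>
            completion Q (A_word Q w) = w)"
  using A_word_admissible[OF assms] admissible_winv[OF assms] admissible_is_A_word[OF assms]
  by blast

end
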